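(* For all integers $\alpha\ge1$ and $n\ge0$, \[ b_{13}\!\left(4\cdot3^{2\alpha+1}n+\frac{17\cdot 3^{2\alpha}-1}{2}\right)\equiv 0\pmod 6,\qquad b_{13}\!\left(4\cdot3^{2\alpha}n+\frac{11\cdot 3^{2\alpha-1}-1}{2}\right)\equiv 0\pmod 6. \]
   Context: For a positive integer $\ell$, $b_\ell(n)$ denotes the number of partitions of $n$ having no part divisible by $\ell$. *)

theory Defs
  imports Main "HOL-Library.Multiset"
begin

definition b :: "nat \<Rightarrow> nat \<Rightarrow> nat" where
  "b l n = card {P :: nat multiset. (\<forall>x\<in>#P. 0 < x \<and> \<not> l dvd x) \<and> sum_mset P = n}"

end

theory Submission
  imports Defs "HOL-Computational_Algebra.Computational_Algebra" "HOL-Library.Z2"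
begin

text \<open>
  Write \<open>f\<^sub>k = \<Prod>(1 - q\<^bsup>kn\<^esup>)\<close> and \<open>F = f\<^sub>1\<^sub>3/f\<^sub>1 = \<Sum> b\<^sub>1\<^sub>3(n) q\<^sup>n\<close>. Both congruences come from modular equations
  of level 13 between \<open>f\<^sub>1\<close> and \<open>f\<^sub>1\<^sub>3\<close>.

  Modulo 3, \<open>f\<^sub>1\<^sup>2 + q f\<^sub>1\<^sub>3\<^sup>2 = f\<^sub>1 f\<^sub>1\<^sub>3 Y\<^sup>3\<close> for some series \<open>Y\<close>. As cubing is the substitution \<open>q \<mapsto> q\<^sup>3\<close>, this
  determines the trisection of \<open>F\<close>: the series \<open>V = \<Sum> b\<^sub>1\<^sub>3(3n+1) q\<^sup>n\<close> satisfies \<open>V\<^sup>2 (Y\<^sup>6 - q) = 1\<close>, so that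
  \<open>V = V\<^sup>3 (Y\<^sup>6 - q)\<close>. Hence \<open>b\<^sub>1\<^sub>3(9n+7) \<equiv> 0\<close> and \<open>b\<^sub>1\<^sub>3(9n+4) \<equiv> - b\<^sub>1\<^sub>3(3n+1)\<close>.

  Modulo 2, \<open>F = (1 + q F\<^sup>2) Z\<^sup>2\<close> with \<open>Z = f\<^sub>1\<^sup>6 + q\<^sup>3 f\<^sub>1\<^sub>3\<^sup>6\<close>, so \<open>b\<^sub>1\<^sub>3(2m)\<close> is the \<open>m\<close>-th coefficient of \<open>Z\<close>. As
  \<open>f\<^sub>1\<^sup>3\<close> is the generating function of the triangular numbers, it can be odd only if \<open>4m+1\<close> is \<open>y\<^sup>2\<close> or \<open>13 y\<^sup>2\<close>.

  The modular equations are consequences of the three-term relation for theta functions of level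
  13, which parametrises the 13-torsion of the Tate curve, together with the degenerate behaviour of
  its \<open>p\<close>-torsion in characteristic \<open>p\<close>.
\<close>

section \<open>Truncation and dilation of power series\<close>

text \<open>The six theta values of index 1, ..., 6 are grouped by the index pairs {1,5}, {2,3},
  {4,6}: up to sign, the cosets of {1,-1,5,-5} in the units modulo 13. Doubling permutes these
  cosets cyclically, so duplication leads from each pair to the next. In characteristic p, Frobenius
  and translation by the surviving p-torsion point together express multiplication by p. Relations
  between theta values thereby become equations between p-th powers, and p-th roots can be taken.
  The progressions are best seen through N = 2m + 1, where m is the argument of b_13: N is
  3^(2\<alpha>) (24n + 17) or 3^(2\<alpha>-1) (24n + 11). Modulo 3, the relation between b_13(9n+4)
  and b_13(3n+1) removes one factor 3 from N, until N = 3(6t + 5) is left. Modulo 2, N has even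
  3-adic valuation with cofactor 2 modulo 3, or odd valuation; neither occurs for y^2 or 13
  y^2.\<close>

lemma fps_X_power_dvd_iff:
  "fps_X ^ r dvd (f :: 'a::comm_ring_1 fps) \<longleftrightarrow> (\<forall>n<r. f $ n = 0)"
proof
  assume "fps_X ^ r dvd f"
  then obtain g where "f = fps_X ^ r * g" by (elim dvdE)
  then show "\<forall>n<r. f $ n = 0" by (simp add: fps_X_power_mult_nth)
next
  assume h: "\<forall>n<r. f $ n = 0"
  have "f = fps_X ^ r * fps_shift r f"
    by (rule fps_ext) (use h in \<open>simp add: fps_X_power_mult_nth\<close>)
  then show "fps_X ^ r dvd f" by (metis dvd_triv_left)
qed

text \<open>Takes the place of convergence: infinite products and sums are compared through
  congruences between finite truncations modulo X^N.\<close>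

lemma fps_eqI_X_power_dvd:
  assumes "\<And>N. fps_X ^ N dvd (f - g :: 'a::comm_ring_1 fps)"
  shows "f = g"
proof (rule fps_ext)
  fix n
  show "f $ n = g $ n" using assms[of "Suc n"] unfolding fps_X_power_dvd_iff by auto
qed

lemma dvd_diff_mult:
  fixes a b c d m :: "'a::comm_ring_1"
  assumes "m dvd a - b" "m dvd c - d"
  shows "m dvd a * c - b * d"
proof -
  have "a * c - b * d = (a - b) * c + b * (c - d)" by (simp add: algebra_simps)
  then show ?thesis using assms by (metis dvd_add dvd_mult dvd_mult2)
qed

lemma dvd_diff_swap:
  fixes a b m :: "'a::comm_ring_1"
  assumes "m dvd a - b"
  shows "m dvd b - a"
  using assms dvd_minus_iff[of m "a - b"] by simp

lemma dvd_diff_trans: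
  fixes a b c m :: "'a::comm_ring_1"
  assumes "m dvd a - b" "m dvd b - c"
  shows "m dvd a - c"
  using dvd_add[OF assms] by simp

lemma dvd_prod_diff_one:
  fixes f :: "'b \<Rightarrow> 'a::comm_ring_1"
  assumes "\<And>x. x \<in> A \<Longrightarrow> m dvd f x - 1"
  shows "m dvd prod f A - 1"
  using assms
proof (induction A rule: infinite_finite_induct)
  case (insert x A)
  then show ?case using dvd_diff_mult[of m "f x" 1 "prod f A" 1] by simp
qed auto

lemma fps_compose_X_power_nth:
  fixes f :: "'a::comm_ring_1 fps"
  assumes "d > 0"
  shows "(f oo fps_X ^ d) $ n = (if d dvd n then f $ (n div d) else 0)"
proof -
  have "(f oo fps_X ^ d) $ n = (\<Sum>i=0..n. f $ i * (if n = d * i then 1 else 0))"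
    by (simp add: fps_compose_nth flip: power_mult)
  also have "\<dots> = (\<Sum>i\<in>{i\<in>{0..n}. n = d * i}. f $ i)"
    by (rule sum.mono_neutral_cong_right) auto
  also have "{i\<in>{0..n}. n = d * i} = (if d dvd n then {n div d} else {})"
    using assms by auto
  finally show ?thesis by simp
qed

text \<open>The theta series live in X with q = X^(8Mc), to have integral exponents; this leads from
  an identity in X back to one in q.\<close>

lemma fps_compose_X_power_inject:
  fixes f g :: "'a::comm_ring_1 fps"
  assumes "d > 0" "f oo fps_X ^ d = g oo fps_X ^ d"
  shows "f = g"
proof (rule fps_ext)
  fix n
  have "(f oo fps_X ^ d) $ (d * n) = (g oo fps_X ^ d) $ (d * n)" using assms by simp
  then show "f $ n = g $ n" using assms(1) by (simp add: fps_compose_X_power_nth)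
qed

section \<open>Euler products\<close>

text \<open>Each coefficient is read off a finite product: factors beyond the index n cannot affect
  the coefficient of X^n.\<close>

definition eprod :: "nat set \<Rightarrow> 'a::comm_ring_1 fps" where
  "eprod S = Abs_fps (\<lambda>n. (\<Prod>k\<in>S \<inter> {1..n}. 1 - fps_X ^ k) $ n)"

lemma eprod_trunc:
  "fps_X ^ N dvd (eprod S - (\<Prod>k\<in>S \<inter> {1..N}. 1 - fps_X ^ k) :: 'a::comm_ring_1 fps)"
  unfolding fps_X_power_dvd_iff
proof (intro allI impI)
  fix n assume n: "n < N"
  define P where "P = (\<Prod>k\<in>S \<inter> {1..n}. 1 - fps_X ^ k :: 'a fps)"
  define R where "R = (\<Prod>k\<in>S \<inter> {Suc n..N}. 1 - fps_X ^ k :: 'a fps)"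
  have "S \<inter> {1..N} = (S \<inter> {1..n}) \<union> (S \<inter> {Suc n..N})" using n by auto
  then have split: "(\<Prod>k\<in>S \<inter> {1..N}. 1 - fps_X ^ k) = P * R"
    unfolding P_def R_def by (simp only:) (rule prod.union_disjoint, auto)
  have "fps_X ^ Suc n dvd R - 1"
    unfolding R_def by (rule dvd_prod_diff_one) (auto simp: le_imp_power_dvd simp del: power_Suc)
  then have "fps_X ^ Suc n dvd P * R - P * 1"
    by (intro dvd_diff_mult) auto
  then have "(P * R) $ n = P $ n"
    unfolding fps_X_power_dvd_iff by auto
  then show "(eprod S - (\<Prod>k\<in>S \<inter> {1..N}. 1 - fps_X ^ k :: 'a fps)) $ n = 0"
    unfolding split by (simp add: eprod_def P_def)
qed

text \<open>Allows truncation after a number of terms of an arithmetic progression, not just at a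
  bound on the exponent.\<close>

lemma eprod_trunc_superset:
  assumes "finite T" "S \<inter> {1..N} \<subseteq> T" "T \<subseteq> S" "0 \<notin> S"
  shows "fps_X ^ N dvd (eprod S - (\<Prod>k\<in>T. 1 - fps_X ^ k) :: 'a::comm_ring_1 fps)"
proof -
  let ?R = "T - (S \<inter> {1..N})"
  have split: "(\<Prod>k\<in>T. 1 - fps_X ^ k) =
      (\<Prod>k\<in>S \<inter> {1..N}. 1 - fps_X ^ k) * (\<Prod>k\<in>?R. 1 - fps_X ^ k :: 'a fps)"
    using prod.subset_diff[OF assms(2,1), of "\<lambda>k. 1 - fps_X ^ k :: 'a fps"] by (simp add: mult.commute)
  have "fps_X ^ N dvd (fps_X ^ k :: 'a fps)" if "k \<in> ?R" for k
    using that assms(3,4) by (intro le_imp_power_dvd) (cases k, auto simp: not_le)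
  then have "fps_X ^ N dvd (\<Prod>k\<in>?R. 1 - fps_X ^ k :: 'a fps) - 1"
    by (intro dvd_prod_diff_one) simp
  then have "fps_X ^ N dvd eprod S * 1 - (\<Prod>k\<in>T. 1 - fps_X ^ k :: 'a fps)"
    unfolding split by (intro dvd_diff_mult eprod_trunc dvd_diff_swap[of _ _ 1])
  then show ?thesis by simp
qed

lemma eprod_nth_0 [simp]: "eprod S $ 0 = 1"
  by (simp add: eprod_def)

lemma eprod_nonzero [simp]: "eprod S \<noteq> (0 :: 'a::comm_ring_1 fps)"
  by (metis eprod_nth_0 fps_zero_nth zero_neq_one)

lemma eprod_Un_disjoint:
  assumes "S \<inter> T = {}"
  shows "(eprod (S \<union> T) :: 'a::comm_ring_1 fps) = eprod S * eprod T"
proof (rule fps_eqI_X_power_dvd)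
  fix N
  have "(S \<union> T) \<inter> {1..N} = (S \<inter> {1..N}) \<union> (T \<inter> {1..N})" by auto
  then have "(\<Prod>k\<in>(S \<union> T) \<inter> {1..N}. 1 - fps_X ^ k :: 'a fps) =
      (\<Prod>k\<in>S \<inter> {1..N}. 1 - fps_X ^ k) * (\<Prod>k\<in>T \<inter> {1..N}. 1 - fps_X ^ k)"
    by (simp only:) (rule prod.union_disjoint, use assms in auto)
  then have "fps_X ^ N dvd
      (\<Prod>k\<in>(S \<union> T) \<inter> {1..N}. 1 - fps_X ^ k :: 'a fps) - eprod S * eprod T"
    by (simp only:) (intro dvd_diff_mult dvd_diff_swap[OF eprod_trunc])
  then show "fps_X ^ N dvd (eprod (S \<union> T) - eprod S * eprod T :: 'a fps)"
    by (rule dvd_diff_trans[OF eprod_trunc])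
qed

lemma eprod_image_times:
  assumes "d > 0" "0 \<notin> S"
  shows "(eprod ((*) d ` S) :: 'a::idom fps) = eprod S oo fps_X ^ d"
proof (rule fps_eqI_X_power_dvd)
  fix N
  have *: "((\<Prod>k\<in>T. 1 - fps_X ^ k) oo fps_X ^ d) = (\<Prod>k\<in>(*) d ` T. 1 - fps_X ^ k :: 'a fps)"
    if "finite T" for T
  proof -
    have "((1 - fps_X ^ k) oo fps_X ^ d) = (1 - fps_X ^ (d * k) :: 'a fps)" for k
      by (simp add: fps_compose_sub_distrib fps_X_power_compose power_mult assms(1))
    moreover have "(\<Prod>k\<in>(*) d ` T. 1 - fps_X ^ k :: 'a fps) = (\<Prod>k\<in>T. 1 - fps_X ^ (d * k))"
      by (rule prod.reindex_cong[of "(*) d"]) (use assms(1) in \<open>auto simp: inj_on_def\<close>)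
    ultimately show ?thesis
      by (subst fps_compose_prod_distrib) (use assms(1) in auto)
  qed
  have dil: "fps_X ^ M dvd ((f oo fps_X ^ d) - (g oo fps_X ^ d))" if "fps_X ^ M dvd f - g"
    for f g :: "'a fps" and M
    unfolding fps_X_power_dvd_iff
  proof (intro allI impI)
    fix n assume "n < M"
    moreover from this have "n div d < M" by (meson div_le_dividend le_less_trans)
    ultimately have "f $ n = g $ n" "f $ (n div d) = g $ (n div d)"
      using that by (auto simp: fps_X_power_dvd_iff)
    then show "((f oo fps_X ^ d) - (g oo fps_X ^ d)) $ n = 0"
      by (simp add: fps_compose_X_power_nth[OF assms(1)])
  qed
  let ?T = "S \<inter> {1..N}"
  have "fps_X ^ N dvd (eprod ((*) d ` S) - (\<Prod>k\<in>(*) d ` ?T. 1 - fps_X ^ k) :: 'a fps)"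
  proof (rule eprod_trunc_superset)
    show "(*) d ` S \<inter> {1..N} \<subseteq> (*) d ` ?T"
    proof
      fix m assume "m \<in> (*) d ` S \<inter> {1..N}"
      then obtain s where s: "m = d * s" "s \<in> S" "1 \<le> m" "m \<le> N" by auto
      then have "s \<le> m" "s \<ge> 1" using assms(1) by (auto simp: Suc_le_eq)
      then have "s \<in> ?T" using s(2) le_trans[OF _ s(4)] by simp
      with s(1) show "m \<in> (*) d ` ?T" by (rule image_eqI)
    qed
  qed (use assms in auto)
  moreover have "fps_X ^ N dvd
      ((eprod S oo fps_X ^ d) - (\<Prod>k\<in>(*) d ` ?T. 1 - fps_X ^ k) :: 'a fps)"
    using dil[OF eprod_trunc[of N S]] by (simp add: *)
  ultimately show "fps_X ^ N dvd (eprod ((*) d ` S) - (eprod S oo fps_X ^ d) :: 'a fps)"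
    using dvd_diff_trans dvd_diff_swap by blast
qed

section \<open>Formal sums of signed monomials\<close>

text \<open>Stands for the sum of s(i) X^(e(i)). An infinite fibre of e would silently contribute 0,
  hence the finiteness hypotheses in the rules that split or multiply such sums.\<close>

definition msum :: "'i set \<Rightarrow> ('i \<Rightarrow> 'a) \<Rightarrow> ('i \<Rightarrow> nat) \<Rightarrow> 'a::comm_ring_1 fps" where
  "msum I s e = Abs_fps (\<lambda>n. \<Sum>i | i \<in> I \<and> e i = n. s i)"

lemma msum_nth: "msum I s e $ n = (\<Sum>i | i \<in> I \<and> e i = n. s i)"
  by (simp add: msum_def)

lemma msum_reindex:
  assumes "bij_betw h I J" "\<And>i. i \<in> I \<Longrightarrow> s i = t (h i)" "\<And>i. i \<in> I \<Longrightarrow> e i = g (h i)"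
  shows "msum I s e = msum J t g"
proof (rule fps_ext)
  fix n
  have "bij_betw h {i. i \<in> I \<and> e i = n} {j. j \<in> J \<and> g j = n}"
    using assms(1,3) unfolding bij_betw_def inj_on_def by auto
  then have "(\<Sum>j | j \<in> J \<and> g j = n. t j) = (\<Sum>i | i \<in> I \<and> e i = n. t (h i))"
    by (rule sum.reindex_bij_betw[symmetric])
  also have "\<dots> = (\<Sum>i | i \<in> I \<and> e i = n. s i)"
    by (rule sum.cong) (auto simp: assms(2))
  finally show "msum I s e $ n = msum J t g $ n"
    by (simp add: msum_nth)
qed

lemma msum_Un_disjoint:
  assumes "I \<inter> J = {}" "\<And>n. finite {i. i \<in> I \<union> J \<and> e i = n}"
  shows "msum (I \<union> J) s e = msum I s e + msum J s e"
proof (rule fps_ext)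
  fix n
  have "{i. i \<in> I \<union> J \<and> e i = n} = {i. i \<in> I \<and> e i = n} \<union> {i. i \<in> J \<and> e i = n}" by auto
  moreover have "finite {i. i \<in> I \<and> e i = n}" "finite {i. i \<in> J \<and> e i = n}"
    by (rule finite_subset[OF _ assms(2)[of n]], auto)+
  ultimately show "msum (I \<union> J) s e $ n = (msum I s e + msum J s e) $ n"
    unfolding msum_nth fps_add_nth using assms(1)
    by (simp only:) (rule sum.union_disjoint, auto)
qed

lemma msum_uminus: "msum I (\<lambda>i. - s i) e = - msum I s e"
  by (rule fps_ext) (simp add: msum_nth sum_negf)

lemma fps_X_power_mult_msum: "fps_X ^ r * msum I s e = msum I s (\<lambda>i. e i + r)"
proof (rule fps_ext)
  fix n
  show "(fps_X ^ r * msum I s e) $ n = msum I s (\<lambda>i. e i + r) $ n"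
  proof (cases "n < r")
    case True
    then have "{i. i \<in> I \<and> e i + r = n} = {}" by auto
    then show ?thesis using True unfolding msum_nth fps_X_power_mult_nth by simp
  next
    case False
    then have "{i. i \<in> I \<and> e i + r = n} = {i. i \<in> I \<and> e i = n - r}" by auto
    then show ?thesis using False unfolding msum_nth fps_X_power_mult_nth by simp
  qed
qed

lemma msum_mult:
  assumes "\<And>n. finite {i. i \<in> I \<and> e i = n}" "\<And>n. finite {j. j \<in> J \<and> g j = n}"
  shows "msum I s e * msum J t g = msum (I \<times> J) (\<lambda>(i, j). s i * t j) (\<lambda>(i, j). e i + g j)"
proof (rule fps_ext)
  fix n
  let ?A = "\<lambda>m. {i. i \<in> I \<and> e i = m}" and ?B = "\<lambda>m. {j. j \<in> J \<and> g j = m}"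
  have "(msum I s e * msum J t g) $ n = (\<Sum>m=0..n. \<Sum>p\<in>?A m \<times> ?B (n - m). s (fst p) * t (snd p))"
    by (simp add: fps_mult_nth msum_nth sum_product sum.cartesian_product case_prod_unfold)
  also have "\<dots> = (\<Sum>p\<in>(\<Union>m\<in>{0..n}. ?A m \<times> ?B (n - m)). s (fst p) * t (snd p))"
    by (rule sum.UNION_disjoint[symmetric]) (use assms in auto)
  also have "(\<Union>m\<in>{0..n}. ?A m \<times> ?B (n - m)) = {p. p \<in> I \<times> J \<and> e (fst p) + g (snd p) = n}"
    by force
  finally show "(msum I s e * msum J t g) $ n =
      msum (I \<times> J) (\<lambda>(i, j). s i * t j) (\<lambda>(i, j). e i + g j) $ n"
    by (simp add: msum_nth case_prod_unfold)
qed

lemma msum_compose_X_power: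
  assumes "d > 0"
  shows "msum I s e oo fps_X ^ d = msum I s (\<lambda>i. d * e i)"
proof (rule fps_ext)
  fix n
  show "(msum I s e oo fps_X ^ d) $ n = msum I s (\<lambda>i. d * e i) $ n"
  proof (cases "d dvd n")
    case True
    then have "{i. i \<in> I \<and> d * e i = n} = {i. i \<in> I \<and> e i = n div d}" using assms by auto
    then show ?thesis using True assms by (simp add: fps_compose_X_power_nth msum_nth)
  next
    case False
    then have "{i. i \<in> I \<and> d * e i = n} = {}" by auto
    then show ?thesis using False unfolding fps_compose_X_power_nth[OF assms] msum_nth
      by (simp only: if_False sum.empty)
  qed
qed

lemma msum_trunc:
  assumes "finite J" "J \<subseteq> I" "\<And>i. i \<in> I - J \<Longrightarrow> e i \<ge> N"
  shows "fps_X ^ N dvd (msum I s e - (\<Sum>i\<in>J. fps_const (s i) * fps_X ^ e i))"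
  unfolding fps_X_power_dvd_iff
proof (intro allI impI)
  fix n assume n: "n < N"
  have "{i. i \<in> I \<and> e i = n} = {i \<in> J. e i = n}"
    using assms(2,3) n by (auto simp: not_le) (metis DiffI leD)
  moreover have "(\<Sum>i\<in>J. fps_const (s i) * fps_X ^ e i) $ n = (\<Sum>i\<in>{i \<in> J. e i = n}. s i)"
    using assms(1) by (auto simp: fps_sum_nth sum.inter_filter intro!: sum.cong)
  ultimately show "(msum I s e - (\<Sum>i\<in>J. fps_const (s i) * fps_X ^ e i)) $ n = 0"
    by (simp add: msum_nth)
qed

section \<open>The Jacobi triple product\<close>

text \<open>The Gaussian binomial coefficient of base p, by its Pascal recursion, which is free of
  division.\<close>

fun gauss :: "'a::comm_ring_1 \<Rightarrow> nat \<Rightarrow> nat \<Rightarrow> 'a" where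
  "gauss p n 0 = 1"
| "gauss p 0 (Suc k) = 0"
| "gauss p (Suc n) (Suc k) = gauss p n k + p ^ Suc k * gauss p n (Suc k)"

lemma gauss_eq_0: "n < k \<Longrightarrow> gauss p n k = 0"
  by (induction p n k rule: gauss.induct) auto

text \<open>The q-binomial theorem, kept homogeneous so that a power of X substituted for y later
  clears all negative exponents. The induction removes the factor i = 0 and absorbs p into
  x.\<close>

lemma gauss_binomial:
  fixes x y p :: "'a::comm_ring_1"
  shows "(\<Prod>i<n. y + x * p ^ i) = (\<Sum>j\<le>n. p ^ (j choose 2) * gauss p n j * x ^ j * y ^ (n - j))"
proof (induction n arbitrary: x)
  case (Suc n)
  let ?c = "\<lambda>n j. p ^ (j choose 2) * gauss p n j"
  have ch: "Suc j choose 2 = (j choose 2) + j" for j by (simp add: numeral_2_eq_2)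
  have "(\<Prod>i<Suc n. y + x * p ^ i) = (y + x) * (\<Prod>i<n. y + (x * p) * p ^ i)"
    by (simp add: prod.lessThan_Suc_shift mult.assoc del: prod.lessThan_Suc)
  also have "\<dots> = (\<Sum>j\<le>n. ?c n j * p ^ j * x ^ j * y ^ (Suc n - j)) +
      (\<Sum>j\<le>n. ?c n j * p ^ j * x ^ Suc j * y ^ (n - j))"
    unfolding Suc.IH sum_distrib_left sum.distrib[symmetric]
    by (rule sum.cong) (auto simp: algebra_simps Suc_diff_le power_mult_distrib)
  also have "(\<Sum>j\<le>n. ?c n j * p ^ j * x ^ j * y ^ (Suc n - j)) =
      (\<Sum>j\<le>Suc n. ?c n j * p ^ j * x ^ j * y ^ (Suc n - j))"
    by (simp add: gauss_eq_0)
  also have "\<dots> = y ^ Suc n + (\<Sum>j\<le>n. ?c n (Suc j) * p ^ Suc j * x ^ Suc j * y ^ (n - j))"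
    by (subst sum.atMost_Suc_shift) (simp add: numeral_2_eq_2)
  also have "\<dots> + (\<Sum>j\<le>n. ?c n j * p ^ j * x ^ Suc j * y ^ (n - j)) =
      y ^ Suc n + (\<Sum>j\<le>n. ?c (Suc n) (Suc j) * x ^ Suc j * y ^ (n - j))"
    unfolding add.assoc sum.distrib[symmetric]
    by (rule arg_cong[of _ _ "(+) (y ^ Suc n)"], rule sum.cong) (auto simp: ch power_add algebra_simps)
  also have "\<dots> = (\<Sum>j\<le>Suc n. ?c (Suc n) j * x ^ j * y ^ (Suc n - j))"
    by (subst sum.atMost_Suc_shift) (simp add: numeral_2_eq_2)
  finally show ?case .
qed (simp add: numeral_2_eq_2)

lemma gauss_mult_prod:
  fixes p :: "'a::comm_ring_1"
  assumes "k \<le> n"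
  shows "gauss p n k * (\<Prod>i=1..k. 1 - p ^ i) = (\<Prod>i=Suc (n - k)..n. 1 - p ^ i)"
  using assms
proof (induction n arbitrary: k)
  case (Suc n)
  show ?case
  proof (cases k)
    case (Suc j)
    then have j: "j \<le> n" using Suc.prems by simp
    define D where "D = (\<Prod>i=Suc (n - j)..n. 1 - p ^ i)"
    have IH: "gauss p n j * (\<Prod>i=1..j. 1 - p ^ i) = D" using Suc.IH[OF j] by (simp add: D_def)
    have IH': "gauss p n (Suc j) * (\<Prod>i=1..Suc j. 1 - p ^ i) = D * (1 - p ^ (n - j))"
    proof (cases "j = n")
      case False
      then have "Suc j \<le> n" using j by simp
      then have "gauss p n (Suc j) * (\<Prod>i=1..Suc j. 1 - p ^ i) = (\<Prod>i=Suc (n - Suc j)..n. 1 - p ^ i)"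
        by (rule Suc.IH)
      also have "Suc (n - Suc j) = n - j" using False j by simp
      also have "(\<Prod>i=n - j..n. 1 - p ^ i) = (1 - p ^ (n - j)) * D"
        unfolding D_def by (rule prod.atLeast_Suc_atMost) simp
      finally show ?thesis by (simp add: mult.commute)
    qed (simp add: gauss_eq_0)
    have "gauss p (Suc n) (Suc j) * (\<Prod>i=1..Suc j. 1 - p ^ i) =
        (gauss p n j * (\<Prod>i=1..j. 1 - p ^ i)) * (1 - p ^ Suc j) +
        p ^ Suc j * (gauss p n (Suc j) * (\<Prod>i=1..Suc j. 1 - p ^ i))"
      by (simp add: algebra_simps)
    also have "\<dots> = D * (1 - p ^ Suc j) + p ^ Suc j * (D * (1 - p ^ (n - j)))"
      unfolding IH IH' ..
    also have "\<dots> = D * (1 - p ^ (Suc j + (n - j)))"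
      by (simp only: power_add) (simp add: algebra_simps)
    also have "\<dots> = D * (1 - p ^ Suc n)" using j by simp
    also have "\<dots> = (\<Prod>i=Suc (n - j)..Suc n. 1 - p ^ i)"
      using j by (simp add: D_def)
    finally show ?thesis using Suc by simp
  qed simp
qed simp

definition alt :: "int \<Rightarrow> 'a::comm_ring_1" where
  "alt k = (if even k then 1 else - 1)"

text \<open>The exponent in the Jacobi triple product of base q^M at q^a. By
  \<open>jexp_bounds\<close> it is nonnegative for 0 < a < M, so \<open>nat\<close> loses
  nothing.\<close>

definition jexp :: "nat \<Rightarrow> nat \<Rightarrow> int \<Rightarrow> nat" where
  "jexp M a k = nat (int M * (k * (k - 1) div 2) + int a * k)"

text \<open>Both bounds express that (|k| - 1)(|k| - 2) is nonnegative at integers.\<close>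

lemma tri_bounds:
  fixes k :: int
  shows "\<bar>k\<bar> - 1 \<le> k * (k - 1) div 2" "k < 0 \<Longrightarrow> \<bar>k\<bar> - 1 \<le> k * (k - 1) div 2 + k"
proof -
  have sq: "0 \<le> (\<bar>k\<bar> - 1) * (\<bar>k\<bar> - 2)"
    by (cases "k = 0"; cases "\<bar>k\<bar> = 1") (auto intro!: mult_nonneg_nonneg)
  have t: "2 * (k * (k - 1) div 2) = k * k - k" by (simp add: algebra_simps)
  show "\<bar>k\<bar> - 1 \<le> k * (k - 1) div 2" "k < 0 \<Longrightarrow> \<bar>k\<bar> - 1 \<le> k * (k - 1) div 2 + k"
    using t sq by (auto simp: algebra_simps abs_if split: if_splits)
qed

lemma jexp_bounds:
  assumes "0 < a" "a < M"
  shows "int (jexp M a k) = int M * (k * (k - 1) div 2) + int a * k"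
    and "int M * (\<bar>k\<bar> - 1) \<le> int (jexp M a k)"
proof -
  let ?t = "k * (k - 1) div 2"
  have "int M * (\<bar>k\<bar> - 1) \<le> int M * ?t + int a * k \<and> 0 \<le> int M * ?t + int a * k"
  proof (cases "k < 0")
    case True
    have "int M * (\<bar>k\<bar> - 1) \<le> int M * (?t + k)"
      using tri_bounds(2)[OF True] by (intro mult_left_mono) auto
    moreover have "int M * k \<le> int a * k" using True assms by (intro mult_right_mono_neg) auto
    moreover have "0 \<le> int M * (\<bar>k\<bar> - 1)" using True by simp
    ultimately show ?thesis by (simp only: distrib_left) linarith
  next
    case False
    have "int M * (\<bar>k\<bar> - 1) \<le> int M * ?t"
      using tri_bounds(1) by (intro mult_left_mono) auto
    moreover have "0 \<le> int M * ?t"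
      using False by (cases "k = 0") (auto simp: pos_imp_zdiv_nonneg_iff)
    moreover have "0 \<le> int a * k" using False by simp
    ultimately show ?thesis by linarith
  qed
  then show "int (jexp M a k) = int M * ?t + int a * k" "int M * (\<bar>k\<bar> - 1) \<le> int (jexp M a k)"
    by (simp_all add: jexp_def)
qed

lemma jexp_double:
  assumes "0 < a" "a < M"
  shows "int M * (k * (k - 1)) + 2 * int a * k = 2 * int (jexp M a k)"
proof -
  have t: "k * (k - 1) = 2 * (k * (k - 1) div 2)" by simp
  have "int M * (k * (k - 1)) + 2 * int a * k = 2 * (int M * (k * (k - 1) div 2) + int a * k)"
    by (subst t) (simp only: distrib_left mult_ac)
  then show ?thesis by (simp only: jexp_bounds(1)[OF assms])
qed

lemma alt_diff: "alt (int j - int N) = (-1) ^ (N + j)"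
  by (simp add: alt_def)

text \<open>Apply the q-binomial theorem to the 2N factors y - X^a p^i with p = X^M and y = X^(MN).
  In the first N factors X^(a+Mi) can be pulled out with a sign, in the last N factors y; the two
  products remain.\<close>

lemma finite_triple_product:
  fixes M a N :: nat
  assumes "0 < a" "a < M"
  shows "(\<Prod>n<N. 1 - fps_X ^ (a + M * n)) * (\<Prod>n=1..N. 1 - fps_X ^ (M * n - a)) =
    (\<Sum>j\<le>2 * N. alt (int j - int N) * fps_X ^ jexp M a (int j - int N) *
       gauss (fps_X ^ M) (2 * N) j :: 'a::idom fps)"
proof -
  let ?p = "fps_X ^ M :: 'a fps" and ?x = "- (fps_X ^ a) :: 'a fps" and ?y = "fps_X ^ (M * N) :: 'a fps"
  define K where "K = (\<Sum>i<N. a + M * i) + M * N * N"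
  let ?A = "\<Prod>n<N. 1 - fps_X ^ (a + M * n) :: 'a fps"
  let ?B = "\<Prod>n=1..N. 1 - fps_X ^ (M * n - a) :: 'a fps"
  have low: "(\<Prod>i<N. ?y + ?x * ?p ^ i) = (-1) ^ N * fps_X ^ (\<Sum>i<N. a + M * i) * ?B"
  proof -
    have "?y + ?x * ?p ^ i = (- 1) * fps_X ^ (a + M * i) * (1 - fps_X ^ (M * (N - i) - a))"
      if "i < N" for i
    proof -
      have "M * 1 \<le> M * (N - i)" using that by (intro mult_le_mono2) simp
      then have "a \<le> M * (N - i)" using assms(2) by linarith
      then have "(a + M * i) + (M * (N - i) - a) = M * (i + (N - i))"
        unfolding add_mult_distrib2 by linarith
      then have "fps_X ^ (a + M * i) * fps_X ^ (M * (N - i) - a) = (?y :: 'a fps)"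
        using that by (simp flip: power_add)
      then show ?thesis by (simp add: algebra_simps power_add power_mult)
    qed
    then have "(\<Prod>i<N. ?y + ?x * ?p ^ i) =
        (\<Prod>i<N. (- 1) * fps_X ^ (a + M * i) * (1 - fps_X ^ (M * (N - i) - a)))"
      by (intro prod.cong) auto
    also have "\<dots> = (-1) ^ N * fps_X ^ (\<Sum>i<N. a + M * i) * (\<Prod>i<N. 1 - fps_X ^ (M * (N - i) - a))"
      by (simp only: prod.distrib power_sum[symmetric]) simp
    also have "(\<Prod>i<N. 1 - fps_X ^ (M * (N - i) - a)) = ?B"
      by (rule prod.reindex_bij_witness[of _ "\<lambda>n. N - n" "\<lambda>i. N - i"]) auto
    finally show ?thesis .
  qed
  have high: "(\<Prod>i=N..<2 * N. ?y + ?x * ?p ^ i) = fps_X ^ (M * N * N) * ?A"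
  proof -
    have "(\<Prod>i=N..<2 * N. ?y + ?x * ?p ^ i) = (\<Prod>i<N. ?y + ?x * ?p ^ (N + i))"
      by (rule prod.reindex_bij_witness[of _ "\<lambda>n. N + n" "\<lambda>i. i - N"]) auto
    also have "\<dots> = (\<Prod>i<N. ?y * (1 - fps_X ^ (a + M * i)))"
    proof (rule prod.cong)
      fix i
      have "fps_X ^ a * ?p ^ (N + i) = ?y * fps_X ^ (a + M * i)"
        unfolding power_mult[symmetric] power_add[symmetric]
        by (rule arg_cong[of _ _ "power fps_X"]) (simp add: algebra_simps)
      then show "?y + ?x * ?p ^ (N + i) = ?y * (1 - fps_X ^ (a + M * i))"
        by (simp add: right_diff_distrib)
    qed simp
    also have "\<dots> = ?y ^ N * ?A" by (simp add: prod.distrib)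
    finally show ?thesis by (simp add: power_mult)
  qed
  have sumK: "2 * int (\<Sum>i<N. a + M * i) = 2 * int a * int N + int M * int N * (int N - 1)"
    by (induction N) (auto simp: algebra_simps)
  \<comment> \<open>K is the total exponent pulled out of the factors. The equality is checked after
    doubling, so that binomial coefficients and triangular numbers lose their denominators.\<close>
  have expo: "M * (j choose 2) + a * j + M * N * (2 * N - j) = K + jexp M a (int j - int N)"
    if "j \<le> 2 * N" for j
  proof -
    have c2: "2 * int (j choose 2) = int j * (int j - 1)"
    proof -
      have "even (j * (j - 1))" by (cases "even j") auto
      then have "2 * (j choose 2) = j * (j - 1)" unfolding choose_two by simp
      then have "2 * int (j choose 2) = int (j * (j - 1))" by linarith
      then show ?thesis by (cases j) (auto simp: algebra_simps)
    qed
    have K2: "2 * int K = 2 * int a * int N + int M * int N * (int N - 1) + 2 * int M * int N * int N"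
      using sumK by (simp add: K_def)
    have "2 * int (M * (j choose 2) + a * j + M * N * (2 * N - j)) =
        int M * (2 * int (j choose 2)) + 2 * int a * int j + 2 * int M * int N * (2 * int N - int j)"
    proof -
      have d: "int (2 * N - j) = 2 * int N - int j" using that by (simp add: of_nat_diff)
      show ?thesis unfolding of_nat_add of_nat_mult d by (simp add: algebra_simps)
    qed
    also have "\<dots> = int M * (int j * (int j - 1)) + 2 * int a * int j + 2 * int M * int N * (2 * int N - int j)"
      unfolding c2 ..
    also have "\<dots> = 2 * int K + int M * ((int j - int N) * (int j - int N - 1)) + 2 * int a * (int j - int N)"
      unfolding K2 by (simp add: algebra_simps)
    also have "\<dots> = 2 * int (K + jexp M a (int j - int N))"
      using jexp_double[OF assms, of "int j - int N"] by simp
    finally show ?thesis by (metis mult_cancel_left of_nat_eq_iff zero_neq_numeral)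
  qed
  have "(-1) ^ N * fps_X ^ K * (?A * ?B) = (\<Prod>i<2 * N. ?y + ?x * ?p ^ i)"
  proof -
    have "(\<Prod>i<2 * N. ?y + ?x * ?p ^ i) = (\<Prod>i<N. ?y + ?x * ?p ^ i) * (\<Prod>i=N..<2 * N. ?y + ?x * ?p ^ i)"
      unfolding lessThan_atLeast0 by (rule prod.atLeastLessThan_concat[symmetric]) auto
    then show ?thesis unfolding low high K_def by (simp only: power_add mult_ac)
  qed
  also have "\<dots> = (\<Sum>j\<le>2 * N. ?p ^ (j choose 2) * gauss ?p (2 * N) j * ?x ^ j * ?y ^ (2 * N - j))"
    by (rule gauss_binomial)
  also have "\<dots> = (\<Sum>j\<le>2 * N. (-1) ^ N * fps_X ^ K *
      (alt (int j - int N) * fps_X ^ jexp M a (int j - int N) * gauss ?p (2 * N) j))"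
  proof (rule sum.cong)
    fix j assume "j \<in> {..2 * N}"
    then have j: "j \<le> 2 * N" by simp
    have "?p ^ (j choose 2) * gauss ?p (2 * N) j * ?x ^ j * ?y ^ (2 * N - j) =
        (-1) ^ j * fps_X ^ (M * (j choose 2) + a * j + M * N * (2 * N - j)) * gauss ?p (2 * N) j"
      by (simp only: power_minus[of "fps_X ^ a"] power_mult[symmetric] power_add mult_ac)
    also have "\<dots> = (-1) ^ j * (fps_X ^ K * fps_X ^ jexp M a (int j - int N)) * gauss ?p (2 * N) j"
      unfolding expo[OF j] power_add ..
    also have "(-1 :: 'a fps) ^ j = (-1) ^ N * alt (int j - int N)"
    proof -
      have "(-1 :: 'a fps) ^ N * (-1) ^ N = 1" by (simp only: power_mult_distrib[symmetric]) simp
      then show ?thesis unfolding alt_diff power_add mult.assoc[symmetric] by simp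
    qed
    finally show "?p ^ (j choose 2) * gauss ?p (2 * N) j * ?x ^ j * ?y ^ (2 * N - j) =
        (-1) ^ N * fps_X ^ K * (alt (int j - int N) * fps_X ^ jexp M a (int j - int N) * gauss ?p (2 * N) j)"
      by (simp only: mult_ac)
  qed simp
  finally show ?thesis
    unfolding sum_distrib_left[symmetric] by simp
qed

text \<open>Gaussian coefficients away from both ends of the row approach the reciprocal of the
  Euler product; the order of the error is set by the distance of j to the nearer end.\<close>

lemma gauss_trunc:
  fixes M N j :: nat
  assumes "M > 0" "j \<le> 2 * N"
  shows "fps_X ^ (M * min j (2 * N - j)) dvd
    (eprod {n. n > 0 \<and> M dvd n} * gauss (fps_X ^ M) (2 * N) j - 1 :: 'a::comm_ring_1 fps)"
proof -
  let ?r = "M * min j (2 * N - j)" and ?f = "eprod {n. n > 0 \<and> M dvd n} :: 'a fps"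
  let ?g = "gauss (fps_X ^ M) (2 * N) j :: 'a fps"
  have "fps_X ^ ?r dvd ?f - (\<Prod>k\<in>(*) M ` {1..j}. 1 - fps_X ^ k)"
  proof (rule eprod_trunc_superset)
    show "{n. n > 0 \<and> M dvd n} \<inter> {1..?r} \<subseteq> (*) M ` {1..j}"
    proof
      fix n assume n: "n \<in> {n. n > 0 \<and> M dvd n} \<inter> {1..?r}"
      then obtain i where i: "n = M * i" by auto
      with n assms(1) have "i \<le> min j (2 * N - j)" "i \<ge> 1" by (auto simp: Suc_le_eq)
      then show "n \<in> (*) M ` {1..j}" using i by auto
    qed
  qed (use assms in auto)
  also have "(\<Prod>k\<in>(*) M ` {1..j}. 1 - fps_X ^ k :: 'a fps) = (\<Prod>i=1..j. 1 - (fps_X ^ M) ^ i)"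
    by (rule prod.reindex_cong[of "(*) M"]) (use assms in \<open>auto simp: inj_on_def power_mult\<close>)
  finally have "fps_X ^ ?r dvd ?f * ?g - (\<Prod>i=1..j. 1 - (fps_X ^ M) ^ i) * ?g"
    by (rule dvd_diff_mult) simp
  also have "(\<Prod>i=1..j. 1 - (fps_X ^ M) ^ i) * ?g = (\<Prod>i=Suc (2 * N - j)..2 * N. 1 - (fps_X ^ M) ^ i)"
    using gauss_mult_prod[OF assms(2), of "fps_X ^ M :: 'a fps"] by (simp add: mult.commute)
  finally show ?thesis
  proof (rule dvd_diff_trans)
    show "fps_X ^ ?r dvd (\<Prod>i=Suc (2 * N - j)..2 * N. 1 - (fps_X ^ M) ^ i :: 'a fps) - 1"
    proof (rule dvd_prod_diff_one)
      fix i assume "i \<in> {Suc (2 * N - j)..2 * N}"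
      then have "?r \<le> M * i" by (intro mult_le_mono2) auto
      then show "fps_X ^ ?r dvd (1 - (fps_X ^ M) ^ i - 1 :: 'a fps)"
        by (simp add: le_imp_power_dvd flip: power_mult)
    qed
  qed
qed

theorem jacobi_triple_product:
  fixes M a :: nat
  assumes "0 < a" "a < M"
  shows "msum (UNIV :: int set) alt (jexp M a) =
    (eprod {n. n > 0 \<and> M dvd n} * eprod {n. n mod M = a} * eprod {n. n mod M = M - a} :: 'a::idom fps)"
proof (rule fps_eqI_X_power_dvd)
  fix L
  \<comment> \<open>For k = j - N the exponent is at least M(|k| - 1) and the Gaussian coefficient
    is exact up to order M(N - |k|). These add up to M(N - 1) = ML, hence the shift by one.\<close>
  define N where "N = Suc L"
  let ?f = "eprod {n. n > 0 \<and> M dvd n} :: 'a fps"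
  have M2: "M \<ge> 2" "M > 0" using assms by auto
  have LM: "L \<le> M * L" "N \<le> M * N" using M2 by auto
  have T1: "fps_X ^ L dvd eprod {n. n mod M = a} - (\<Prod>n<N. 1 - fps_X ^ (a + M * n) :: 'a fps)"
  proof -
    have "fps_X ^ L dvd eprod {n. n mod M = a} - (\<Prod>k\<in>(\<lambda>n. a + M * n) ` {..<N}. 1 - fps_X ^ k :: 'a fps)"
    proof (rule eprod_trunc_superset)
      show "{n. n mod M = a} \<inter> {1..L} \<subseteq> (\<lambda>n. a + M * n) ` {..<N}"
      proof
        fix n assume n: "n \<in> {n. n mod M = a} \<inter> {1..L}"
        then have "n = a + M * (n div M)" using mod_mult_div_eq[of n M] by simp
        moreover have "n div M < N" using n le_trans[OF div_le_dividend, of n L M] unfolding N_def by (simp add: less_Suc_eq_le)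
        ultimately show "n \<in> (\<lambda>n. a + M * n) ` {..<N}" by blast
      qed
    qed (use assms in auto)
    also have "(\<Prod>k\<in>(\<lambda>n. a + M * n) ` {..<N}. 1 - fps_X ^ k :: 'a fps) = (\<Prod>n<N. 1 - fps_X ^ (a + M * n))"
      by (rule prod.reindex_cong[of "\<lambda>n. a + M * n"]) (use M2 in \<open>auto simp: inj_on_def\<close>)
    finally show ?thesis .
  qed
  have T2: "fps_X ^ L dvd eprod {n. n mod M = M - a} - (\<Prod>n=1..N. 1 - fps_X ^ (M * n - a) :: 'a fps)"
  proof -
    have mn: "M * Suc n - a = (M - a) + M * n" for n using assms by simp
    have "fps_X ^ L dvd eprod {n. n mod M = M - a} - (\<Prod>k\<in>(\<lambda>n. (M - a) + M * n) ` {..<N}. 1 - fps_X ^ k :: 'a fps)"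
    proof (rule eprod_trunc_superset)
      show "{n. n mod M = M - a} \<inter> {1..L} \<subseteq> (\<lambda>n. (M - a) + M * n) ` {..<N}"
      proof
        fix n assume n: "n \<in> {n. n mod M = M - a} \<inter> {1..L}"
        then have "n = (M - a) + M * (n div M)" using mod_mult_div_eq[of n M] by simp
        moreover have "n div M < N" using n le_trans[OF div_le_dividend, of n L M] unfolding N_def by (simp add: less_Suc_eq_le)
        ultimately show "n \<in> (\<lambda>n. (M - a) + M * n) ` {..<N}" by blast
      qed
    next
      have "((M - a) + M * n) mod M = M - a" for n
        unfolding mod_mult_self2 using assms by simp
      then show "(\<lambda>n. (M - a) + M * n) ` {..<N} \<subseteq> {n. n mod M = M - a}" by blast
    qed (use assms in auto)
    also have "(\<Prod>k\<in>(\<lambda>n. (M - a) + M * n) ` {..<N}. 1 - fps_X ^ k :: 'a fps) =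
        (\<Prod>n<N. 1 - fps_X ^ ((M - a) + M * n))"
      by (rule prod.reindex_cong[of "\<lambda>n. (M - a) + M * n"]) (use M2 in \<open>auto simp: inj_on_def\<close>)
    also have "\<dots> = (\<Prod>n=1..N. 1 - fps_X ^ (M * n - a))"
      unfolding mn[symmetric]
      by (rule prod.reindex_bij_witness[of _ "\<lambda>n. n - 1" Suc]) auto
    finally show ?thesis .
  qed
  let ?t = "\<lambda>j. alt (int j - int N) * fps_X ^ jexp M a (int j - int N) :: 'a fps"
  have T3: "fps_X ^ L dvd (\<Sum>j\<le>2 * N. ?t j * (?f * gauss (fps_X ^ M) (2 * N) j)) - (\<Sum>j\<le>2 * N. ?t j)"
    unfolding sum_subtractf[symmetric]
  proof (rule dvd_sum)
    fix j assume "j \<in> {..2 * N}"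
    then have j: "j \<le> 2 * N" by simp
    let ?k = "int j - int N" and ?m = "min j (2 * N - j)"
    have "int ?m = int N - \<bar>?k\<bar>" using j by (auto simp: min_def of_nat_diff)
    then have "\<bar>?k\<bar> - 1 + int ?m = int L" unfolding N_def by simp
    then have "int M * (\<bar>?k\<bar> - 1) + int M * int ?m = int (M * L)"
      unfolding distrib_left[symmetric] by simp
    then have "int (M * L) \<le> int (jexp M a ?k + M * ?m)"
      using jexp_bounds(2)[OF assms, of ?k] by simp
    then have le: "L \<le> jexp M a ?k + M * ?m" using LM(1) by linarith
    have "fps_X ^ L dvd (fps_X ^ jexp M a ?k * fps_X ^ (M * ?m) :: 'a fps)"
      unfolding power_add[symmetric] by (rule le_imp_power_dvd[OF le])
    also have "\<dots> dvd fps_X ^ jexp M a ?k * (?f * gauss (fps_X ^ M) (2 * N) j - 1)"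
      by (intro mult_dvd_mono dvd_refl gauss_trunc j M2)
    also have "\<dots> dvd alt ?k * (fps_X ^ jexp M a ?k * (?f * gauss (fps_X ^ M) (2 * N) j - 1))"
      by simp
    also have "\<dots> = ?t j * (?f * gauss (fps_X ^ M) (2 * N) j) - ?t j"
      by (simp add: algebra_simps)
    finally show "fps_X ^ L dvd ?t j * (?f * gauss (fps_X ^ M) (2 * N) j) - ?t j" .
  qed
  have T4: "fps_X ^ L dvd msum UNIV alt (jexp M a) - (\<Sum>j\<le>2 * N. ?t j)"
  proof -
    have "fps_X ^ L dvd msum UNIV alt (jexp M a) -
        (\<Sum>k\<in>{- int N..int N}. fps_const (alt k) * fps_X ^ jexp M a k :: 'a fps)"
    proof (rule msum_trunc)
      fix k :: int assume "k \<in> UNIV - {- int N..int N}"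
      then have "int N \<le> \<bar>k\<bar> - 1" by auto
      then have "int M * int N \<le> int M * (\<bar>k\<bar> - 1)" by (intro mult_left_mono) auto
      then have "int (M * N) \<le> int (jexp M a k)" using jexp_bounds(2)[OF assms, of k] by simp
      then show "L \<le> jexp M a k" using LM(2) unfolding N_def by linarith
    qed auto
    also have "(\<Sum>k\<in>{- int N..int N}. fps_const (alt k) * fps_X ^ jexp M a k :: 'a fps) = (\<Sum>j\<le>2 * N. ?t j)"
      by (rule sum.reindex_bij_witness[of _ "\<lambda>j. int j - int N" "\<lambda>k. nat (k + int N)"])
        (auto simp: alt_def)
    finally show ?thesis .
  qed
  have "?f * ((\<Prod>n<N. 1 - fps_X ^ (a + M * n)) * (\<Prod>n=1..N. 1 - fps_X ^ (M * n - a))) =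
      (\<Sum>j\<le>2 * N. ?t j * (?f * gauss (fps_X ^ M) (2 * N) j))"
    unfolding finite_triple_product[OF assms] sum_distrib_left by (rule sum.cong) (auto simp: algebra_simps)
  then have "fps_X ^ L dvd ?f * (eprod {n. n mod M = a} * eprod {n. n mod M = M - a}) -
      (\<Sum>j\<le>2 * N. ?t j * (?f * gauss (fps_X ^ M) (2 * N) j))"
    using dvd_diff_mult[OF _ dvd_diff_mult[OF T1 T2], of ?f ?f] by simp
  from dvd_diff_trans[OF T4 dvd_diff_swap[OF dvd_diff_trans[OF this T3]]]
  show "fps_X ^ L dvd msum UNIV alt (jexp M a) -
      (?f * eprod {n. n mod M = a} * eprod {n. n mod M = M - a})"
    by (simp add: mult.assoc)
qed

text \<open>By \<open>frob\<close>, Frobenius fixes the coefficients and only dilates. The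
  freshman's dream is applied to the truncation \<open>t\<close>; the p-th power of the tail starts
  beyond the index n.\<close>

lemma fps_power_char:
  fixes f :: "'a::idom fps"
  assumes p: "prime p" "CHAR('a) = p" and frob: "\<And>c :: 'a. c ^ p = c"
  shows "f ^ p = f oo fps_X ^ p"
proof (rule fps_ext)
  fix n
  have p0: "p > 0" using p(1) prime_gt_0_nat by simp
  have char: "CHAR('a fps) = p" using p(2) by simp
  define N where "N = Suc n"
  define t where "t = (\<Sum>i<N. fps_const (f $ i) * fps_X ^ i)"
  have "fps_X ^ N dvd f - t"
    unfolding fps_X_power_dvd_iff by (auto simp: t_def fps_sum_nth if_distrib[of "(*) _"] cong: if_cong)
  then obtain g where "f - t = fps_X ^ N * g" by (elim dvdE)
  then have "f = t + fps_X ^ N * g" by (simp add: algebra_simps)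
  then have "f ^ p = (t + fps_X ^ N * g) ^ p" by (rule arg_cong)
  also have "\<dots> = t ^ p + (fps_X ^ N * g) ^ p"
    by (rule freshmans_dream) (use p char in auto)
  finally have "f ^ p = t ^ p + (fps_X ^ N * g) ^ p" .
  moreover have "t ^ p = (\<Sum>i<N. fps_const (f $ i) * fps_X ^ (p * i))"
  proof -
    have "t ^ p = (\<Sum>i<N. (fps_const (f $ i) * fps_X ^ i) ^ p)"
      unfolding t_def by (rule freshmans_dream_sum) (use p char in auto)
    also have "\<dots> = (\<Sum>i<N. fps_const (f $ i) * fps_X ^ (p * i))"
      by (intro sum.cong) (auto simp: power_mult_distrib fps_const_power frob mult.commute simp flip: power_mult)
    finally show ?thesis .
  qed
  moreover have "((fps_X ^ N * g) ^ p) $ n = 0"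
  proof -
    have "n < N * p" using p0 unfolding N_def by (cases p) auto
    then show ?thesis by (simp add: power_mult_distrib fps_X_power_mult_nth flip: power_mult)
  qed
  ultimately have "(f ^ p) $ n = (\<Sum>i<N. f $ i * (if n = p * i then 1 else 0))"
    by (simp add: fps_sum_nth)
  also have "\<dots> = (f oo fps_X ^ p) $ n"
    unfolding fps_compose_nth N_def lessThan_Suc_atMost atLeast0AtMost by (simp flip: power_mult)
  finally show "(f ^ p) $ n = (f oo fps_X ^ p) $ n" .
qed

section \<open>Theta series\<close>

text \<open>
  With \<open>q = X\<^bsup>8Mc\<^esup>\<close> this is the Jacobi theta function of nome \<open>q\<^sup>M\<close> at \<open>q\<^sup>a\<close>, multiplied by the power
  of \<open>X\<close> that makes it odd and antiperiodic in \<open>a\<close>.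
\<close>

definition th :: "nat \<Rightarrow> nat \<Rightarrow> int \<Rightarrow> 'a::comm_ring_1 fps" where
  "th c M a = msum UNIV alt (\<lambda>k. c * nat ((2 * int M * k - int M + 2 * a)\<^sup>2))"

lemma finite_quadratic_fibre:
  fixes u v :: int
  assumes "c > 0" "u \<noteq> 0"
  shows "finite {k. k \<in> A \<and> c * nat ((u * k + v)\<^sup>2) = n}"
proof (rule finite_subset)
  show "{k. k \<in> A \<and> c * nat ((u * k + v)\<^sup>2) = n} \<subseteq> (\<lambda>k. u * k + v) -` {- int n..int n}"
  proof
    fix k assume "k \<in> {k. k \<in> A \<and> c * nat ((u * k + v)\<^sup>2) = n}"
    then have "n = c * nat ((u * k + v)\<^sup>2)" by simp
    then have "nat ((u * k + v)\<^sup>2) \<le> n" using assms(1) by simp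
    then have "(u * k + v)\<^sup>2 \<le> int n" by linarith
    moreover have "\<bar>u * k + v\<bar> \<le> (u * k + v)\<^sup>2"
      using self_le_power[of "\<bar>u * k + v\<bar>" 2] by (cases "u * k + v = 0") auto
    ultimately show "k \<in> (\<lambda>k. u * k + v) -` {- int n..int n}" by auto
  qed
  show "finite ((\<lambda>k. u * k + v) -` {- int n..int n})"
    by (rule finite_vimageI) (use assms(2) in \<open>auto simp: inj_on_def\<close>)
qed

lemma finite_th_fibre:
  assumes "c > 0" "M > 0"
  shows "finite {k. k \<in> A \<and> c * nat ((2 * int M * k - int M + 2 * a)\<^sup>2) = n}"
  using finite_quadratic_fibre[OF assms(1), of "2 * int M" A "- int M + 2 * a" n] assms(2)
  by (simp add: algebra_simps)

lemma th_minus: "th c M (- a) = - th c M a"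
proof -
  have "th c M (- a) = msum UNIV (\<lambda>k. - alt k) (\<lambda>k. c * nat ((2 * int M * k - int M + 2 * a)\<^sup>2))"
    unfolding th_def
  proof (rule msum_reindex[of "\<lambda>k. 1 - k"])
    show "bij_betw (\<lambda>k. 1 - k) (UNIV :: int set) UNIV"
      by (rule bij_betwI[where g = "\<lambda>k. 1 - k"]) auto
    fix i :: int
    have "2 * int M * i - int M + 2 * - a = - (2 * int M * (1 - i) - int M + 2 * a)"
      by (simp add: algebra_simps)
    then show "c * nat ((2 * int M * i - int M + 2 * - a)\<^sup>2) =
        c * nat ((2 * int M * (1 - i) - int M + 2 * a)\<^sup>2)"
      by (simp only: power2_minus)
  qed (auto simp: alt_def)
  then show ?thesis by (simp add: th_def msum_uminus)
qed

lemma th_add_period: "th c M (a + int M) = - th c M a"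
proof -
  have "th c M (a + int M) = msum UNIV (\<lambda>k. - alt k) (\<lambda>k. c * nat ((2 * int M * k - int M + 2 * a)\<^sup>2))"
    unfolding th_def
  proof (rule msum_reindex[of "\<lambda>k. k + 1"])
    show "bij_betw (\<lambda>k. k + 1) (UNIV :: int set) UNIV"
      by (rule bij_betwI[where g = "\<lambda>k. k - 1"]) auto
  qed (auto simp: alt_def algebra_simps)
  then show ?thesis by (simp add: th_def msum_uminus)
qed

lemma th_reflect: "th c M (int M - a) = th c M a"
proof -
  have "int M - a = - a + int M" by simp
  then show ?thesis by (simp only: th_add_period th_minus minus_minus)
qed

text \<open>For s = p, combined with Frobenius, this makes a level pM series at a multiple of p a
  p-th power of a level M series.\<close>

lemma th_rescale:
  assumes "s > 0"
  shows "th c (s * M) (int s * a) = th (c * s\<^sup>2) M a"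
proof -
  have "c * nat ((2 * int (s * M) * k - int (s * M) + 2 * (int s * a))\<^sup>2) =
      c * s\<^sup>2 * nat ((2 * int M * k - int M + 2 * a)\<^sup>2)" for k
  proof -
    have "(2 * int (s * M) * k - int (s * M) + 2 * (int s * a))\<^sup>2 =
        (int s)\<^sup>2 * (2 * int M * k - int M + 2 * a)\<^sup>2"
      unfolding power_mult_distrib[symmetric] by (rule arg_cong[of _ _ "\<lambda>x. x\<^sup>2"]) (simp add: algebra_simps)
    also have "nat \<dots> = s\<^sup>2 * nat ((2 * int M * k - int M + 2 * a)\<^sup>2)"
      by (simp add: nat_mult_distrib nat_power_eq)
    finally show ?thesis by (simp add: mult.assoc)
  qed
  then show ?thesis unfolding th_def by (simp only:)
qed

lemma th_compose_X_power:
  assumes "d > 0"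
  shows "th c M a oo fps_X ^ d = th (d * c) M a"
  unfolding th_def using msum_compose_X_power[OF assms] by (simp add: mult.assoc)

text \<open>The index is sorted by its residue modulo 3; among the three substitutions only 3j - 1
  changes the parity, which explains the single minus sign.\<close>

lemma th_trisect:
  assumes "c > 0" "M > 0"
  shows "th c M a = th c (3 * M) (a + int M) + th c (3 * M) (a - int M) - th c (3 * M) a"
proof -
  let ?e = "\<lambda>k. c * nat ((2 * int M * k - int M + 2 * a)\<^sup>2)"
  let ?R = "\<lambda>r. range (\<lambda>j::int. 3 * j - r)"
  have U: "UNIV = ?R 0 \<union> (?R 2 \<union> ?R 1)"
  proof -
    have "k \<in> ?R 0 \<union> (?R 2 \<union> ?R 1)" for k :: int
    proof -
      have "k = 3 * (k div 3) - 0 \<or> k = 3 * (k div 3 + 1) - 2 \<or> k = 3 * (k div 3 + 1) - 1"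
        by presburger
      then show ?thesis by blast
    qed
    then show ?thesis by auto
  qed
  have fin: "finite {k. k \<in> A \<and> ?e k = n}" for A n using finite_th_fibre[OF assms] .
  have part: "msum (?R r) alt ?e = msum UNIV (\<lambda>j. alt (3 * j - r)) (\<lambda>j. ?e (3 * j - r))" for r
    by (rule msum_reindex[of "\<lambda>j. 3 * j - r", symmetric]) (auto simp: bij_betw_def inj_on_def)
  have ex: "?e (3 * j - 0) = c * nat ((2 * int (3 * M) * j - int (3 * M) + 2 * (a + int M))\<^sup>2)"
    "?e (3 * j - 2) = c * nat ((2 * int (3 * M) * j - int (3 * M) + 2 * (a - int M))\<^sup>2)"
    "?e (3 * j - 1) = c * nat ((2 * int (3 * M) * j - int (3 * M) + 2 * a)\<^sup>2)" for j
    by (simp_all add: algebra_simps)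
  have al: "alt (3 * j - 0) = alt j" "alt (3 * j - 2) = alt j" "alt (3 * j - 1) = - alt j" for j
    by (auto simp: alt_def)
  have dis: "?R 0 \<inter> (?R 2 \<union> ?R 1) = {}" "?R 2 \<inter> ?R 1 = {}"
    by (auto, presburger+)
  have "th c M a = msum (?R 0 \<union> (?R 2 \<union> ?R 1)) alt ?e"
    by (simp only: th_def U[symmetric])
  also have "\<dots> = msum (?R 0) alt ?e + (msum (?R 2) alt ?e + msum (?R 1) alt ?e)"
    by (simp only: msum_Un_disjoint[OF dis(1) fin] msum_Un_disjoint[OF dis(2) fin])
  finally show ?thesis
    unfolding part ex al msum_uminus th_def by (simp only: diff_conv_add_uminus add.assoc)
qed

text \<open>Sorting the index by parity leaves signs that are constant on each half instead of
  alternating. Only in characteristic 2, where signs are invisible, are the halves theta series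
  again.\<close>

lemma th_bisect_char_2:
  assumes "c > 0" "m > 0" "(2 :: 'a) = 0"
  shows "(th c (2 * m) a :: 'a::comm_ring_1 fps) = th c (4 * m) (a + int m) + th c (4 * m) (a - int m)"
proof -
  let ?e = "\<lambda>k. c * nat ((2 * int (2 * m) * k - int (2 * m) + 2 * a)\<^sup>2)"
  let ?R = "\<lambda>r. range (\<lambda>j::int. 2 * j - r)"
  have "(- 1 :: 'a) = 1" using assms(3) by (metis add.right_inverse add_left_imp_eq one_add_one)
  then have al: "(alt k :: 'a) = 1" for k by (simp add: alt_def)
  have U: "UNIV = ?R 0 \<union> ?R 1"
  proof -
    have "k \<in> ?R 0 \<union> ?R 1" for k :: int
    proof -
      have "k = 2 * (k div 2) - 0 \<or> k = 2 * (k div 2 + 1) - 1" by presburger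
      then show ?thesis by blast
    qed
    then show ?thesis by auto
  qed
  have fin: "finite {k. k \<in> A \<and> ?e k = n}" for A n by (rule finite_th_fibre) (use assms in auto)
  have part: "msum (?R r) alt ?e = (msum UNIV (\<lambda>j. alt (2 * j - r)) (\<lambda>j. ?e (2 * j - r)) :: 'a fps)" for r
    by (rule msum_reindex[of "\<lambda>j. 2 * j - r", symmetric]) (auto simp: bij_betw_def inj_on_def)
  have ex: "?e (2 * j - 0) = c * nat ((2 * int (4 * m) * j - int (4 * m) + 2 * (a + int m))\<^sup>2)"
    "?e (2 * j - 1) = c * nat ((2 * int (4 * m) * j - int (4 * m) + 2 * (a - int m))\<^sup>2)" for j
    by (simp_all add: algebra_simps)
  have dis: "?R 0 \<inter> ?R 1 = {}"
    by (auto, presburger)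
  have "(th c (2 * m) a :: 'a fps) = msum (?R 0 \<union> ?R 1) alt ?e"
    by (simp only: th_def U[symmetric])
  also have "\<dots> = msum (?R 0) alt ?e + msum (?R 1) alt ?e"
    by (simp only: msum_Un_disjoint[OF dis fin])
  finally show ?thesis
    unfolding part ex al th_def by simp
qed

text \<open>
  Writing the double sum in terms of the sum and the difference of the indices separates \<open>a\<close> from
  \<open>b\<close>; the antisymmetric rank two form of the result implies the three-term relation.
\<close>

lemma th_mult:
  fixes a b :: int
  assumes "c > 0" "M > 0"
  defines "g \<equiv> \<lambda>a k. 2 * c * nat ((int M * k + 2 * a)\<^sup>2)"
  shows "th c M (a + b) * th c M (a - b) =
    msum {k. odd k} (\<lambda>_. 1) (g a) * msum {k. even k} (\<lambda>_. 1) (g b) -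
    msum {k. even k} (\<lambda>_. 1) (g a) * (msum {k. odd k} (\<lambda>_. 1) (g b) :: 'a::comm_ring_1 fps)"
proof -
  let ?e = "\<lambda>a k. c * nat ((2 * int M * k - int M + 2 * a)\<^sup>2)"
  let ?O = "{k :: int. odd k}" and ?E = "{k :: int. even k}"
  let ?t = "\<lambda>(k, l :: int). if odd k then 1 else - 1 :: 'a"
  let ?g = "\<lambda>(k, l). g a k + g b l"
  have fing: "finite {k. k \<in> A \<and> g a k = n}" for A n a
    unfolding g_def using finite_quadratic_fibre[of "2 * c" "int M" A "2 * a" n] assms(1,2) by simp
  have fin2: "finite {p. p \<in> A \<and> ?g p = n}" for A n
  proof (rule finite_subset)
    show "finite ((\<Union>i\<le>n. {k. k \<in> UNIV \<and> g a k = i}) \<times> (\<Union>i\<le>n. {k. k \<in> UNIV \<and> g b k = i}))"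
      by (intro finite_cartesian_product finite_UN_I fing) auto
  qed auto
  have "th c M (a + b) * th c M (a - b) =
      msum (UNIV \<times> UNIV) (\<lambda>(i, j). alt i * alt j) (\<lambda>(i, j). ?e (a + b) i + ?e (a - b) j)"
    unfolding th_def by (rule msum_mult; rule finite_th_fibre[OF assms(1,2)])
  also have "\<dots> = msum (?O \<times> ?E \<union> ?E \<times> ?O) ?t ?g"
  \<comment> \<open>With u, v the two linear forms, u^2 + v^2 = 2((u+v)/2)^2 + 2((u-v)/2)^2. The -1
    absorbs the constants -M of both forms, and makes the two new indices have opposite
    parity.\<close>
  proof (rule msum_reindex[of "\<lambda>(i, j). (i + j - 1, i - j)"])
    show "bij_betw (\<lambda>(i, j). (i + j - 1, i - j)) (UNIV \<times> UNIV) (?O \<times> ?E \<union> ?E \<times> ?O)"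
    proof (rule bij_betwI[where g = "\<lambda>(k, l). ((k + 1 + l) div 2, (k + 1 - l) div 2)"])
      show "(\<lambda>(i, j). (i + j - 1, i - j)) \<in> UNIV \<times> UNIV \<rightarrow> ?O \<times> ?E \<union> ?E \<times> ?O"
        by auto
      show "(case case p of (k, l) \<Rightarrow> ((k + 1 + l) div 2, (k + 1 - l) div 2) of (i, j) \<Rightarrow> (i + j - 1, i - j)) = p"
        if "p \<in> ?O \<times> ?E \<union> ?E \<times> ?O" for p :: "int \<times> int"
        using that by (auto elim!: evenE oddE)
    qed auto
    fix p :: "int \<times> int"
    obtain i j where p: "p = (i, j)" by (cases p)
    show "(case p of (i, j) \<Rightarrow> alt i * alt j) = ?t (case p of (i, j) \<Rightarrow> (i + j - 1, i - j))"
      by (auto simp: p alt_def)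
    let ?u = "2 * int M * i - int M + 2 * (a + b)" and ?v = "2 * int M * j - int M + 2 * (a - b)"
    let ?x = "int M * (i + j - 1) + 2 * a" and ?y = "int M * (i - j) + 2 * b"
    have "?u\<^sup>2 + ?v\<^sup>2 = 2 * ?x\<^sup>2 + 2 * ?y\<^sup>2" by (simp add: power2_eq_square algebra_simps)
    then have "nat (?u\<^sup>2) + nat (?v\<^sup>2) = 2 * nat (?x\<^sup>2) + 2 * nat (?y\<^sup>2)"
      by (simp add: nat_eq_iff nat_add_distrib[symmetric] nat_mult_distrib[symmetric] flip: of_nat_eq_iff)
    then have "c * (nat (?u\<^sup>2) + nat (?v\<^sup>2)) = c * (2 * nat (?x\<^sup>2) + 2 * nat (?y\<^sup>2))" by (simp only:)
    then show "(case p of (i, j) \<Rightarrow> ?e (a + b) i + ?e (a - b) j) = ?g (case p of (i, j) \<Rightarrow> (i + j - 1, i - j))"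
      by (simp add: p g_def distrib_left mult.assoc mult.left_commute[of c 2])
  qed
  also have "\<dots> = msum (?O \<times> ?E) ?t ?g + msum (?E \<times> ?O) ?t ?g"
    by (rule msum_Un_disjoint, force, rule fin2)
  also have "msum (?O \<times> ?E) ?t ?g = msum ?O (\<lambda>_. 1) (g a) * msum ?E (\<lambda>_. 1) (g b)"
    unfolding msum_mult[OF fing fing] by (rule msum_reindex[of id]) auto
  also have "msum (?E \<times> ?O) ?t ?g = - (msum ?E (\<lambda>_. 1) (g a) * msum ?O (\<lambda>_. 1) (g b))"
    unfolding msum_mult[OF fing fing] msum_uminus[symmetric] by (rule msum_reindex[of id]) auto
  finally show ?thesis by simp
qed

theorem th_three_term:
  fixes a b x y :: int
  assumes "c > 0" "M > 0"
  defines "T \<equiv> th c M :: int \<Rightarrow> 'a::comm_ring_1 fps"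
  shows "T (a + b) * T (a - b) * (T (x + y) * T (x - y)) -
    T (a + x) * T (a - x) * (T (b + y) * T (b - y)) +
    T (a + y) * T (a - y) * (T (b + x) * T (b - x)) = 0"
proof -
  define P Q :: "int \<Rightarrow> 'a fps"
    where "P = (\<lambda>a. msum {k. odd k} (\<lambda>_. 1) (\<lambda>k. 2 * c * nat ((int M * k + 2 * a)\<^sup>2)))"
      and "Q = (\<lambda>a. msum {k. even k} (\<lambda>_. 1) (\<lambda>k. 2 * c * nat ((int M * k + 2 * a)\<^sup>2)))"
  have PQ: "T (a + b) * T (a - b) = P a * Q b - Q a * P b" for a b
    unfolding T_def P_def Q_def by (rule th_mult[OF assms(1,2)])
  show ?thesis unfolding PQ by (simp add: algebra_simps)
qed

text \<open>Completing the square in the Jacobi exponent produces the dilation by 8Mc and the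
  leading power of X.\<close>

lemma th_triple_product:
  fixes a c M :: nat
  assumes "0 < a" "a < M" "c > 0"
  shows "th c M (int a) = fps_X ^ (c * nat ((int M - 2 * int a)\<^sup>2)) *
    ((eprod {n. n > 0 \<and> M dvd n} * eprod {n. n mod M = a} * eprod {n. n mod M = M - a}
       :: 'a::idom fps) oo fps_X ^ (8 * M * c))"
proof -
  have "nat ((2 * int M * k - int M + 2 * int a)\<^sup>2) = 8 * M * jexp M a k + nat ((int M - 2 * int a)\<^sup>2)" for k
  proof -
    have "(2 * int M * k - int M + 2 * int a)\<^sup>2 =
        4 * int M * (int M * (k * (k - 1)) + 2 * int a * k) + (int M - 2 * int a)\<^sup>2"
      by (simp add: power2_eq_square algebra_simps)
    also have "int M * (k * (k - 1)) + 2 * int a * k = 2 * int (jexp M a k)"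
      by (rule jexp_double[OF assms(1,2)])
    finally have "int (nat ((2 * int M * k - int M + 2 * int a)\<^sup>2)) =
        int (8 * M * jexp M a k + nat ((int M - 2 * int a)\<^sup>2))" by simp
    then show ?thesis by (simp only: of_nat_eq_iff)
  qed
  then have "th c M (int a) =
      (msum UNIV alt (\<lambda>k. (8 * M * c) * jexp M a k + c * nat ((int M - 2 * int a)\<^sup>2)) :: 'a fps)"
    unfolding th_def by (simp add: algebra_simps)
  also have "\<dots> = fps_X ^ (c * nat ((int M - 2 * int a)\<^sup>2)) * (msum UNIV alt (jexp M a) oo fps_X ^ (8 * M * c))"
    using assms by (subst msum_compose_X_power) (auto simp: fps_X_power_mult_msum)
  finally show ?thesis unfolding jacobi_triple_product[OF assms(1,2)] .
qed

section \<open>Algebraic form of the modular equations\<close>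

text \<open>
  Polynomial identities in characteristic 2 or 3 are obtained from this lemma; the cofactor \<open>q\<close> is
  the difference of both sides, expanded over the integers, divided by the characteristic.
\<close>

lemma eq_if_multiple_of_char:
  fixes x y q n :: "'a::comm_ring_1"
  assumes "n = 0" "x - y = n * q"
  shows "x = y"
  using assms by simp

lemma cancel_left:
  fixes c x y :: "'a::idom"
  assumes "c \<noteq> 0" "c * x = c * y"
  shows "x = y"
  using assms by simp

text \<open>
  Here \<open>V1 = \<theta>\<^sub>1\<theta>\<^sub>5\<close>, \<open>V2 = \<theta>\<^sub>2\<theta>\<^sub>3\<close>, \<open>V4 = \<theta>\<^sub>4\<theta>\<^sub>6\<close> and \<open>E = \<eta>(13\<tau>)\<^sup>6\<close>, where \<open>\<theta>\<^sub>a\<close> are the theta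
  series of level 13; their product is \<open>P = \<eta>(\<tau>) \<eta>(13\<tau>)\<^sup>5\<close>, so the conclusion is a relation between
  \<open>\<eta>(\<tau>)\<close> and \<open>\<eta>(13\<tau>)\<close>. The reciprocals of the \<open>V\<close>'s are linearly dependent, hence parametrise a
  rational curve.
\<close>

lemma modular_equation_char_2:
  fixes V1 V2 V4 E :: "'a::field"
  assumes two: "(2 :: 'a) = 0"
    and nz: "V1 \<noteq> 0" "V2 \<noteq> 0" "V4 \<noteq> 0"
    and rv: "V1 * V2 + V1 * V4 = V2 * V4"
    and e1: "V1 ^ 5 * E = V4\<^sup>2 * (V2 * E + V1 ^ 4)\<^sup>2"
    and e2: "V2 ^ 5 * E = V1\<^sup>2 * (V4 * E + V2 ^ 4)\<^sup>2"
    and ne: "V2 ^ 3 + V1\<^sup>2 * V2 + V1 ^ 3 \<noteq> 0"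
  defines "P \<equiv> V1 * V2 * V4"
  shows "P * E ^ 11 = (P\<^sup>2 + E\<^sup>2) ^ 3 * (P ^ 4 + P\<^sup>2 * E\<^sup>2 + E ^ 4)\<^sup>2"
proof -
  define A B C where "A = 1 / V1" and "B = 1 / V2" and "C = 1 / V4"
  have ABC: "A \<noteq> 0" "B \<noteq> 0" "C \<noteq> 0" and V: "V1 = 1 / A" "V2 = 1 / B" "V4 = 1 / C"
    using nz by (auto simp: A_def B_def C_def)
  have inv: "A * V1 = 1" "B * V2 = 1" "C * V4 = 1" using nz by (auto simp: A_def B_def C_def)
  have "C * (A * V1) * (B * V2) + B * (A * V1) * (C * V4) = A * (B * V2) * (C * V4)"
    using rv by algebra
  then have C: "C = A - B" unfolding inv by (simp add: algebra_simps)
  \<comment> \<open>T is 1/P. Since C = A - B, these are, modulo 2, the binary forms vanishing at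
    the points of the projective line over the field with 2 elements (T), at those of degree 3 (k
    and l) and at those of degree 2 (m).\<close>
  define T k l m where "T = A * B * C" and "k = A ^ 3 + A\<^sup>2 * B + B ^ 3"
    and "l = A ^ 3 + A * B\<^sup>2 + B ^ 3" and "m = A\<^sup>2 + A * B + B\<^sup>2"
  have i: "E * A ^ 3 * B\<^sup>2 * C\<^sup>2 = (A ^ 4 * E + B)\<^sup>2"
  proof -
    have "E * A ^ 3 * B\<^sup>2 * C\<^sup>2 * (A * V1) ^ 5 = (C * V4)\<^sup>2 * (A ^ 4 * E * (B * V2) + B * (A * V1) ^ 4)\<^sup>2"
      using e1 by algebra
    then show ?thesis unfolding inv by simp
  qed
  have ii: "E * B ^ 3 * C\<^sup>2 * A\<^sup>2 = (B ^ 4 * E + C)\<^sup>2"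
  proof -
    have "E * B ^ 3 * C\<^sup>2 * A\<^sup>2 * (B * V2) ^ 5 = (A * V1)\<^sup>2 * (B ^ 4 * E * (C * V4) + C * (B * V2) ^ 4)\<^sup>2"
      using e2 by algebra
    then show ?thesis unfolding inv by simp
  qed
  have l: "l \<noteq> 0"
  proof
    assume "l = 0"
    moreover have "l * V1 ^ 3 * V2 ^ 3 =
        (A * V1) ^ 3 * V2 ^ 3 + (A * V1) * (B * V2)\<^sup>2 * V1\<^sup>2 * V2 + (B * V2) ^ 3 * V1 ^ 3"
      unfolding l_def by algebra
    ultimately show False using ne unfolding inv by simp
  qed
  have T: "T \<noteq> 0" using ABC by (simp add: T_def)
  \<comment> \<open>B^8 times \<open>i\<close> minus A^8 times \<open>ii\<close>: in characteristic
    2 the terms in E^2 cancel, and both sides acquire the factor l, which is nonzero.\<close>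
  have "E * T ^ 3 * k * l = E * A ^ 3 * B\<^sup>2 * C\<^sup>2 * B ^ 8 - E * B ^ 3 * C\<^sup>2 * A\<^sup>2 * A ^ 8"
    by (rule eq_if_multiple_of_char[OF two, of _ _
          "0 - (0 - A^12*B^3*E + 2*A^11*B^4*E - A^10*B^5*E - A^9*B^6*E + 3*A^8*B^7*E - 3*A^7*B^8*E
            + A^6*B^9*E + A^5*B^10*E - 2*A^4*B^11*E + A^3*B^12*E)"])
      (unfold T_def k_def l_def C, algebra)
  also have "\<dots> = (A ^ 4 * E + B)\<^sup>2 * B ^ 8 - (B ^ 4 * E + C)\<^sup>2 * A ^ 8"
    unfolding i ii ..
  also have "\<dots> = (m * l)\<^sup>2"
    by (rule eq_if_multiple_of_char[OF two, of _ _
          "0 - A^10 - A^9*B^4*E + A^8*B^5*E - 3*A^8*B^2 - 4*A^7*B^3 - 6*A^6*B^4 - 7*A^5*B^5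
            + A^4*B^9*E - 7*A^4*B^6 - 6*A^3*B^7 - 4*A^2*B^8 - 2*A*B^9"])
      (unfold m_def l_def C, algebra)
  finally have iv: "E * T ^ 3 * k = m\<^sup>2 * l"
    using l by (simp add: power2_eq_square mult.assoc)
  have "A ^ 7 * (E\<^sup>2 * T * k) = (A ^ 4 * E)\<^sup>2 * (B * C * k)"
    unfolding T_def by algebra
  also have "\<dots> = (E * A ^ 3 * B\<^sup>2 * C\<^sup>2 + B\<^sup>2) * (B * C * k)"
  proof -
    have "(A ^ 4 * E)\<^sup>2 = E * A ^ 3 * B\<^sup>2 * C\<^sup>2 + B\<^sup>2"
      by (rule eq_if_multiple_of_char[OF two, of _ _ "0 - A ^ 4 * E * B - B\<^sup>2"]) (unfold i, algebra)
    then show ?thesis by simp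
  qed
  also have "\<dots> = B ^ 3 * C * k + E * T ^ 3 * k"
    unfolding T_def by algebra
  also have "\<dots> = B ^ 3 * C * k + m\<^sup>2 * l" unfolding iv ..
  also have "\<dots> = A ^ 7"
    by (rule eq_if_multiple_of_char[OF two, of _ _
          "A^6*B + 2*A^5*B^2 + 3*A^4*B^3 + 3*A^3*B^4 + 2*A^2*B^5 + 2*A*B^6"])
      (unfold m_def l_def k_def C, algebra)
  finally have v: "E\<^sup>2 * T * k = 1" using ABC by simp
  have vi: "E * (m\<^sup>2 * l) = T\<^sup>2"
  proof -
    have "E * (m\<^sup>2 * l) = E\<^sup>2 * T * k * T\<^sup>2" unfolding iv[symmetric] by algebra
    then show ?thesis unfolding v by simp
  qed
  have kT: "k + T = l"
    by (rule eq_if_multiple_of_char[OF two, of _ _ "A^2*B - A*B^2"]) (unfold T_def l_def k_def C, algebra)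
  have k3: "k\<^sup>2 + k * T + T\<^sup>2 = m ^ 3"
    by (rule eq_if_multiple_of_char[OF two, of _ _ "0 - 2*A^4*B^2 - 4*A^3*B^3 - A^2*B^4 - 2*A*B^5"])
      (unfold T_def m_def k_def C, algebra)
  \<comment> \<open>With P = 1/T these are the two brackets of the conclusion. Once they are
    factored through l and m, \<open>vi\<close> removes both forms.\<close>
  have "1 + E\<^sup>2 * T\<^sup>2 = E\<^sup>2 * T * k + E\<^sup>2 * T\<^sup>2" unfolding v ..
  also have "\<dots> = E\<^sup>2 * T * (k + T)" by algebra
  finally have h1: "1 + E\<^sup>2 * T\<^sup>2 = E\<^sup>2 * T * l" unfolding kT .
  have "1 + E\<^sup>2 * T\<^sup>2 + E ^ 4 * T ^ 4 = (E\<^sup>2 * T * k)\<^sup>2 + (E\<^sup>2 * T * k) * (E\<^sup>2 * T\<^sup>2) + E ^ 4 * T ^ 4"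
    unfolding v by simp
  also have "\<dots> = E ^ 4 * T\<^sup>2 * (k\<^sup>2 + k * T + T\<^sup>2)" by algebra
  finally have h2: "1 + E\<^sup>2 * T\<^sup>2 + E ^ 4 * T ^ 4 = E ^ 4 * T\<^sup>2 * m ^ 3" unfolding k3 .
  have "(1 + E\<^sup>2 * T\<^sup>2) ^ 3 * (1 + E\<^sup>2 * T\<^sup>2 + E ^ 4 * T ^ 4)\<^sup>2 = E ^ 11 * T ^ 7 * (E * (m\<^sup>2 * l)) ^ 3"
    unfolding h2 unfolding h1 by algebra
  also have "\<dots> = E ^ 11 * T ^ 13" unfolding vi by algebra
  finally have fin: "(1 + E\<^sup>2 * T\<^sup>2) ^ 3 * (1 + E\<^sup>2 * T\<^sup>2 + E ^ 4 * T ^ 4)\<^sup>2 = E ^ 11 * T ^ 13" .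
  have PT: "P * T = 1" using ABC by (simp add: P_def V T_def)
  have "(P\<^sup>2 + E\<^sup>2) ^ 3 * (P ^ 4 + P\<^sup>2 * E\<^sup>2 + E ^ 4)\<^sup>2 =
      P ^ 14 * ((1 + E\<^sup>2 * T\<^sup>2) ^ 3 * (1 + E\<^sup>2 * T\<^sup>2 + E ^ 4 * T ^ 4)\<^sup>2)"
  proof -
    have a: "P\<^sup>2 + E\<^sup>2 = P\<^sup>2 * (1 + E\<^sup>2 * T\<^sup>2)"
      using PT by algebra
    have b: "P ^ 4 + P\<^sup>2 * E\<^sup>2 + E ^ 4 = P ^ 4 * (1 + E\<^sup>2 * T\<^sup>2 + E ^ 4 * T ^ 4)"
      using PT by algebra
    show ?thesis unfolding a b by algebra
  qed
  also have "\<dots> = P * E ^ 11 * (P * T) ^ 13" unfolding fin by algebra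
  finally show ?thesis unfolding PT by simp
qed


section \<open>Level 13 theta values and the Weierstrass curve in characteristic 3\<close>

locale theta_relations =
  fixes W1 W2 W3 W4 W5 W6 :: "'a::field"
  assumes nz: "W1 \<noteq> 0" "W2 \<noteq> 0" "W3 \<noteq> 0" "W4 \<noteq> 0" "W5 \<noteq> 0" "W6 \<noteq> 0"
    and rv: "W1 * W2 * W3 * W5 + W1 * W4 * W5 * W6 = W2 * W3 * W4 * W6"
    and l1: "W1 ^ 3 * W5 + W1 * W3 ^ 3 = W2 ^ 3 * W4"
    and l2: "W1 * W5 ^ 3 + W2 ^ 3 * W5 = W3 ^ 3 * W6"
    and k1: "W1 * W2\<^sup>2 * W6 + W1 * W4\<^sup>2 * W5 = W2 * W3\<^sup>2 * W6"
    and k2: "W1\<^sup>2 * W2 * W5 + W2 * W4 * W5\<^sup>2 = W3\<^sup>2 * W4 * W6"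
    and m1: "W1 ^ 3 * W6 + W2 * W4 ^ 3 = W3 ^ 3 * W5"
    and m2: "W1 * W2 ^ 3 + W3 * W6 ^ 3 = W4 * W5 ^ 3"
begin

definition "A = 1 / (W1 * W5)"
definition "B = 1 / (W2 * W3)"
definition "C = 1 / (W4 * W6)"
text \<open>Multiplying the indices by 5 fixes A, B, C and exchanges \<mu> and \<nu>, all up to
  sign. Sum and product of \<mu> and \<nu> are polynomials in A, B, C, so every expression symmetric
  in the two can be reduced to A and B.\<close>

definition "\<mu> = A\<^sup>2 * B\<^sup>2 * C * (W3 ^ 3 * W5)"
definition "\<nu> = A\<^sup>2 * B\<^sup>2 * C * (W1 * W2 ^ 3)"

lemma ABC_nz: "A \<noteq> 0" "B \<noteq> 0" "C \<noteq> 0"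
  using nz by (auto simp: A_def B_def C_def)

lemma ABC_inv: "A * (W1 * W5) = 1" "B * (W2 * W3) = 1" "C * (W4 * W6) = 1"
  using nz by (auto simp: A_def B_def C_def)

lemma C_eq: "C = A - B"
proof -
  have "C * (A * (W1 * W5)) * (B * (W2 * W3)) + B * (A * (W1 * W5)) * (C * (W4 * W6)) =
      A * (B * (W2 * W3)) * (C * (W4 * W6))"
    using rv by algebra
  then show ?thesis unfolding ABC_inv by (simp add: algebra_simps)
qed

lemma mu_prod: "\<mu> * \<nu> = A ^ 3 * B * C\<^sup>2"
proof -
  have "\<mu> * \<nu> = A ^ 3 * B * C\<^sup>2 * (A * (W1 * W5)) * (B * (W2 * W3)) ^ 3"
    unfolding \<mu>_def \<nu>_def by algebra
  then show ?thesis unfolding ABC_inv by simp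
qed

text \<open>In the product of \<open>l1\<close> and \<open>l2\<close> the cross terms are the
  monomials of \<mu> and \<nu>; everything else involves only W1 W5, W2 W3 and W4 W6.\<close>

lemma mu_sum: "\<mu> + \<nu> = A ^ 3 - A * B\<^sup>2 + B ^ 3"
proof -
  have "W1 * W5 * ((W1 * W5) ^ 3 + (W2 * W3) ^ 3 + W1 * W5 * (W3 ^ 3 * W5 + W1 * W2 ^ 3)) =
      (W1 ^ 3 * W5 + W1 * W3 ^ 3) * (W1 * W5 ^ 3 + W2 ^ 3 * W5)"
    by algebra
  also have "\<dots> = (W2 * W3) ^ 3 * (W4 * W6)"
    unfolding l1 l2 by algebra
  finally have "W1 * W5 * ((W1 * W5) ^ 3 + (W2 * W3) ^ 3 + W1 * W5 * (W3 ^ 3 * W5 + W1 * W2 ^ 3)) =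
      (W2 * W3) ^ 3 * (W4 * W6)" .
  then have "A * B ^ 3 * C * (A * (W1 * W5)) ^ 4 + A ^ 4 * C * (A * (W1 * W5)) * (B * (W2 * W3)) ^ 3 +
      (A * (W1 * W5))\<^sup>2 * A * B * (\<mu> + \<nu>) = A ^ 5 * (B * (W2 * W3)) ^ 3 * (C * (W4 * W6))"
    unfolding \<mu>_def \<nu>_def by algebra
  then have "A * (B * (\<mu> + \<nu>)) = A * (A ^ 4 - B ^ 3 * C - A ^ 3 * C)"
    unfolding ABC_inv power_one mult_1_right mult_1 by algebra
  then have "B * (\<mu> + \<nu>) = A ^ 4 - B ^ 3 * C - A ^ 3 * C"
    using ABC_nz by simp
  also have "\<dots> = B * (A ^ 3 - A * B\<^sup>2 + B ^ 3)" unfolding C_eq by algebra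
  finally show ?thesis using ABC_nz by simp
qed

abbreviation "D \<equiv> A\<^sup>2 * B\<^sup>2 * C\<^sup>2"

lemma monomials:
  defines "Q \<equiv> A\<^sup>2 - A * B + B\<^sup>2"
  shows "D * (W2 * W4 ^ 3) = - (A * (\<nu> - A\<^sup>2 * C))"
    and "D * (W3 * W6 ^ 3) = A * (\<mu> - A\<^sup>2 * C)"
    and "D * (W1 ^ 3 * W6) = B * (A * Q - \<mu>)"
    and "D * (W4 * W5 ^ 3) = B * (A * Q - \<nu>)"
proof -
  have "W1 * W2 ^ 3 * (W4 * W6) + W1 * W5 * (W2 * W4 ^ 3) = (W2 * W3)\<^sup>2 * (W4 * W6)"
    using k1 by algebra
  then have "A * (C * (W4 * W6)) * \<nu> + (A * (W1 * W5)) * (D * (W2 * W4 ^ 3)) =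
      A ^ 3 * C * (B * (W2 * W3))\<^sup>2 * (C * (W4 * W6))"
    unfolding \<nu>_def by algebra
  then show n': "D * (W2 * W4 ^ 3) = - (A * (\<nu> - A\<^sup>2 * C))"
    unfolding ABC_inv power_one mult_1_right mult_1 by algebra
  have "(W1 * W5)\<^sup>2 * (W2 * W3) + W2 * W3 * (W4 * W5 ^ 3) = W4 * W6 * (W3 ^ 3 * W5)"
    using k2 by algebra
  then have "(A * (W1 * W5))\<^sup>2 * (B * (W2 * W3)) * B\<^sup>2 * C\<^sup>2 + (B * (W2 * W3)) * (D * (W4 * W5 ^ 3)) =
      (C * (W4 * W6)) * B * \<mu>"
    unfolding \<mu>_def by algebra
  then have "D * (W4 * W5 ^ 3) = B * (\<mu> - B * C\<^sup>2)"
    unfolding ABC_inv power_one mult_1_right mult_1 by algebra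
  also have "\<mu> - B * C\<^sup>2 = A * Q - \<nu>"
    using mu_sum unfolding C_eq Q_def by algebra
  finally show o': "D * (W4 * W5 ^ 3) = B * (A * Q - \<nu>)" .
  have "D * (W3 * W6 ^ 3) = D * (W4 * W5 ^ 3) - C * \<nu>"
    using m2 unfolding \<nu>_def by algebra
  also have "\<dots> = A * (\<mu> - A\<^sup>2 * C)"
    unfolding o' using mu_sum unfolding C_eq Q_def by algebra
  finally show "D * (W3 * W6 ^ 3) = A * (\<mu> - A\<^sup>2 * C)" .
  have "D * (W1 ^ 3 * W6) = C * \<mu> - D * (W2 * W4 ^ 3)"
    using m1 unfolding \<mu>_def by algebra
  also have "\<dots> = B * (A * Q - \<mu>)"
    unfolding n' using mu_sum unfolding C_eq Q_def by algebra
  finally show "D * (W1 ^ 3 * W6) = B * (A * Q - \<mu>)" .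
qed

text \<open>W(2a) / W(a)^4 is, up to a constant, the ordinate of the point of index a, as for the
  sigma function. Its square becomes a polynomial in A, B, C and one of \<mu>, \<nu>.\<close>

lemma y_squares:
  defines "T \<equiv> A * B * C" and "Q \<equiv> A\<^sup>2 - A * B + B\<^sup>2"
  shows "B ^ 6 * C ^ 5 * (W2\<^sup>2 / W1 ^ 8) = A\<^sup>2 * ((T - \<nu>) * (A * Q - \<nu>) ^ 3)"
    and "B ^ 6 * C ^ 5 * (W3\<^sup>2 / W5 ^ 8) = - (A\<^sup>2 * ((T - \<mu>) * (A * Q - \<mu>) ^ 3))"
    and "A ^ 4 * C ^ 5 * (W4\<^sup>2 / W2 ^ 8) = - ((A * Q - \<mu>) * (T - \<mu>) * \<mu>\<^sup>2)"
    and "A ^ 4 * C ^ 5 * (W6\<^sup>2 / W3 ^ 8) = (A * Q - \<nu>) * (T - \<nu>) * \<nu>\<^sup>2"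
proof -
  note mono = monomials[folded Q_def]
  have D: "D \<noteq> 0" using ABC_nz by simp
  have mu: "D * (W3 ^ 3 * W5) = C * \<mu>" "D * (W1 * W2 ^ 3) = C * \<nu>"
    unfolding \<mu>_def \<nu>_def by algebra+
  have T: "(\<mu> - A\<^sup>2 * C) * \<nu> = A\<^sup>2 * C * (T - \<nu>)" "(\<nu> - A\<^sup>2 * C) * \<mu> = A\<^sup>2 * C * (T - \<mu>)"
    using mu_prod unfolding T_def by algebra+
  have w: "W2\<^sup>2 / W1 ^ 8 = A ^ 8 * (W2\<^sup>2 * W5 ^ 8)" "W3\<^sup>2 / W5 ^ 8 = A ^ 8 * (W3\<^sup>2 * W1 ^ 8)"
    "W4\<^sup>2 / W2 ^ 8 = B ^ 8 * (W4\<^sup>2 * W3 ^ 8)" "W6\<^sup>2 / W3 ^ 8 = B ^ 8 * (W6\<^sup>2 * W2 ^ 8)"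
    using nz by (auto simp: A_def B_def field_simps)
  \<comment> \<open>The inserted factors equal 1; they turn the monomial into a product of monomials
    evaluated before.\<close>
  have "D ^ 5 * (W2\<^sup>2 * W5 ^ 8) = D ^ 5 * (W2\<^sup>2 * W5 ^ 8) * (A * (W1 * W5)) * (B * (W2 * W3)) * (C * (W4 * W6)) ^ 3"
    unfolding ABC_inv by simp
  also have "\<dots> = A * B * C ^ 3 * (D * (W3 * W6 ^ 3)) * (D * (W1 * W2 ^ 3)) * (D * (W4 * W5 ^ 3)) ^ 3"
    by algebra
  also have "\<dots> = A\<^sup>2 * B ^ 4 * C ^ 4 * ((\<mu> - A\<^sup>2 * C) * \<nu>) * (A * Q - \<nu>) ^ 3"
    unfolding mono mu by algebra
  also have "\<dots> = A ^ 4 * B ^ 4 * C ^ 5 * ((T - \<nu>) * (A * Q - \<nu>) ^ 3)"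
    unfolding T by algebra
  finally have "D\<^sup>2 * (B ^ 6 * C ^ 5 * (W2\<^sup>2 / W1 ^ 8)) = D\<^sup>2 * (A\<^sup>2 * ((T - \<nu>) * (A * Q - \<nu>) ^ 3))"
    unfolding w by algebra
  then show "B ^ 6 * C ^ 5 * (W2\<^sup>2 / W1 ^ 8) = A\<^sup>2 * ((T - \<nu>) * (A * Q - \<nu>) ^ 3)"
    by (rule cancel_left[rotated]) (use D in simp)
  have "D ^ 5 * (W3\<^sup>2 * W1 ^ 8) = D ^ 5 * (W3\<^sup>2 * W1 ^ 8) * (A * (W1 * W5)) * (B * (W2 * W3)) * (C * (W4 * W6)) ^ 3"
    unfolding ABC_inv by simp
  also have "\<dots> = A * B * C ^ 3 * (D * (W2 * W4 ^ 3)) * (D * (W3 ^ 3 * W5)) * (D * (W1 ^ 3 * W6)) ^ 3"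
    by algebra
  also have "\<dots> = - (A\<^sup>2 * B ^ 4 * C ^ 4 * ((\<nu> - A\<^sup>2 * C) * \<mu>) * (A * Q - \<mu>) ^ 3)"
    unfolding mono mu by algebra
  also have "\<dots> = - (A ^ 4 * B ^ 4 * C ^ 5 * ((T - \<mu>) * (A * Q - \<mu>) ^ 3))"
    unfolding T by algebra
  finally have "D\<^sup>2 * (B ^ 6 * C ^ 5 * (W3\<^sup>2 / W5 ^ 8)) = D\<^sup>2 * (- (A\<^sup>2 * ((T - \<mu>) * (A * Q - \<mu>) ^ 3)))"
    unfolding w by algebra
  then show "B ^ 6 * C ^ 5 * (W3\<^sup>2 / W5 ^ 8) = - (A\<^sup>2 * ((T - \<mu>) * (A * Q - \<mu>) ^ 3))"
    by (rule cancel_left[rotated]) (use D in simp)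
  have "D ^ 5 * (W4\<^sup>2 * W3 ^ 8) = D ^ 5 * (W4\<^sup>2 * W3 ^ 8) * (A * (W1 * W5)) ^ 3 * (B * (W2 * W3)) * (C * (W4 * W6))"
    unfolding ABC_inv by simp
  also have "\<dots> = A ^ 3 * B * C * (D * (W1 ^ 3 * W6)) * (D * (W2 * W4 ^ 3)) * (D * (W3 ^ 3 * W5)) ^ 3"
    by algebra
  also have "\<dots> = - (A ^ 4 * B\<^sup>2 * C ^ 4 * (A * Q - \<mu>) * ((\<nu> - A\<^sup>2 * C) * \<mu>) * \<mu>\<^sup>2)"
    unfolding mono mu by algebra
  also have "\<dots> = - (A ^ 6 * B\<^sup>2 * C ^ 5 * ((A * Q - \<mu>) * (T - \<mu>) * \<mu>\<^sup>2))"
    unfolding T by algebra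
  finally have "D ^ 3 * B\<^sup>2 * (A ^ 4 * C ^ 5 * (W4\<^sup>2 / W2 ^ 8)) = D ^ 3 * B\<^sup>2 * (- ((A * Q - \<mu>) * (T - \<mu>) * \<mu>\<^sup>2))"
    unfolding w by algebra
  then show "A ^ 4 * C ^ 5 * (W4\<^sup>2 / W2 ^ 8) = - ((A * Q - \<mu>) * (T - \<mu>) * \<mu>\<^sup>2)"
    by (rule cancel_left[rotated]) (use D in simp)
  have "D ^ 5 * (W6\<^sup>2 * W2 ^ 8) = D ^ 5 * (W6\<^sup>2 * W2 ^ 8) * (A * (W1 * W5)) ^ 3 * (B * (W2 * W3)) * (C * (W4 * W6))"
    unfolding ABC_inv by simp
  also have "\<dots> = A ^ 3 * B * C * (D * (W4 * W5 ^ 3)) * (D * (W3 * W6 ^ 3)) * (D * (W1 * W2 ^ 3)) ^ 3"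
    by algebra
  also have "\<dots> = A ^ 4 * B\<^sup>2 * C ^ 4 * (A * Q - \<nu>) * ((\<mu> - A\<^sup>2 * C) * \<nu>) * \<nu>\<^sup>2"
    unfolding mono mu by algebra
  also have "\<dots> = A ^ 6 * B\<^sup>2 * C ^ 5 * ((A * Q - \<nu>) * (T - \<nu>) * \<nu>\<^sup>2)"
    unfolding T by algebra
  finally have "D ^ 3 * B\<^sup>2 * (A ^ 4 * C ^ 5 * (W6\<^sup>2 / W3 ^ 8)) = D ^ 3 * B\<^sup>2 * ((A * Q - \<nu>) * (T - \<nu>) * \<nu>\<^sup>2)"
    unfolding w by algebra
  then show "A ^ 4 * C ^ 5 * (W6\<^sup>2 / W3 ^ 8) = (A * Q - \<nu>) * (T - \<nu>) * \<nu>\<^sup>2"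
    by (rule cancel_left[rotated]) (use D in simp)
qed

text \<open>
  The points \<open>x\<^sub>a\<close> lie on a curve in Weierstrass form. Subtracting the equations of \<open>x\<^sub>1\<close> and \<open>x\<^sub>5\<close>, and
  those of \<open>x\<^sub>2\<close> and \<open>x\<^sub>3\<close>, gives \<open>x\<^sub>1 + x\<^sub>5\<close> and \<open>x\<^sub>2 + x\<^sub>3\<close> as multiples of \<open>E\<^sup>2\<close>, while their
  difference is a multiple of \<open>E\<close>; adding the equations of \<open>x\<^sub>1\<close> and \<open>x\<^sub>5\<close> then determines \<open>E\<^sup>2\<close>.
\<close>

lemma modular_equation_char_3:
  fixes E x1 x2 x3 x5 :: 'a
  assumes three: "(3 :: 'a) = 0" and E: "E \<noteq> 0"
    and c1: "E ^ 3 * (W2\<^sup>2 / W1 ^ 8) = x1 ^ 3 + x1\<^sup>2 - E ^ 4"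
    and c5: "E ^ 3 * (W3\<^sup>2 / W5 ^ 8) = x5 ^ 3 + x5\<^sup>2 - E ^ 4"
    and c2: "E ^ 3 * (W4\<^sup>2 / W2 ^ 8) = x2 ^ 3 + x2\<^sup>2 - E ^ 4"
    and c3: "E ^ 3 * (W6\<^sup>2 / W3 ^ 8) = x3 ^ 3 + x3\<^sup>2 - E ^ 4"
    and d15: "x1 - x5 = E * (W4 * W6) / (W1 * W5)\<^sup>2"
    and d23: "x2 - x3 = E * (W1 * W5) / (W2 * W3)\<^sup>2"
    and d12: "x1 - x2 = E * W3 / (W1 * W2\<^sup>2)"
    and d53: "x5 - x3 = - (E * W2 / (W5 * W3\<^sup>2))"
    and ne: "W3 ^ 3 * W5 \<noteq> W1 * W2 ^ 3"
  shows "E\<^sup>2 * (A * B * C) * (A * B\<^sup>2 - A ^ 3 - A\<^sup>2 * B - B ^ 3) = 1"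
proof -
  define s1 s2 where "s1 = x1 + x5" and "s2 = x2 + x3"
  define \<delta> where "\<delta> = \<mu> - \<nu>"
  \<comment> \<open>b and b2 are the numerators of s1 / E^2 and s2 / E^2. Below, c arises from s1 -
    s2, r from f \<nu> - f \<mu>, and g is -(c + r^2) modulo 3.\<close>
  define b b2 where "b = (A\<^sup>2 + B\<^sup>2)\<^sup>2 * (A ^ 3 - A\<^sup>2 * B - A * B\<^sup>2 - B ^ 3)"
    and "b2 = (A\<^sup>2 + A * B - B\<^sup>2)\<^sup>2 * (A ^ 3 - A\<^sup>2 * B + B ^ 3)"
  define c g r where "c = (A + B) * (A ^ 3 - A\<^sup>2 * B + A * B\<^sup>2 + B ^ 3)"
    and "g = A ^ 4 - A ^ 3 * B + A\<^sup>2 * B\<^sup>2 - A * B ^ 3 + B ^ 4"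
    and "r = A\<^sup>2 - A * B - B\<^sup>2"
  define T Q S where "T = A * B * C" and "Q = A\<^sup>2 - A * B + B\<^sup>2" and "S = A ^ 3 - A * B\<^sup>2 + B ^ 3"
  define k where "k = A * B\<^sup>2 - A ^ 3 - A\<^sup>2 * B - B ^ 3"
  define f h where "f = (\<lambda>t. (T - t) * (A * Q - t) ^ 3)" and "h = (\<lambda>t. (A * Q - t) * (T - t) * t\<^sup>2)"
  note nzs = ABC_nz E
  note y = y_squares[folded T_def Q_def]
  have \<delta>: "\<delta> \<noteq> 0" using ne ABC_nz by (simp add: \<delta>_def \<mu>_def \<nu>_def)
  have \<nu>: "\<nu> = S - \<mu>" using mu_sum by (simp add: S_def algebra_simps)
  have quad: "\<mu>\<^sup>2 - S * \<mu> + A ^ 3 * B * C\<^sup>2 = 0"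
    using mu_prod unfolding \<nu> by algebra
  have D2: "\<delta>\<^sup>2 = S\<^sup>2 - 4 * (A ^ 3 * B * C\<^sup>2)"
    unfolding \<delta>_def \<nu> using quad by algebra
  have D15: "C * (x1 - x5) = E * A\<^sup>2"
    unfolding d15 A_def C_def using nz by (simp add: field_simps)
  have D23: "A * (x2 - x3) = E * B\<^sup>2"
    unfolding d23 A_def B_def using nz by (simp add: field_simps)

  have diff: "E ^ 3 * u - E ^ 3 * v = (x - z) ^ 3 + (x - z) * (x + z)"
    if "E ^ 3 * u = x ^ 3 + x\<^sup>2 - E ^ 4" "E ^ 3 * v = z ^ 3 + z\<^sup>2 - E ^ 4" for u v x z
    by (rule eq_if_multiple_of_char[OF three, of _ _ "x\<^sup>2 * z - x * z\<^sup>2"]) (unfold that, algebra)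

  have G1: "f \<mu> + f \<nu> = b * B ^ 4 * C + A ^ 4 * B ^ 6 * C\<^sup>2"
  proof -
    \<comment> \<open>Division by the quadratic equation of \<mu>: the last bracket before the
      quadratic is the quotient, and the remainder is a multiple of 3. \<open>G2\<close> and
      \<open>F1\<close> work alike.\<close>
    have "f \<mu> + f \<nu> - (b * B ^ 4 * C + A ^ 4 * B ^ 6 * C\<^sup>2) =
        3 * (0 - A^7*B^5 + 3*A^6*B^6 - 3*A^5*B^7 + 4*A^4*B^8 - 5*A^3*B^9 + 4*A^2*B^10 - 2*A*B^11) +
        (A^6 - 2*A^5*B + 5*A^4*B^2 - 9*A^3*B^3 - 2*A^3*\<mu> + 16*A^2*B^4 - 14*A*B^5 + 2*A*B^2*\<mu>
          + 4*B^6 - 2*B^3*\<mu> + 2*\<mu>^2) * (\<mu>\<^sup>2 - S * \<mu> + A ^ 3 * B * C\<^sup>2)"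
      unfolding f_def \<nu> b_def T_def Q_def S_def C_eq by algebra
    from this[unfolded quad mult_zero_right add_0_right] show ?thesis
      by (rule eq_if_multiple_of_char[OF three])
  qed
  have G2: "h \<mu> + h \<nu> = - (b2 * B\<^sup>2 * C ^ 3 + A * B ^ 6 * C ^ 5)"
  proof -
    have "h \<mu> + h \<nu> - (- (b2 * B\<^sup>2 * C ^ 3 + A * B ^ 6 * C ^ 5)) =
        3 * (A^9*B^3 - 4*A^8*B^4 + 5*A^7*B^5 + A^6*B^6 - 9*A^5*B^7 + 10*A^4*B^8 - 5*A^3*B^9 + A^2*B^10) +
        (A^6 - 5*A^4*B^2 + 7*A^3*B^3 - 2*A^3*\<mu> + 2*A^2*B^4 - 8*A*B^5 + 2*A*B^2*\<mu> + 4*B^6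
          - 2*B^3*\<mu> + 2*\<mu>^2) * (\<mu>\<^sup>2 - S * \<mu> + A ^ 3 * B * C\<^sup>2)"
      unfolding h_def \<nu> b2_def T_def Q_def S_def C_eq by algebra
    from this[unfolded quad mult_zero_right add_0_right] show ?thesis
      by (rule eq_if_multiple_of_char[OF three])
  qed
  have F1: "f \<nu> - f \<mu> = \<delta> * C * r\<^sup>2 * B ^ 4"
  proof -
    have "f \<nu> - f \<mu> - \<delta> * C * r\<^sup>2 * B ^ 4 =
        3 * (4*A^5*B^7 - 2*A^6*B^6 - 6*A^3*B^9 + 4*A^3*B^6*\<mu> + 6*A^2*B^10 - 8*A^2*B^7*\<mu>
          - 2*A*B^11 + 4*A*B^8*\<mu>) +
        (2*A^5*B - A^6 - 3*A^4*B^2 - A^3*B^3 + 2*A^3*\<mu> + 6*A^2*B^4 - 4*A^2*B*\<mu> - 6*A*B^5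
          + 8*A*B^2*\<mu> + 2*B^6 - 4*B^3*\<mu>) * (\<mu>\<^sup>2 - S * \<mu> + A ^ 3 * B * C\<^sup>2)"
      unfolding f_def \<delta>_def \<nu> r_def T_def Q_def S_def C_eq by algebra
    from this[unfolded quad mult_zero_right add_0_right] show ?thesis
      by (rule eq_if_multiple_of_char[OF three])
  qed

  have s1: "B\<^sup>2 * C ^ 3 * s1 = E\<^sup>2 * b"
  proof -
    have "E ^ 3 * A\<^sup>2 * (f \<mu> + f \<nu>) = B ^ 6 * C ^ 5 * (E ^ 3 * (W2\<^sup>2 / W1 ^ 8) - E ^ 3 * (W3\<^sup>2 / W5 ^ 8))"
      using y(1,2) unfolding f_def by algebra
    also have "\<dots> = B ^ 6 * C\<^sup>2 * (C * (x1 - x5)) ^ 3 + B ^ 6 * C ^ 4 * (C * (x1 - x5)) * s1"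
      unfolding diff[OF c1 c5] s1_def by algebra
    finally have "E * A\<^sup>2 * B ^ 4 * C * (B\<^sup>2 * C ^ 3 * s1) = E * A\<^sup>2 * B ^ 4 * C * (E\<^sup>2 * b)"
      unfolding G1 D15 by algebra
    then show ?thesis by (rule cancel_left[rotated]) (use nzs in simp)
  qed
  have s2: "A ^ 3 * C\<^sup>2 * s2 = E\<^sup>2 * b2"
  proof -
    have "E ^ 3 * (- (h \<mu> + h \<nu>)) = A ^ 4 * C ^ 5 * (E ^ 3 * (W4\<^sup>2 / W2 ^ 8) - E ^ 3 * (W6\<^sup>2 / W3 ^ 8))"
      using y(3,4) unfolding h_def by algebra
    also have "\<dots> = A * C ^ 5 * (A * (x2 - x3)) ^ 3 + A ^ 3 * C ^ 5 * (A * (x2 - x3)) * s2"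
      unfolding diff[OF c2 c3] s2_def by algebra
    finally have "E * B\<^sup>2 * C ^ 3 * (A ^ 3 * C\<^sup>2 * s2) = E * B\<^sup>2 * C ^ 3 * (E\<^sup>2 * b2)"
      unfolding G2 D23 by algebra
    then show ?thesis by (rule cancel_left[rotated]) (use nzs in simp)
  qed
  have s12: "A * C * (s1 - s2) = E * \<delta>"
  proof -
    have "s1 - s2 = (x1 - x2) + (x5 - x3)" by (simp add: s1_def s2_def)
    also have "\<dots> = E * (W3 ^ 3 * W5 - W1 * W2 ^ 3) * A * B\<^sup>2"
      unfolding d12 d53 A_def B_def using nz by (simp add: field_simps power2_eq_square power3_eq_cube)
    finally show ?thesis unfolding \<delta>_def \<mu>_def \<nu>_def by algebra
  qed
  have scale: "T\<^sup>2 = E * \<delta> * c"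
  proof -
    have bb: "b * A ^ 3 - b2 * B\<^sup>2 * C = \<delta>\<^sup>2 * c"
      by (rule eq_if_multiple_of_char[OF three, of _ _
            "A^9*B - 2*A^8*B^2 - A^7*B^3 + 3*A^6*B^4 - 4*A^5*B^5 - 3*A^4*B^6 + 2*A^3*B^7 + A^2*B^8 - A*B^9"])
        (unfold D2 S_def b_def b2_def c_def C_eq, algebra)
    have "A ^ 3 * B\<^sup>2 * C ^ 3 * (s1 - s2) = E\<^sup>2 * (b * A ^ 3 - b2 * B\<^sup>2 * C)"
      using s1 s2 by algebra
    then have "E * \<delta> * T\<^sup>2 = E * \<delta> * (E * \<delta> * c)"
      using s12 unfolding bb T_def by algebra
    then show ?thesis by (rule cancel_left[rotated]) (use nzs \<delta> in simp)
  qed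
  have T: "T \<noteq> 0" using nzs by (simp add: T_def)
  have c: "c \<noteq> 0" using scale T by auto
  have N: "E\<^sup>2 * \<delta>\<^sup>2 * c\<^sup>2 = T ^ 4" using scale by algebra

  \<comment> \<open>As 2 = -1, the sum of the squares of x1 and x5 is minus the sum of the squares
    of x1 + x5 and x1 - x5.\<close>
  have sum: "E ^ 3 * (W2\<^sup>2 / W1 ^ 8) + E ^ 3 * (W3\<^sup>2 / W5 ^ 8) = s1 ^ 3 - s1\<^sup>2 - (x1 - x5)\<^sup>2 + E ^ 4"
    by (rule eq_if_multiple_of_char[OF three, of _ _ "x1\<^sup>2 + x5\<^sup>2 - x1\<^sup>2 * x5 - x1 * x5\<^sup>2 - E ^ 4"])
      (unfold c1 c5 s1_def, algebra)
  have "C * B ^ 4 * (B\<^sup>2 * C ^ 4 * (s1 ^ 3 - s1\<^sup>2 - (x1 - x5)\<^sup>2 + E ^ 4)) = E ^ 3 * A\<^sup>2 * (f \<nu> - f \<mu>)"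
    unfolding sum[symmetric] using y(1,2) unfolding f_def by algebra
  then have "C * B ^ 4 * (B\<^sup>2 * C ^ 4 * (s1 ^ 3 - s1\<^sup>2 - (x1 - x5)\<^sup>2 + E ^ 4)) = C * B ^ 4 * (E ^ 3 * A\<^sup>2 * \<delta> * r\<^sup>2)"
    unfolding F1 by algebra
  then have "B\<^sup>2 * C ^ 4 * (s1 ^ 3 - s1\<^sup>2 - (x1 - x5)\<^sup>2 + E ^ 4) = E ^ 3 * A\<^sup>2 * \<delta> * r\<^sup>2"
    by (rule cancel_left[rotated]) (use nzs in simp)
  then have "(B\<^sup>2 * C ^ 3 * s1) ^ 3 - B\<^sup>2 * C ^ 3 * (B\<^sup>2 * C ^ 3 * s1)\<^sup>2 - B ^ 6 * C ^ 7 * (C * (x1 - x5))\<^sup>2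
      + B ^ 6 * C ^ 9 * E ^ 4 = B ^ 4 * C ^ 5 * (E ^ 3 * A\<^sup>2 * \<delta> * r\<^sup>2)"
    by algebra
  then have "E\<^sup>2 * (E ^ 4 * b ^ 3 - B\<^sup>2 * C ^ 3 * E\<^sup>2 * b\<^sup>2 - B ^ 6 * C ^ 7 * A ^ 4 + B ^ 6 * C ^ 9 * E\<^sup>2) =
      E\<^sup>2 * (B ^ 4 * C ^ 5 * A\<^sup>2 * r\<^sup>2 * (E * \<delta>))"
    unfolding s1 D15 by algebra
  then have "E ^ 4 * b ^ 3 - B\<^sup>2 * C ^ 3 * E\<^sup>2 * b\<^sup>2 - B ^ 6 * C ^ 7 * A ^ 4 + B ^ 6 * C ^ 9 * E\<^sup>2 =
      B ^ 4 * C ^ 5 * A\<^sup>2 * r\<^sup>2 * (E * \<delta>)"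
    by (rule cancel_left[rotated]) (use nzs in simp)
  then have "c * (E ^ 4 * b ^ 3 - B\<^sup>2 * C ^ 3 * E\<^sup>2 * b\<^sup>2 + B ^ 6 * C ^ 9 * E\<^sup>2) =
      B ^ 6 * C ^ 7 * A ^ 4 * c + B ^ 4 * C ^ 5 * A\<^sup>2 * r\<^sup>2 * (E * \<delta> * c)"
    by algebra
  also have "\<dots> = B ^ 6 * C ^ 7 * A ^ 4 * (c + r\<^sup>2)"
    unfolding scale[symmetric] T_def by algebra
  also have "c + r\<^sup>2 = - g"
    by (rule eq_if_multiple_of_char[OF three, of _ _ "A^4 - A^3*B + A*B^3 + B^4"])
      (unfold c_def r_def g_def, algebra)
  finally have e1: "c * (E ^ 4 * b ^ 3 - B\<^sup>2 * C ^ 3 * E\<^sup>2 * b\<^sup>2 + B ^ 6 * C ^ 9 * E\<^sup>2) = - (B ^ 6 * C ^ 7 * A ^ 4 * g)"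
    by simp
  \<comment> \<open>Multiplying by the squares of \<delta> and c lets \<open>N\<close> trade E^2 for
    T^4.\<close>
  have "c * T ^ 4 * (E\<^sup>2 * b ^ 3 - B\<^sup>2 * C ^ 3 * b\<^sup>2 + B ^ 6 * C ^ 9) = c * T ^ 4 * (- (B\<^sup>2 * C ^ 3 * g * \<delta>\<^sup>2 * c))"
  proof -
    have "c * T ^ 4 * (E\<^sup>2 * b ^ 3 - B\<^sup>2 * C ^ 3 * b\<^sup>2 + B ^ 6 * C ^ 9) =
        \<delta>\<^sup>2 * c\<^sup>2 * (c * (E ^ 4 * b ^ 3 - B\<^sup>2 * C ^ 3 * E\<^sup>2 * b\<^sup>2 + B ^ 6 * C ^ 9 * E\<^sup>2))"
      unfolding N[symmetric] by algebra
    also have "\<dots> = c * T ^ 4 * (- (B\<^sup>2 * C ^ 3 * g * \<delta>\<^sup>2 * c))"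
      unfolding e1 T_def by algebra
    finally show ?thesis .
  qed
  then have e2: "E\<^sup>2 * b ^ 3 - B\<^sup>2 * C ^ 3 * b\<^sup>2 + B ^ 6 * C ^ 9 = - (B\<^sup>2 * C ^ 3 * g * \<delta>\<^sup>2 * c)"
    by (rule cancel_left[rotated]) (use c T in simp)
  have "B\<^sup>2 * C ^ 3 * (B ^ 4 * C ^ 6 * (\<delta>\<^sup>2 * c\<^sup>2)) =
      B\<^sup>2 * C ^ 3 * (\<delta>\<^sup>2 * c\<^sup>2 * b\<^sup>2 - g * (\<delta>\<^sup>2)\<^sup>2 * c ^ 3 - A ^ 4 * B\<^sup>2 * C * b ^ 3)"
  proof -
    have "B\<^sup>2 * C ^ 3 * (B ^ 4 * C ^ 6 * (\<delta>\<^sup>2 * c\<^sup>2)) =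
        \<delta>\<^sup>2 * c\<^sup>2 * (- (B\<^sup>2 * C ^ 3 * g * \<delta>\<^sup>2 * c) + B\<^sup>2 * C ^ 3 * b\<^sup>2) - (E\<^sup>2 * \<delta>\<^sup>2 * c\<^sup>2) * b ^ 3"
      unfolding e2[symmetric] by algebra
    then show ?thesis unfolding N T_def by algebra
  qed
  then have "B ^ 4 * C ^ 6 * (\<delta>\<^sup>2 * c\<^sup>2) =
      \<delta>\<^sup>2 * c\<^sup>2 * b\<^sup>2 - g * (\<delta>\<^sup>2)\<^sup>2 * c ^ 3 - A ^ 4 * B\<^sup>2 * C * b ^ 3"
    by (rule cancel_left[rotated]) (use nzs in simp)
  \<comment> \<open>With E eliminated and the square of \<delta> given by \<open>D2\<close>, this is
    an identity between forms of degree 28 in A and B.\<close>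
  also have "\<dots> = A ^ 5 * B ^ 9 * C ^ 11 * k"
    by (rule eq_if_multiple_of_char[OF three, of _ _
          "- (7*A^26*B^2 - A^27*B - 19*A^25*B^3 + 21*A^24*B^4 + 9*A^23*B^5 - 59*A^22*B^6
            + 69*A^21*B^7 + 8*A^20*B^8 - 77*A^19*B^9 + 110*A^18*B^10 - 107*A^17*B^11 + 124*A^16*B^12
            - 138*A^15*B^13 - 79*A^14*B^14 + 162*A^13*B^15 - 354*A^12*B^16 + 271*A^11*B^17
            - 372*A^10*B^18 + 183*A^9*B^19 - 69*A^8*B^20 - 3*A^7*B^21 - 10*A^6*B^22 + 9*A^5*B^23
            + 6*A^4*B^24 - 5*A^3*B^25 - 5*A^2*B^26 - A*B^27)"])
      (unfold D2 S_def b_def c_def g_def k_def C_eq, algebra)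
  finally have "B ^ 4 * C ^ 6 * (\<delta>\<^sup>2 * c\<^sup>2) = B ^ 4 * C ^ 6 * (T ^ 5 * k)"
    unfolding T_def by algebra
  then have "\<delta>\<^sup>2 * c\<^sup>2 = T ^ 5 * k"
    by (rule cancel_left[rotated]) (use nzs in simp)
  then have "T ^ 4 * (E\<^sup>2 * T * k) = T ^ 4 * 1"
    using N by algebra
  then have "E\<^sup>2 * T * k = 1"
    by (rule cancel_left[rotated]) (use T in simp)
  then show ?thesis unfolding T_def k_def .
qed

end

section \<open>Euler functions and their dissections\<close>

definition euler :: "nat \<Rightarrow> 'a::comm_ring_1 fps" where
  "euler k = eprod {n. n > 0 \<and> k dvd n}"

lemma euler_nth_0 [simp]: "euler k $ 0 = 1"
  by (simp add: euler_def)

lemma euler_nonzero [simp]: "euler k \<noteq> (0 :: 'a::comm_ring_1 fps)"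
  by (simp add: euler_def)

lemma euler_times:
  assumes "d > 0"
  shows "(euler (d * k) :: 'a::idom fps) = euler k oo fps_X ^ d"
proof -
  have "{n. n > 0 \<and> d * k dvd n} = (*) d ` {n. n > 0 \<and> k dvd n}"
    using assms by (auto elim!: dvdE simp: image_iff)
  then show ?thesis
    using assms by (simp add: euler_def eprod_image_times)
qed

lemma euler_power_char:
  assumes "prime p" "CHAR('a) = p" "\<And>c :: 'a. c ^ p = c"
  shows "(euler k :: 'a::idom fps) ^ p = euler (p * k)"
  unfolding fps_power_char[OF assms, of "euler k"]
  by (rule euler_times[symmetric]) (use assms(1) prime_gt_0_nat in blast)

lemma th_power_char:
  assumes "prime p" "CHAR('a) = p" "\<And>c :: 'a. c ^ p = c"
  shows "(th c M a :: 'a::idom fps) ^ p = th (p * c) M a"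
  unfolding fps_power_char[OF assms, of "th c M a"]
  by (rule th_compose_X_power) (use assms(1) prime_gt_0_nat in blast)

section \<open>Infinite products for the theta series of level 13\<close>

definition jac :: "nat \<Rightarrow> 'a::comm_ring_1 fps" where
  "jac a = euler 13 * eprod {n. n mod 13 = a} * eprod {n. n mod 13 = 13 - a}"

lemma jac_nth_0 [simp]: "jac a $ 0 = 1"
  by (simp add: jac_def)

lemma th_13_eq_jac:
  assumes "0 < a" "a < 13" "c > 0"
  shows "(th c 13 (int a) :: 'a::idom fps) = fps_X ^ (c * nat ((13 - 2 * int a)\<^sup>2)) * (jac a oo fps_X ^ (104 * c))"
  using th_triple_product[of a 13 c, where 'a = 'a] assms by (simp add: jac_def euler_def)

lemma eprod_residues_13:
  "(euler 1 :: 'a::comm_ring_1 fps) =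
    euler 13 * (\<Prod>a\<in>{1, 2, 3, 4, 5, 6, 7, 8, 9, 10, 11, 12}. eprod {n. n mod 13 = a})"
proof -
  have *: "(eprod {n. n mod 13 \<in> A} :: 'a fps) = (\<Prod>a\<in>A. eprod {n. n mod 13 = a})" if "finite A" for A :: "nat set"
    using that
  proof (induction A rule: finite_induct)
    case empty
    show ?case by (simp add: eprod_def fps_eq_iff)
  next
    case (insert a A)
    have "{n. n mod 13 \<in> insert a A} = {n. n mod 13 = a} \<union> {n. n mod 13 \<in> A}" by auto
    then show ?case using insert by (simp add: eprod_Un_disjoint disjoint_iff)
  qed
  let ?A = "{1, 2, 3, 4, 5, 6, 7, 8, 9, 10, 11, 12} :: nat set"
  have "n > 0 \<longleftrightarrow> n > 0 \<and> 13 dvd n \<or> n mod 13 \<in> ?A" for n :: nat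
    unfolding insert_iff empty_iff by presburger
  then have "{n :: nat. n > 0 \<and> 1 dvd n} = {n. n > 0 \<and> 13 dvd n} \<union> {n. n mod 13 \<in> ?A}"
    by auto
  moreover have "{n :: nat. n > 0 \<and> 13 dvd n} \<inter> {n. n mod 13 \<in> ?A} = {}"
    by (auto simp: dvd_eq_mod_eq_0)
  ultimately have "(euler 1 :: 'a fps) = euler 13 * eprod {n. n mod 13 \<in> ?A}"
    unfolding euler_def by (simp only: eprod_Un_disjoint)
  also have "\<dots> = euler 13 * (\<Prod>a\<in>?A. eprod {n. n mod 13 = a})"
    by (subst *) auto
  finally show ?thesis .
qed

text \<open>Of the six factors \<open>euler 13\<close>, one completes the twelve nonzero residue
  classes to \<open>euler 1\<close>.\<close>

lemma jac_product:
  "(jac 1 * jac 5 * (jac 2 * jac 3) * (jac 4 * jac 6) :: 'a::comm_ring_1 fps) = euler 1 * euler 13 ^ 5"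
proof -
  let ?e = "\<lambda>a. eprod {n. n mod 13 = a} :: 'a fps"
  have "(euler 1 :: 'a fps) = euler 13 * (?e 1 * ?e 2 * ?e 3 * ?e 4 * ?e 5 * ?e 6 * ?e 7 * ?e 8 * ?e 9 * ?e 10 * ?e 11 * ?e 12)"
    unfolding eprod_residues_13 by (simp add: mult.assoc)
  then show ?thesis unfolding jac_def by (simp add: power_numeral_reduce mult_ac)
qed

text \<open>286 = 11^2 + 9^2 + 7^2 + 5^2 + 3^2 + 1^2 collects the leading exponents (13 -
  2a)^2.\<close>

lemma th_product:
  assumes "c > 0"
  shows "(th c 13 1 * th c 13 5 * (th c 13 2 * th c 13 3) * (th c 13 4 * th c 13 6) :: 'a::idom fps) =
    fps_X ^ (286 * c) * ((euler 1 * euler 13 ^ 5) oo fps_X ^ (104 * c))"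
proof -
  have j: "th c 13 1 = fps_X ^ (121 * c) * (jac 1 oo fps_X ^ (104 * c) :: 'a fps)"
    "th c 13 2 = fps_X ^ (81 * c) * (jac 2 oo fps_X ^ (104 * c) :: 'a fps)"
    "th c 13 3 = fps_X ^ (49 * c) * (jac 3 oo fps_X ^ (104 * c) :: 'a fps)"
    "th c 13 4 = fps_X ^ (25 * c) * (jac 4 oo fps_X ^ (104 * c) :: 'a fps)"
    "th c 13 5 = fps_X ^ (9 * c) * (jac 5 oo fps_X ^ (104 * c) :: 'a fps)"
    "th c 13 6 = fps_X ^ c * (jac 6 oo fps_X ^ (104 * c) :: 'a fps)"
    using th_13_eq_jac[of 1 c, where 'a = 'a] th_13_eq_jac[of 2 c, where 'a = 'a] th_13_eq_jac[of 3 c, where 'a = 'a]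
      th_13_eq_jac[of 4 c, where 'a = 'a] th_13_eq_jac[of 5 c, where 'a = 'a] th_13_eq_jac[of 6 c, where 'a = 'a] assms
    by (simp_all add: mult.commute)
  have "fps_X ^ (286 * c) = (fps_X ^ (121 * c) * fps_X ^ (9 * c) * (fps_X ^ (81 * c) * fps_X ^ (49 * c)) *
      (fps_X ^ (25 * c) * fps_X ^ c) :: 'a fps)"
    unfolding power_add[symmetric] by (rule arg_cong[of _ _ "power fps_X"]) simp
  moreover have "((jac 1 * jac 5 * (jac 2 * jac 3) * (jac 4 * jac 6)) oo fps_X ^ (104 * c) :: 'a fps) =
      (jac 1 oo fps_X ^ (104 * c)) * (jac 5 oo fps_X ^ (104 * c)) *
      ((jac 2 oo fps_X ^ (104 * c)) * (jac 3 oo fps_X ^ (104 * c))) *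
      ((jac 4 oo fps_X ^ (104 * c)) * (jac 6 oo fps_X ^ (104 * c)))"
    using assms by (simp add: fps_compose_mult_distrib)
  ultimately show ?thesis
    unfolding j jac_product[symmetric] by (simp only: mult_ac)
qed

lemma fps_X_power_mult_unit_nonzero:
  fixes u :: "'a::idom fps"
  assumes "u $ 0 = 1"
  shows "fps_X ^ r * u \<noteq> 0"
proof -
  have "u \<noteq> 0" using assms by auto
  then show ?thesis by simp
qed

lemma th_13_nonzero:
  assumes "0 < a" "a < 13" "c > 0"
  shows "th c 13 (int a) \<noteq> (0 :: 'a::idom fps)"
  unfolding th_13_eq_jac[OF assms]
  by (rule fps_X_power_mult_unit_nonzero) (use assms in simp)

lemma th_13_values:
  fixes c :: nat
  defines "T \<equiv> th c 13 :: int \<Rightarrow> 'a::comm_ring_1 fps"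
  shows "T 7 = T 6" "T 8 = T 5" "T 9 = T 4" "T 10 = T 3" "T 11 = T 2" "T 12 = T 1"
    "T 14 = - T 1" "T 15 = - T 2" "T 16 = - T 3" "T 17 = - T 4" "T 18 = - T 5" "T 19 = - T 6"
    "T 20 = - T 6" "T 21 = - T 5" "T 22 = - T 4" "T 23 = - T 3"
    "T (- 1) = - T 1" "T (- 2) = - T 2" "T (- 3) = - T 3" "T (- 4) = - T 4" "T (- 5) = - T 5" "T (- 6) = - T 6"
    "T (- 7) = - T 6" "T (- 8) = - T 5" "T (- 9) = - T 4" "T (- 10) = - T 3" "T (- 11) = - T 2" "T (- 12) = - T 1"
proof -
  have r: "T (13 - a) = T a" for a unfolding T_def using th_reflect[of c 13 a] by simp
  have p: "T (a + 13) = - T a" for a unfolding T_def using th_add_period[of c 13 a] by simp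
  have m: "T (- a) = - T a" for a unfolding T_def by (rule th_minus)
  show 1: "T 7 = T 6" "T 8 = T 5" "T 9 = T 4" "T 10 = T 3" "T 11 = T 2" "T 12 = T 1"
    using r[of 6] r[of 5] r[of 4] r[of 3] r[of 2] r[of 1] by simp_all
  show "T 14 = - T 1" "T 15 = - T 2" "T 16 = - T 3" "T 17 = - T 4" "T 18 = - T 5" "T 19 = - T 6"
    "T 20 = - T 6" "T 21 = - T 5" "T 22 = - T 4" "T 23 = - T 3"
    using p[of 1] p[of 2] p[of 3] p[of 4] p[of 5] p[of 6] p[of 7] p[of 8] p[of 9] p[of 10]
    by (simp_all add: 1)
  show "T (- 1) = - T 1" "T (- 2) = - T 2" "T (- 3) = - T 3" "T (- 4) = - T 4" "T (- 5) = - T 5" "T (- 6) = - T 6"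
    "T (- 7) = - T 6" "T (- 8) = - T 5" "T (- 9) = - T 4" "T (- 10) = - T 3" "T (- 11) = - T 2" "T (- 12) = - T 1"
    by (simp_all only: m 1)
qed

text \<open>Each is one instance of the three-term relation with its arguments reduced to 1, ..., 6.
  The choice a = 0 makes T(a+b) T(a-b) minus a square, which is how cubes arise.\<close>

lemma th_13_relations:
  fixes c :: nat
  assumes "c > 0"
  defines "T \<equiv> th c 13 :: int \<Rightarrow> 'a::idom fps"
  shows "T 1 * T 2 * T 3 * T 5 + T 1 * T 4 * T 5 * T 6 = T 2 * T 3 * T 4 * T 6"
    and "T 1 ^ 3 * T 5 + T 1 * T 3 ^ 3 = T 2 ^ 3 * T 4"
    and "T 1 * T 5 ^ 3 + T 2 ^ 3 * T 5 = T 3 ^ 3 * T 6"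
    and "T 1 * (T 2)\<^sup>2 * T 6 + T 1 * (T 4)\<^sup>2 * T 5 = T 2 * (T 3)\<^sup>2 * T 6"
    and "(T 1)\<^sup>2 * T 2 * T 5 + T 2 * T 4 * (T 5)\<^sup>2 = (T 3)\<^sup>2 * T 4 * T 6"
    and "T 1 ^ 3 * T 6 + T 2 * T 4 ^ 3 = T 3 ^ 3 * T 5"
    and "T 1 * T 2 ^ 3 + T 3 * T 6 ^ 3 = T 4 * T 5 ^ 3"
proof -
  have t: "T (a + b) * T (a - b) * (T (x + y) * T (x - y)) - T (a + x) * T (a - x) * (T (b + y) * T (b - y)) +
      T (a + y) * T (a - y) * (T (b + x) * T (b - x)) = 0" for a b x y
    unfolding T_def using th_three_term[of c 13, where 'a = 'a] assms(1) by simp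
  note v = th_13_values[of c, where 'a = 'a, folded T_def]
  show "T 1 * T 2 * T 3 * T 5 + T 1 * T 4 * T 5 * T 6 = T 2 * T 3 * T 4 * T 6"
    using t[of 8 10 11 12] by (simp only: arith_simps numeral_One add_0_left diff_0 v) algebra
  show "T 1 ^ 3 * T 5 + T 1 * T 3 ^ 3 = T 2 ^ 3 * T 4"
    using t[of 0 10 11 12] by (simp only: arith_simps numeral_One add_0_left diff_0 v) algebra
  show "T 1 * T 5 ^ 3 + T 2 ^ 3 * T 5 = T 3 ^ 3 * T 6"
    using t[of 0 8 10 11] by (simp only: arith_simps numeral_One add_0_left diff_0 v) algebra
  show "T 1 * (T 2)\<^sup>2 * T 6 + T 1 * (T 4)\<^sup>2 * T 5 = T 2 * (T 3)\<^sup>2 * T 6"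
    using t[of 7 8 9 11] by (simp only: arith_simps numeral_One add_0_left diff_0 v) algebra
  show "(T 1)\<^sup>2 * T 2 * T 5 + T 2 * T 4 * (T 5)\<^sup>2 = (T 3)\<^sup>2 * T 4 * T 6"
    using t[of 7 8 10 11] by (simp only: arith_simps numeral_One add_0_left diff_0 v) algebra
  show "T 1 ^ 3 * T 6 + T 2 * T 4 ^ 3 = T 3 ^ 3 * T 5"
    using t[of 0 9 10 12] by (simp only: arith_simps numeral_One add_0_left diff_0 v) algebra
  show "T 1 * T 2 ^ 3 + T 3 * T 6 ^ 3 = T 4 * T 5 ^ 3"
    using t[of 0 7 8 11] by (simp only: arith_simps numeral_One add_0_left diff_0 v) algebra
qed

section \<open>The modular equation modulo 3\<close>

text \<open>Three explicit elements turn the field axioms into finite case distinctions; each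
  nonzero element is its own inverse.\<close>

datatype f3 = F0 | F1 | F2

instantiation f3 :: field
begin

definition "0 = F0"
definition "1 = F1"

fun plus_f3 :: "f3 \<Rightarrow> f3 \<Rightarrow> f3" where
  "F0 + y = y" | "x + F0 = x" | "F1 + F1 = F2" | "F1 + F2 = F0" | "F2 + F1 = F0" | "F2 + F2 = F1"

fun uminus_f3 :: "f3 \<Rightarrow> f3" where
  "- F0 = F0" | "- F1 = F2" | "- F2 = F1"

definition "x - y = x + - (y :: f3)"

fun times_f3 :: "f3 \<Rightarrow> f3 \<Rightarrow> f3" where
  "F0 * y = F0" | "F1 * y = y" | "F2 * y = - y"

definition "inverse x = (x :: f3)"
definition "x div y = x * (y :: f3)"

instance
proof
  fix a b c :: f3
  show "a + b + c = a + (b + c)" by (cases a; cases b; cases c) simp_all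
  show "a + b = b + a" by (cases a; cases b) simp_all
  show "0 + a = a" by (simp add: zero_f3_def)
  show "- a + a = 0" by (cases a) (simp_all add: zero_f3_def)
  show "a - b = a + - b" by (simp add: minus_f3_def)
  show "a * b * c = a * (b * c)" by (cases a; cases b; cases c) simp_all
  show "a * b = b * a" by (cases a; cases b) simp_all
  show "1 * a = a" by (simp add: one_f3_def)
  show "(a + b) * c = a * c + b * c" by (cases a; cases b; cases c) simp_all
  show "(0 :: f3) \<noteq> 1" by (simp add: zero_f3_def one_f3_def)
  show "a \<noteq> 0 \<Longrightarrow> inverse a * a = 1"
    by (cases a) (simp_all add: zero_f3_def one_f3_def inverse_f3_def)
  show "a div b = a * inverse b" by (simp add: divide_f3_def inverse_f3_def)
  show "inverse 0 = (0 :: f3)" by (simp add: inverse_f3_def)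
qed

end

lemma f3_cube: "c ^ 3 = (c :: f3)"
  by (cases c) (simp_all add: power3_eq_cube)

lemma f3_three: "(3 :: f3) = 0"
proof -
  have "(3 :: f3) = 1 + 1 + 1" by simp
  also have "\<dots> = 0" by (simp only: one_f3_def zero_f3_def plus_f3.simps)
  finally show ?thesis .
qed

lemma three_is_prime: "prime (3 :: nat)"
  by (simp add: prime_nat_numeral_eq)

lemma f3_CHAR: "CHAR(f3) = 3"
proof -
  have "CHAR(f3) dvd 3" using of_nat_eq_0_iff_char_dvd[of 3, where 'a = f3] f3_three by simp
  moreover have "CHAR(f3) \<noteq> 1"
    using of_nat_CHAR[where 'a = f3] by (metis of_nat_1 zero_neq_one)
  ultimately show ?thesis using three_is_prime by (auto simp: prime_nat_iff)
qed

lemmas f3_frobenius = three_is_prime f3_CHAR f3_cube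

lemma three_fps: "(3 :: f3 fps) = 0"
  by (simp add: f3_three numeral_fps_const)

lemma three_fls: "(3 :: f3 fls) = 0"
  using three_fps by (metis fps_to_fls_numeral fps_zero_to_fls)

lemma cube_cancel:
  fixes x y :: "'a::idom"
  assumes "(3 :: 'a) = 0" "x ^ 3 = y ^ 3"
  shows "x = y"
proof -
  have "(x - y) ^ 3 = (x ^ 3 - y ^ 3) - 3 * (x * y * (x - y))" by algebra
  then show ?thesis using assms by simp
qed

section \<open>Residue classes modulo 39 and the 3-torsion values\<close>

lemma eprod_residue_split_3:
  fixes a :: nat
  assumes "a < 13"
  shows "(eprod {n. n mod 13 = a} :: 'a::comm_ring_1 fps) =
    eprod {n. n mod 39 = a} * eprod {n. n mod 39 = a + 13} * eprod {n. n mod 39 = a + 26}"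
proof -
  have "n mod 13 = a \<longleftrightarrow> (n mod 39 = a \<or> n mod 39 = a + 13) \<or> n mod 39 = a + 26" for n :: nat
  proof -
    have "n mod 39 = 13 * (n div 13 mod 3) + n mod 13" using mod_mult2_eq[of n 13 3] by simp
    moreover have "n div 13 mod 3 = 0 \<or> n div 13 mod 3 = 1 \<or> n div 13 mod 3 = 2" by linarith
    moreover have "n mod 13 < 13" by simp
    ultimately show ?thesis using assms by (elim disjE) linarith+
  qed
  then have "{n. n mod 13 = a} = ({n. n mod 39 = a} \<union> {n. n mod 39 = a + 13}) \<union> {n. n mod 39 = a + 26}"
    by blast
  then show ?thesis
    by (simp only:) (subst eprod_Un_disjoint, force, subst eprod_Un_disjoint, force, rule refl)
qed

lemma euler_13_split_3:
  "(euler 13 :: 'a::comm_ring_1 fps) = euler 39 * eprod {n. n mod 39 = 13} * eprod {n. n mod 39 = 26}"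
proof -
  have "n > 0 \<and> 13 dvd n \<longleftrightarrow> ((n > 0 \<and> 39 dvd n) \<or> n mod 39 = 13) \<or> n mod 39 = 26" for n :: nat
  proof -
    have "n mod 39 = 13 * (n div 13 mod 3) + n mod 13" using mod_mult2_eq[of n 13 3] by simp
    moreover have "n div 13 mod 3 = 0 \<or> n div 13 mod 3 = 1 \<or> n div 13 mod 3 = 2" by linarith
    moreover have "n mod 39 = 0 \<or> n > 0" by (cases n) auto
    ultimately show ?thesis unfolding dvd_eq_mod_eq_0 by (cases "n = 0") (simp, elim disjE, auto)
  qed
  then have "{n. n > 0 \<and> 13 dvd n} = ({n. n > 0 \<and> 39 dvd n} \<union> {n. n mod 39 = 13}) \<union> {n :: nat. n mod 39 = 26}"
    by blast
  then show ?thesis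
    unfolding euler_def by (simp only:) (subst eprod_Un_disjoint, force, subst eprod_Un_disjoint, force, rule refl)
qed

text \<open>At a third of the period, the classes 0, 13 and 26 modulo 39 together fill the multiples
  of 13.\<close>

lemma th_39_13: "(th 1 39 13 :: 'a::idom fps) = fps_X ^ 169 * (euler 13 oo fps_X ^ 312)"
  unfolding euler_13_split_3 unfolding euler_def using th_triple_product[of 13 39 1, where 'a = 'a] by simp

text \<open>The six residue classes modulo 39 on the left are those of b and -b modulo 13. By
  Frobenius the cube of \<open>euler 39\<close> is the ninth power of \<open>euler 13\<close>: one
  factor completes the level 13 series, eight go into \<open>th 1 39 13 ^ 8\<close>, as does the
  surplus exponent 1352 = 8 * 169.\<close>

lemma th_39_triple_product:
  fixes b :: nat
  assumes "0 < b" "b < 13"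
  shows "th 1 39 (int b) * th 1 39 (int b + 13) * th 1 39 (int b + 26) = (th 3 13 (int b) * th 1 39 13 ^ 8 :: f3 fps)"
proof -
  let ?q = "fps_X ^ 312 :: f3 fps"
  let ?e = "\<lambda>a. eprod {n. n mod 39 = a} :: f3 fps"
  have mult: "(f * g) oo ?q = (f oo ?q) * (g oo ?q)" for f g by (simp add: fps_compose_mult_distrib)
  have t1: "th 1 39 (int b) = fps_X ^ nat ((39 - 2 * int b)\<^sup>2) * ((euler 39 * ?e b * ?e (39 - b)) oo ?q)"
    using th_triple_product[of b 39 1, where 'a = f3] assms by (simp add: euler_def)
  have t2: "th 1 39 (int b + 13) = fps_X ^ nat ((13 - 2 * int b)\<^sup>2) * ((euler 39 * ?e (b + 13) * ?e (26 - b)) oo ?q)"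
    using th_triple_product[of "b + 13" 39 1, where 'a = f3] assms by (simp add: euler_def)
  have t3: "th 1 39 (int b + 26) = fps_X ^ nat ((13 + 2 * int b)\<^sup>2) * ((euler 39 * ?e (b + 26) * ?e (13 - b)) oo ?q)"
  proof -
    have "39 - 2 * int (b + 26) = - (13 + 2 * int b)" by simp
    then have "(39 - 2 * int (b + 26))\<^sup>2 = (13 + 2 * int b)\<^sup>2" by (simp only: power2_minus)
    then show ?thesis
      using th_triple_product[of "b + 26" 39 1, where 'a = f3] assms by (simp add: euler_def)
  qed
  have t4: "th 3 13 (int b) = fps_X ^ (3 * nat ((13 - 2 * int b)\<^sup>2)) * ((euler 13 * (?e b * ?e (b + 13) * ?e (b + 26)) *
      (?e (13 - b) * ?e (26 - b) * ?e (39 - b))) oo ?q)"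
    using th_triple_product[of b 13 3, where 'a = f3] assms
      eprod_residue_split_3[of b, where 'a = f3] eprod_residue_split_3[of "13 - b", where 'a = f3]
    by (simp add: euler_def)
  have ex: "nat ((39 - 2 * int b)\<^sup>2) + nat ((13 - 2 * int b)\<^sup>2) + nat ((13 + 2 * int b)\<^sup>2) =
      3 * nat ((13 - 2 * int b)\<^sup>2) + 1352"
  proof -
    have "(39 - 2 * int b)\<^sup>2 + (13 - 2 * int b)\<^sup>2 + (13 + 2 * int b)\<^sup>2 = 3 * (13 - 2 * int b)\<^sup>2 + 1352"
      by algebra
    then have "int (nat ((39 - 2 * int b)\<^sup>2) + nat ((13 - 2 * int b)\<^sup>2) + nat ((13 + 2 * int b)\<^sup>2)) =
        int (3 * nat ((13 - 2 * int b)\<^sup>2) + 1352)" by simp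
    then show ?thesis by (simp only: of_nat_eq_iff)
  qed
  have e39: "(euler 39 :: f3 fps) = euler 13 ^ 3"
    using euler_power_char[OF f3_frobenius, of 13] by simp
  have X: "(fps_X ^ nat ((39 - 2 * int b)\<^sup>2) * fps_X ^ nat ((13 - 2 * int b)\<^sup>2) * fps_X ^ nat ((13 + 2 * int b)\<^sup>2) :: f3 fps) =
      fps_X ^ (3 * nat ((13 - 2 * int b)\<^sup>2)) * (fps_X ^ 169) ^ 8"
    unfolding power_mult[symmetric] power_add[symmetric] using ex by simp
  have cube: "(f ^ 3) oo ?q = (f oo ?q) ^ 3" for f by (simp add: power3_eq_cube mult)
  have key: "x1 * (e ^ 3 * u1 * u6) * (x2 * (e ^ 3 * u2 * u5)) * (x3 * (e ^ 3 * u3 * u4)) =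
      y * (e * (u1 * u2 * u3) * (u4 * u5 * u6)) * (z * e) ^ 8"
    if "x1 * x2 * x3 = y * z ^ 8" for x1 x2 x3 y z e u1 u2 u3 u4 u5 u6 :: "f3 fps"
  proof -
    have "x1 * (e ^ 3 * u1 * u6) * (x2 * (e ^ 3 * u2 * u5)) * (x3 * (e ^ 3 * u3 * u4)) =
        (x1 * x2 * x3) * (e * (u1 * u2 * u3) * (u4 * u5 * u6)) * e ^ 8"
      by (simp add: power_numeral_reduce mult_ac)
    then show ?thesis unfolding that power_mult_distrib by (simp only: mult_ac)
  qed
  show ?thesis
    unfolding t1 t2 t3 t4 th_39_13 e39 mult cube by (rule key[OF X])
qed


lemma th_39_three_a:
  "(th 1 39 (3 * a) :: f3 fps) = th 3 13 a ^ 3"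
  using th_rescale[of 3 1 13 a, where 'a = f3] th_power_char[OF f3_frobenius, of 3 13 a] by simp

text \<open>Laurent series, to have a field. With q = X^312, the cube of \<open>wt a\<close> is the
  theta value at q^(3a) on the Frobenius twist of period q^39; \<open>wp a\<close> and
  \<open>wm a\<close> are the values there after translation by the 3-torsion point q^13 and its
  inverse.\<close>

definition wt :: "int \<Rightarrow> f3 fls" where "wt a = fps_to_fls (th 3 13 a)"
definition \<eta> :: "f3 fls" where "\<eta> = fps_to_fls (th 1 39 13)"
definition wp :: "int \<Rightarrow> f3 fls" where "wp a = fps_to_fls (th 1 39 (3 * a + 13))"
definition wm :: "int \<Rightarrow> f3 fls" where "wm a = fps_to_fls (th 1 39 (3 * a - 13))"

text \<open>The abscissa, on the Tate curve of modulus \<open>q\<^sup>1\<^sup>3\<close> reduced modulo 3, of the point \<open>q\<^sup>a\<close>.\<close>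

definition xt :: "int \<Rightarrow> f3 fls" where "xt a = \<eta> ^ 8 * (wp a + wm a) / wt a ^ 3"

lemma \<eta>_nonzero: "\<eta> \<noteq> 0"
proof -
  have "fps_X ^ 169 * (euler 13 oo fps_X ^ 312 :: f3 fps) \<noteq> 0"
    by (rule fps_X_power_mult_unit_nonzero) simp
  then show ?thesis unfolding \<eta>_def th_39_13 fps_to_fls_eq_0_iff .
qed

text \<open>Trisection of the level 13 series at 3a yields exactly the three translates, and
  Frobenius identifies its cube with a value of \<open>wt\<close>.\<close>

lemma w_trisect: "(wp a + wm a - wt a ^ 3) ^ 3 = wt (3 * a)"
proof -
  have "th 1 13 (3 * a) = th 1 39 (3 * a + 13) + th 1 39 (3 * a - 13) - (th 1 39 (3 * a) :: f3 fps)"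
    using th_trisect[of 1 13 "3 * a", where 'a = f3] by simp
  moreover have "th 1 13 (3 * a) ^ 3 = (th 3 13 (3 * a) :: f3 fps)"
    using th_power_char[OF f3_frobenius, of 1 13 "3 * a"] by simp
  ultimately have "(th 1 39 (3 * a + 13) + th 1 39 (3 * a - 13) - th 3 13 a ^ 3) ^ 3 = (th 3 13 (3 * a) :: f3 fps)"
    by (simp only: th_39_three_a)
  then show ?thesis unfolding wp_def wm_def wt_def
    by (simp only: flip: fps_to_fls_plus fps_to_fls_minus fps_to_fls_power)
qed

text \<open>The three-term relation for 3a + 13, 3a - 13, 13, 0 is the cube of this equation,
  because cubing is additive.\<close>

lemma w_double: "wt (2 * a) * \<eta> = wt a * (wp a - wm a)"
proof -
  let ?T = "th 1 39 :: int \<Rightarrow> f3 fps"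
  have v: "?T 26 = ?T 13" "?T (3 * a + 26) = - ?T (3 * a - 13)" "?T (3 * a - 26) = - ?T (3 * a + 13)"
    using th_reflect[of 1 39 13, where 'a = f3] th_add_period[of 1 39 "3 * a - 13", where 'a = f3]
      th_add_period[of 1 39 "3 * a - 26", where 'a = f3]
    by (simp_all add: algebra_simps)
  have ar: "(3 * a + 13) + (3 * a - 13) = 3 * (2 * a)" "(3 * a + 13) - (3 * a - 13) = 26"
    "(3 * a + 13) + 13 = 3 * a + 26" "(3 * a + 13) - 13 = 3 * a" "(3 * a - 13) + 13 = 3 * a"
    "(3 * a - 13) - 13 = 3 * a - 26" by simp_all
  have "?T (3 * (2 * a)) * ?T 26 * (?T 13 * ?T 13) - ?T (3 * a + 26) * ?T (3 * a) * (?T (3 * a - 13) * ?T (3 * a - 13)) +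
      ?T (3 * a + 13) * ?T (3 * a + 13) * (?T (3 * a) * ?T (3 * a - 26)) = 0"
    using th_three_term[of 1 39 "3 * a + 13" "3 * a - 13" 13 0, where 'a = f3, OF zero_less_one zero_less_numeral]
    unfolding ar add_0_right diff_0_right .
  then have "(th 3 13 (2 * a) * ?T 13) ^ 3 = th 3 13 a ^ 3 * (?T (3 * a + 13) ^ 3 - ?T (3 * a - 13) ^ 3)"
    unfolding v th_39_three_a by algebra
  also have "\<dots> = (th 3 13 a * (?T (3 * a + 13) - ?T (3 * a - 13))) ^ 3"
    by (rule eq_if_multiple_of_char[OF three_fps, of _ _
          "th 3 13 a ^ 3 * (?T (3 * a + 13) * ?T (3 * a - 13) * (?T (3 * a + 13) - ?T (3 * a - 13)))"]) algebra
  finally have "th 3 13 (2 * a) * ?T 13 = th 3 13 a * (?T (3 * a + 13) - ?T (3 * a - 13))"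
    by (rule cube_cancel[OF three_fps])
  then show ?thesis unfolding wt_def \<eta>_def wp_def wm_def
    by (simp only: flip: fps_to_fls_minus fls_times_fps_to_fls)
qed

lemma w_addition:
  fixes a b :: int
  shows "(wt (a + b) * wt (a - b)) ^ 3 * \<eta>\<^sup>2 = wp a * wm a * wt b ^ 6 - wp b * wm b * wt a ^ 6"
proof -
  let ?T = "th 1 39 :: int \<Rightarrow> f3 fps"
  have "3 * a + 3 * b = 3 * (a + b)" "3 * a - 3 * b = 3 * (a - b)" by simp_all
  then have "?T (3 * (a + b)) * ?T (3 * (a - b)) * (?T 13 * ?T 13) - ?T (3 * a + 13) * ?T (3 * a - 13) * (?T (3 * b) * ?T (3 * b)) +
      ?T (3 * a) * ?T (3 * a) * (?T (3 * b + 13) * ?T (3 * b - 13)) = 0"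
    using th_three_term[of 1 39 "3 * a" "3 * b" 13 0, where 'a = f3] by simp
  then have "(th 3 13 (a + b) * th 3 13 (a - b)) ^ 3 * (?T 13)\<^sup>2 =
      ?T (3 * a + 13) * ?T (3 * a - 13) * th 3 13 b ^ 6 - ?T (3 * b + 13) * ?T (3 * b - 13) * th 3 13 a ^ 6"
    unfolding th_39_three_a by algebra
  then show ?thesis unfolding wt_def \<eta>_def wp_def wm_def
    by (simp only: flip: fps_to_fls_minus fls_times_fps_to_fls fps_to_fls_power)
qed

text \<open>Multiplication by 3 as Frobenius followed by the product over the 3-torsion translates.
  The values 3a are 3, 6, 9 and 15; the last is reduced to 2 by antiperiodicity.\<close>

lemma w_triple:
  assumes "a \<in> {1, 2, 3, 5}"
  shows "wt a \<noteq> 0" "wp a * wm a * wt a ^ 3 = - (wt (3 * a) * \<eta> ^ 8)"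
proof -
  show "wt a \<noteq> 0"
    using assms th_13_nonzero[of 1 3, where 'a = f3] th_13_nonzero[of 2 3, where 'a = f3]
      th_13_nonzero[of 3 3, where 'a = f3] th_13_nonzero[of 5 3, where 'a = f3]
    by (auto simp: wt_def)
  let ?T = "th 1 39 :: int \<Rightarrow> f3 fps"
  have m: "?T (- 10) = - ?T 29" "?T (- 7) = - ?T 32" "?T (- 4) = - ?T 35"
    using th_add_period[of 1 39 "- 10", where 'a = f3] th_add_period[of 1 39 "- 7", where 'a = f3]
      th_add_period[of 1 39 "- 4", where 'a = f3] by simp_all
  have "?T (3 * a + 13) * ?T (3 * a - 13) * ?T (3 * a) = - (th 3 13 (3 * a) * ?T 13 ^ 8)"
    using assms th_39_triple_product[of 3] th_39_triple_product[of 6] th_39_triple_product[of 9]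
      th_39_triple_product[of 2] th_13_values(8)[of 3, where 'a = f3]
    by (auto simp: m[unfolded One_nat_def] mult_ac)
  then have "?T (3 * a + 13) * ?T (3 * a - 13) * th 3 13 a ^ 3 = - (th 3 13 (3 * a) * ?T 13 ^ 8)"
    by (simp only: th_39_three_a)
  then show "wp a * wm a * wt a ^ 3 = - (wt (3 * a) * \<eta> ^ 8)"
    unfolding wt_def \<eta>_def wp_def wm_def
    by (simp only: flip: fps_to_fls_uminus fls_times_fps_to_fls fps_to_fls_power)
qed

text \<open>\<open>w_trisect\<close> and \<open>w_triple\<close> turn the cubic and constant terms
  into a multiple of -wp wm. Adding (wp + wm)^2 gives (wp - wm)^2 modulo 3, the square of the
  ordinate by \<open>w_double\<close>.\<close>

lemma x_curve:
  assumes "a \<in> {1, 2, 3, 5}"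
  shows "(\<eta> ^ 6) ^ 3 * ((wt (2 * a))\<^sup>2 / wt a ^ 8) = xt a ^ 3 + (xt a)\<^sup>2 - (\<eta> ^ 6) ^ 4"
proof -
  note wa = w_triple[OF assms]
  have "wt a ^ 9 * (xt a ^ 3 + (xt a)\<^sup>2 - (\<eta> ^ 6) ^ 4) =
      \<eta> ^ 16 * (\<eta> ^ 8 * ((wp a + wm a) ^ 3 - wt a ^ 9) + (wp a + wm a)\<^sup>2 * wt a ^ 3)"
    using wa(1) unfolding xt_def by (simp add: field_simps) algebra
  also have "(wp a + wm a) ^ 3 - wt a ^ 9 = (wp a + wm a - wt a ^ 3) ^ 3"
    by (rule eq_if_multiple_of_char[OF three_fls, of _ _
          "(wp a + wm a) * wt a ^ 3 * (wp a + wm a - wt a ^ 3)"]) algebra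
  also have "\<eta> ^ 8 * (wp a + wm a - wt a ^ 3) ^ 3 = - (wp a * wm a * wt a ^ 3)"
    unfolding w_trisect wa(2) by simp
  also have "- (wp a * wm a * wt a ^ 3) + (wp a + wm a)\<^sup>2 * wt a ^ 3 = wt a ^ 3 * (wp a - wm a)\<^sup>2"
    by (rule eq_if_multiple_of_char[OF three_fls, of _ _ "wp a * wm a * wt a ^ 3"]) algebra
  also have "\<eta> ^ 16 * (wt a ^ 3 * (wp a - wm a)\<^sup>2) = \<eta> ^ 16 * wt a * (wt (2 * a) * \<eta>)\<^sup>2"
    unfolding w_double by algebra
  also have "\<dots> = wt a ^ 9 * ((\<eta> ^ 6) ^ 3 * ((wt (2 * a))\<^sup>2 / wt a ^ 8))"
    using wa(1) by (simp add: field_simps) algebra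
  finally have h: "wt a ^ 9 * (xt a ^ 3 + (xt a)\<^sup>2 - (\<eta> ^ 6) ^ 4) =
      wt a ^ 9 * ((\<eta> ^ 6) ^ 3 * ((wt (2 * a))\<^sup>2 / wt a ^ 8))" .
  show ?thesis
    by (rule cancel_left[OF _ h[symmetric]]) (use wa(1) in simp)
qed

text \<open>The addition formula for abscissae. Up to common factors, \<open>wp c * wm c\<close> is
  the cube of \<open>u c\<close> times \<open>wt c ^ 6\<close>, so \<open>w_addition\<close> is an
  equation between cubes.\<close>

lemma x_diff:
  fixes a b :: int
  assumes "a \<in> {1, 2, 3, 5}" "b \<in> {1, 2, 3, 5}"
  shows "xt a - xt b = - (\<eta> ^ 6 * (wt (a + b) * wt (a - b)) / (wt a * wt b)\<^sup>2)"
proof -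
  note wa = w_triple[OF assms(1)] and wb = w_triple[OF assms(2)]
  define u where "u = (\<lambda>c. (wp c + wm c - wt c ^ 3) / wt c ^ 3)"
  have xu: "xt c = \<eta> ^ 8 * (u c + 1)" if "c \<in> {1, 2, 3, 5}" for c
    using w_triple(1)[OF that] unfolding xt_def u_def by (simp add: field_simps)
  have pm: "wp c * wm c = - (\<eta> ^ 8 * u c ^ 3 * wt c ^ 6)" if "c \<in> {1, 2, 3, 5}" for c
  proof -
    have "wt c ^ 3 * (wp c * wm c) = wt c ^ 3 * (- (\<eta> ^ 8 * u c ^ 3 * wt c ^ 6))"
      using w_triple[OF that] unfolding u_def power_divide w_trisect by (simp add: field_simps)
    then show ?thesis by (rule cancel_left[rotated]) (use w_triple(1)[OF that] in simp)
  qed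
  have "(wt (a + b) * wt (a - b)) ^ 3 * \<eta>\<^sup>2 = - (\<eta> ^ 8 * (u a ^ 3 - u b ^ 3) * wt a ^ 6 * wt b ^ 6)"
    unfolding w_addition pm[OF assms(1)] pm[OF assms(2)] by algebra
  also have "u a ^ 3 - u b ^ 3 = (u a - u b) ^ 3"
    by (rule eq_if_multiple_of_char[OF three_fls, of _ _ "u a * u b * (u a - u b)"]) algebra
  finally have "\<eta>\<^sup>2 * (wt (a + b) * wt (a - b)) ^ 3 = \<eta>\<^sup>2 * (- (\<eta>\<^sup>2 * (u a - u b) * (wt a * wt b)\<^sup>2)) ^ 3"
    by algebra
  then have "(wt (a + b) * wt (a - b)) ^ 3 = (- (\<eta>\<^sup>2 * (u a - u b) * (wt a * wt b)\<^sup>2)) ^ 3"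
    by (rule cancel_left[rotated]) (use \<eta>_nonzero in simp)
  then have "wt (a + b) * wt (a - b) = - (\<eta>\<^sup>2 * (u a - u b) * (wt a * wt b)\<^sup>2)"
    by (rule cube_cancel[OF three_fls])
  moreover have "xt a - xt b = \<eta> ^ 8 * (u a - u b)"
    unfolding xu[OF assms(1)] xu[OF assms(2)] by algebra
  ultimately show ?thesis
    using wa(1) wb(1) by (simp add: field_simps) algebra
qed


lemma modular_equation_mod_3:
  obtains Y :: "f3 fps"
  where "euler 1 ^ 2 + fps_X * euler 13 ^ 2 = euler 1 * euler 13 * Y ^ 3"
proof -
  have nz: "wt 1 \<noteq> 0" "wt 2 \<noteq> 0" "wt 3 \<noteq> 0" "wt 4 \<noteq> 0" "wt 5 \<noteq> 0" "wt 6 \<noteq> 0"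
    using th_13_nonzero[of 1 3, where 'a = f3] th_13_nonzero[of 2 3, where 'a = f3]
      th_13_nonzero[of 3 3, where 'a = f3] th_13_nonzero[of 4 3, where 'a = f3]
      th_13_nonzero[of 5 3, where 'a = f3] th_13_nonzero[of 6 3, where 'a = f3]
    by (auto simp: wt_def)
  have rel: "fps_to_fls f = fps_to_fls g" if "f = g" for f g :: "f3 fps" using that by simp
  note th_rel = th_13_relations[of 3, where 'a = f3, simplified, THEN rel,
      simplified fps_to_fls_plus fls_times_fps_to_fls fps_to_fls_power, folded wt_def]
  interpret theta_relations "wt 1" "wt 2" "wt 3" "wt 4" "wt 5" "wt 6"
    by (unfold_locales; (fact nz | fact th_rel))
  have v: "wt 10 = wt 3" "wt (- 4) = - wt 4" "wt (- 1) = - wt 1" "wt 8 = wt 5"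
    using th_13_values[of 3, where 'a = f3] by (simp_all add: wt_def)
  define E where "E = \<eta> ^ 6"
  have E: "E \<noteq> 0" using \<eta>_nonzero by (simp add: E_def)
  \<comment> \<open>The lowest exponents differ: 3(3 * 7^2 + 3^2) = 468 on one side, 3(11^2 + 3 *
    9^2) = 1092 on the other.\<close>
  have "wt 3 ^ 3 * wt 5 \<noteq> wt 1 * wt 2 ^ 3"
  proof
    assume "wt 3 ^ 3 * wt 5 = wt 1 * wt 2 ^ 3"
    then have "th 3 13 3 ^ 3 * th 3 13 5 = (th 3 13 1 * th 3 13 2 ^ 3 :: f3 fps)"
      unfolding wt_def by (simp flip: fps_to_fls_power fls_times_fps_to_fls)
    moreover have "th 3 13 3 ^ 3 * th 3 13 5 = fps_X ^ 468 * ((jac 3 oo fps_X ^ 312) ^ 3 * (jac 5 oo fps_X ^ 312) :: f3 fps)"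
      using th_13_eq_jac[of 3 3, where 'a = f3] th_13_eq_jac[of 5 3, where 'a = f3]
      by (simp add: power_mult_distrib mult_ac flip: power_mult power_add)
    moreover have "th 3 13 1 * th 3 13 2 ^ 3 = fps_X ^ 1092 * ((jac 1 oo fps_X ^ 312) * (jac 2 oo fps_X ^ 312) ^ 3 :: f3 fps)"
      using th_13_eq_jac[of 1 3, where 'a = f3] th_13_eq_jac[of 2 3, where 'a = f3]
      by (simp add: power_mult_distrib mult_ac flip: power_mult power_add)
    ultimately have "(fps_X ^ 468 * ((jac 3 oo fps_X ^ 312) ^ 3 * (jac 5 oo fps_X ^ 312)) :: f3 fps) $ 468 =
        (fps_X ^ 1092 * ((jac 1 oo fps_X ^ 312) * (jac 2 oo fps_X ^ 312) ^ 3)) $ 468"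
      by simp
    then show False
      unfolding fps_X_power_mult_nth by simp
  qed
  then have "E\<^sup>2 * (A * B * C) * (A * B\<^sup>2 - A ^ 3 - A\<^sup>2 * B - B ^ 3) = 1"
  proof (rule modular_equation_char_3[OF three_fls E, rotated 8])
    show "E ^ 3 * ((wt 2)\<^sup>2 / wt 1 ^ 8) = xt 1 ^ 3 + (xt 1)\<^sup>2 - E ^ 4"
      "E ^ 3 * ((wt 3)\<^sup>2 / wt 5 ^ 8) = xt 5 ^ 3 + (xt 5)\<^sup>2 - E ^ 4"
      "E ^ 3 * ((wt 4)\<^sup>2 / wt 2 ^ 8) = xt 2 ^ 3 + (xt 2)\<^sup>2 - E ^ 4"
      "E ^ 3 * ((wt 6)\<^sup>2 / wt 3 ^ 8) = xt 3 ^ 3 + (xt 3)\<^sup>2 - E ^ 4"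
      using x_curve[of 1] x_curve[of 5] x_curve[of 2] x_curve[of 3] by (simp_all add: E_def v)
    show "xt 1 - xt 5 = E * (wt 4 * wt 6) / (wt 1 * wt 5)\<^sup>2"
      using x_diff[of 1 5] by (simp add: E_def v mult_ac)
    show "xt 2 - xt 3 = E * (wt 1 * wt 5) / (wt 2 * wt 3)\<^sup>2"
      using x_diff[of 2 3] by (simp add: E_def v mult_ac)
    show "xt 1 - xt 2 = E * wt 3 / (wt 1 * (wt 2)\<^sup>2)"
      using x_diff[of 1 2] nz by (simp add: E_def v field_simps power2_eq_square)
    show "xt 5 - xt 3 = - (E * wt 2 / (wt 5 * (wt 3)\<^sup>2))"
      using x_diff[of 5 3] nz by (simp add: E_def v field_simps power2_eq_square)
  qed
  \<comment> \<open>Modulo 3 the cubic form is minus a cube minus ABC. The cube yields Y^3, and ABC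
    = 1/P yields the term with the square of \<open>euler 1\<close>.\<close>
  moreover have "(A * B\<^sup>2 - A ^ 3 - A\<^sup>2 * B - B ^ 3) = - ((A + B) ^ 3) - A * B * C"
    by (rule eq_if_multiple_of_char[OF three_fls, of _ _ "A\<^sup>2 * B + A * B\<^sup>2"]) (unfold C_eq, algebra)
  ultimately have k: "E\<^sup>2 * (A * B * C) * (- ((A + B) ^ 3) - A * B * C) = 1" by simp
  define V1 V2 V4 where "V1 = wt 1 * wt 5" and "V2 = wt 2 * wt 3" and "V4 = wt 4 * wt 6"
  define P where "P = V1 * V2 * V4"
  have inv: "A * V1 = 1" "B * V2 = 1" "C * V4 = 1"
    using ABC_inv by (simp_all add: V1_def V2_def V4_def)
  have "P * (A * B * C) = 1" unfolding P_def using inv by algebra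
  then have "P\<^sup>2 = E\<^sup>2 * (P * (- ((A + B) ^ 3)) - 1)"
    using k by algebra
  then have "(P\<^sup>2 + E\<^sup>2) * (V1 * V2) ^ 3 = - (E\<^sup>2 * P * (V1 + V2) ^ 3)"
    using inv by algebra
  then have "((th 3 13 1 * th 3 13 5 * (th 3 13 2 * th 3 13 3) * (th 3 13 4 * th 3 13 6))\<^sup>2 + (th 1 39 13 ^ 6)\<^sup>2) *
      (th 3 13 1 * th 3 13 5 * (th 3 13 2 * th 3 13 3)) ^ 3 =
      - ((th 1 39 13 ^ 6)\<^sup>2 * (th 3 13 1 * th 3 13 5 * (th 3 13 2 * th 3 13 3) * (th 3 13 4 * th 3 13 6)) *
        (th 3 13 1 * th 3 13 5 + th 3 13 2 * th 3 13 3) ^ 3 :: f3 fps)"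
    unfolding P_def V1_def V2_def V4_def E_def wt_def \<eta>_def
    by (simp only: fps_to_fls_eq_iff flip: fps_to_fls_plus fps_to_fls_uminus fls_times_fps_to_fls fps_to_fls_power)
  \<comment> \<open>78 = 312 / 4 divides all leading exponents that occur, so z serves as a fourth
    root of q.\<close>
  moreover define z where "z = (fps_X ^ 78 :: f3 fps)"
  let ?q = "fps_X ^ 312 :: f3 fps"
  let ?a = "jac 1 * jac 5 :: f3 fps" and ?b = "jac 2 * jac 3 :: f3 fps"
  have mult: "(f * g) oo ?q = (f oo ?q) * (g oo ?q)" for f g by (simp add: fps_compose_mult_distrib)
  have pow: "(f ^ n) oo ?q = (f oo ?q) ^ n" for f n by (induction n) (simp_all add: mult)
  have X: "fps_X oo ?q = z ^ 4" by (simp add: z_def flip: power_mult)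
  have "th 3 13 1 * th 3 13 5 = z ^ 5 * (?a oo ?q)"
    using th_13_eq_jac[of 1 3, where 'a = f3] th_13_eq_jac[of 5 3, where 'a = f3]
    by (simp add: z_def mult mult_ac flip: power_mult power_add)
  moreover have "th 3 13 2 * th 3 13 3 = z ^ 5 * (?b oo ?q)"
    using th_13_eq_jac[of 2 3, where 'a = f3] th_13_eq_jac[of 3 3, where 'a = f3]
    by (simp add: z_def mult mult_ac flip: power_mult power_add)
  moreover have "th 3 13 1 * th 3 13 5 * (th 3 13 2 * th 3 13 3) * (th 3 13 4 * th 3 13 6) =
      z ^ 11 * ((euler 1 oo ?q) * (euler 13 oo ?q) ^ 5)"
    using th_product[of 3, where 'a = f3] by (simp add: z_def mult pow flip: power_mult)
  moreover have "((th 1 39 13 :: f3 fps) ^ 6)\<^sup>2 = z ^ 26 * (euler 13 oo ?q) ^ 12"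
    unfolding th_39_13 by (simp add: z_def power_mult_distrib flip: power_mult)
  ultimately have "z ^ 52 * (euler 13 oo ?q) ^ 10 * ((((euler 1)\<^sup>2 + fps_X * (euler 13)\<^sup>2) * (?a * ?b) ^ 3) oo ?q) =
      z ^ 52 * (euler 13 oo ?q) ^ 10 * ((- (euler 1 * euler 13 ^ 7 * (?a + ?b) ^ 3)) oo ?q)"
    unfolding mult pow fps_compose_add_distrib fps_compose_uminus X by algebra
  moreover have "z ^ 52 * (euler 13 oo ?q) ^ 10 \<noteq> 0"
    unfolding z_def power_mult[symmetric] by (rule fps_X_power_mult_unit_nonzero) (simp add: fps_nth_power_0)
  ultimately have "(((euler 1)\<^sup>2 + fps_X * (euler 13)\<^sup>2) * (?a * ?b) ^ 3) oo ?q =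
      (- (euler 1 * euler 13 ^ 7 * (?a + ?b) ^ 3)) oo ?q"
    using cancel_left by blast
  then have eq: "((euler 1)\<^sup>2 + fps_X * (euler 13)\<^sup>2) * (?a * ?b) ^ 3 = - (euler 1 * euler 13 ^ 7 * (?a + ?b) ^ 3)"
    by (rule fps_compose_X_power_inject[rotated]) simp
  define u where "u = inverse (?a * ?b)"
  have u: "u * (?a * ?b) = 1" unfolding u_def by (rule inverse_mult_eq_1) simp
  have "(euler 1)\<^sup>2 + fps_X * (euler 13)\<^sup>2 = ((euler 1)\<^sup>2 + fps_X * (euler 13)\<^sup>2) * (u * (?a * ?b)) ^ 3"
    unfolding u by simp
  also have "\<dots> = (((euler 1)\<^sup>2 + fps_X * (euler 13)\<^sup>2) * (?a * ?b) ^ 3) * u ^ 3"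
    by (simp only: power_mult_distrib mult_ac)
  also have "\<dots> = euler 1 * euler 13 * (- ((euler 13)\<^sup>2 * (?a + ?b) * u)) ^ 3"
    unfolding eq by algebra
  finally show ?thesis by (rule that)
qed

section \<open>The modular equation modulo 2\<close>

lemma bit_CHAR: "CHAR(bit) = 2"
proof -
  have "CHAR(bit) dvd 2" using of_nat_eq_0_iff_char_dvd[of 2, where 'a = bit] by simp
  moreover have "CHAR(bit) \<noteq> 1"
    using of_nat_CHAR[where 'a = bit] by (metis of_nat_1 zero_neq_one)
  ultimately show ?thesis using two_is_prime_nat by (auto simp: prime_nat_iff)
qed

lemma bit_square: "c\<^sup>2 = (c :: bit)"
  by (cases c) simp_all

lemmas bit_frobenius = two_is_prime_nat bit_CHAR bit_square

lemma two_fps: "(2 :: bit fps) = 0"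
  by (simp add: numeral_fps_const)

lemma two_fls: "(2 :: bit fls) = 0"
  using two_fps by (metis fps_to_fls_numeral fps_zero_to_fls)

lemma uminus_bit_fps: "- f = (f :: bit fps)"
  by (rule eq_if_multiple_of_char[OF two_fps, of _ _ "- f"]) simp

lemma square_cancel:
  fixes x y :: "'a::idom"
  assumes "(2 :: 'a) = 0" "x\<^sup>2 = y\<^sup>2"
  shows "x = y"
proof -
  have "(x - y)\<^sup>2 = (x\<^sup>2 - y\<^sup>2) - 2 * (x * y - y\<^sup>2)" by algebra
  then show ?thesis using assms by simp
qed

section \<open>Residue classes modulo 26 and the 2-torsion values\<close>

lemma eprod_residue_split_2:
  fixes a :: nat
  assumes "a < 13"
  shows "(eprod {n. n mod 13 = a} :: 'a::comm_ring_1 fps) = eprod {n. n mod 26 = a} * eprod {n. n mod 26 = a + 13}"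
proof -
  have "n mod 13 = a \<longleftrightarrow> n mod 26 = a \<or> n mod 26 = a + 13" for n :: nat
  proof -
    have "n mod 26 = 13 * (n div 13 mod 2) + n mod 13" using mod_mult2_eq[of n 13 2] by simp
    moreover have "n div 13 mod 2 = 0 \<or> n div 13 mod 2 = 1" by linarith
    moreover have "n mod 13 < 13" by simp
    ultimately show ?thesis using assms by (elim disjE) linarith+
  qed
  then have "{n. n mod 13 = a} = {n. n mod 26 = a} \<union> {n. n mod 26 = a + 13}"
    by blast
  then show ?thesis
    by (simp only:) (subst eprod_Un_disjoint, force, rule refl)
qed

lemma euler_13_split_2:
  "(euler 13 :: 'a::comm_ring_1 fps) = euler 26 * eprod {n. n mod 26 = 13}"
proof -
  have "n > 0 \<and> 13 dvd n \<longleftrightarrow> (n > 0 \<and> 26 dvd n) \<or> n mod 26 = 13" for n :: nat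
  proof -
    have "n mod 26 = 13 * (n div 13 mod 2) + n mod 13" using mod_mult2_eq[of n 13 2] by simp
    moreover have "n div 13 mod 2 = 0 \<or> n div 13 mod 2 = 1" by linarith
    ultimately show ?thesis unfolding dvd_eq_mod_eq_0 by (cases "n = 0") (simp, elim disjE, auto)
  qed
  then have "{n. n > 0 \<and> 13 dvd n} = {n. n > 0 \<and> 26 dvd n} \<union> {n :: nat. n mod 26 = 13}"
    by blast
  then show ?thesis
    unfolding euler_def by (simp only:) (subst eprod_Un_disjoint, force, rule refl)
qed

lemma euler_26_bit: "(euler 26 :: bit fps) = (euler 13)\<^sup>2"
  using euler_power_char[OF bit_frobenius, of 13] by simp

text \<open>At half the period the leading exponent is 0, and the product is the square of
  \<open>euler 13\<close> over \<open>euler 26\<close>, which Frobenius makes trivial.\<close>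

lemma th_26_13: "(th 1 26 13 :: bit fps) = 1"
proof -
  have th: "(th 1 26 13 :: bit fps) = (euler 26 * eprod {n. n mod 26 = 13} * eprod {n. n mod 26 = 13}) oo fps_X ^ 208"
    using th_triple_product[of 13 26 1, where 'a = bit] by (simp add: euler_def)
  have "(euler 26 :: bit fps) * 1 = (euler 26 * eprod {n. n mod 26 = 13})\<^sup>2"
    using euler_26_bit euler_13_split_2[where 'a = bit] by simp
  also have "\<dots> = euler 26 * (euler 26 * eprod {n. n mod 26 = 13} * eprod {n. n mod 26 = 13})"
    by (simp only: power2_eq_square mult_ac)
  finally have "1 = (euler 26 * eprod {n. n mod 26 = 13} * eprod {n. n mod 26 = 13} :: bit fps)"
    by (rule cancel_left[rotated]) simp
  then show ?thesis unfolding th by (metis fps_compose_1)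
qed

text \<open>The counterpart modulo 2 of the series above: \<open>thP a\<close> is the value on the
  Frobenius twist after translation by the 2-torsion point, and the square of \<open>thH\<close> is
  the series E of the algebraic modular equation.\<close>

definition thW :: "int \<Rightarrow> bit fps" where "thW = th 2 13"
definition thP :: "int \<Rightarrow> bit fps" where "thP a = th 1 26 (2 * a + 13)"
definition thH :: "bit fps" where "thH = fps_X ^ 338 * (euler 13 oo fps_X ^ 208) ^ 3"

lemma th_26_even: "th 1 26 (2 * a) = (thW a)\<^sup>2"
  using th_rescale[of 2 1 13 a, where 'a = bit] th_power_char[OF bit_frobenius, of 2 13 a] by (simp add: thW_def)

lemma P_reflect: "th 1 26 (2 * a - 13) = thP a"
  using th_add_period[of 1 26 "2 * a - 13", where 'a = bit] by (simp add: thP_def uminus_bit_fps algebra_simps)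

text \<open>The three-term relation for 2a, 2b, 13, 0 is the square of this, since the values at
  2-torsion are 1.\<close>

lemma W_P_addition:
  fixes a b :: int
  shows "thW (a + b) * thW (a - b) = thP a * (thW b)\<^sup>2 + thP b * (thW a)\<^sup>2"
proof -
  let ?T = "th 1 26 :: int \<Rightarrow> bit fps"
  have ar: "2 * a + 2 * b = 2 * (a + b)" "2 * a - 2 * b = 2 * (a - b)" by simp_all
  have "?T (2 * (a + b)) * ?T (2 * (a - b)) * (?T 13 * ?T 13) - ?T (2 * a + 13) * ?T (2 * a - 13) * (?T (2 * b) * ?T (2 * b)) +
      ?T (2 * a) * ?T (2 * a) * (?T (2 * b + 13) * ?T (2 * b - 13)) = 0"
    using th_three_term[of 1 26 "2 * a" "2 * b" 13 0, where 'a = bit, OF zero_less_one zero_less_numeral]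
    unfolding ar add_0_right diff_0_right .
  then have "(thW (a + b) * thW (a - b))\<^sup>2 = (thP a * (thW b)\<^sup>2)\<^sup>2 - (thP b * (thW a)\<^sup>2)\<^sup>2"
    unfolding th_26_even th_26_13 P_reflect thP_def[symmetric] by algebra
  also have "\<dots> = (thP a * (thW b)\<^sup>2 + thP b * (thW a)\<^sup>2)\<^sup>2"
    by (rule eq_if_multiple_of_char[OF two_fps, of _ _
          "0 - (thP b * (thW a)\<^sup>2)\<^sup>2 - thP a * (thW b)\<^sup>2 * (thP b * (thW a)\<^sup>2)"]) algebra
  finally show ?thesis by (rule square_cancel[OF two_fps])
qed

lemma th_26_pair:
  fixes b :: nat
  assumes "0 < b" "b < 13"
  shows "th 1 26 (int b) * th 1 26 (int b + 13) = thW (int b) * thH"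
proof -
  let ?q = "fps_X ^ 208 :: bit fps"
  let ?e = "\<lambda>a. eprod {n. n mod 26 = a} :: bit fps"
  have mult: "(f * g) oo ?q = (f oo ?q) * (g oo ?q)" for f g by (simp add: fps_compose_mult_distrib)
  have t1: "th 1 26 (int b) = fps_X ^ nat ((26 - 2 * int b)\<^sup>2) * ((euler 26 * ?e b * ?e (26 - b)) oo ?q)"
    using th_triple_product[of b 26 1, where 'a = bit] assms by (simp add: euler_def)
  have t2: "th 1 26 (int b + 13) = fps_X ^ nat ((2 * int b)\<^sup>2) * ((euler 26 * ?e (b + 13) * ?e (13 - b)) oo ?q)"
  proof -
    have "26 - 2 * int (b + 13) = - (2 * int b)" by simp
    then have "(26 - 2 * int (b + 13))\<^sup>2 = (2 * int b)\<^sup>2" by (simp only: power2_minus)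
    then show ?thesis
      using th_triple_product[of "b + 13" 26 1, where 'a = bit] assms by (simp add: euler_def)
  qed
  have t3: "thW (int b) = fps_X ^ (2 * nat ((13 - 2 * int b)\<^sup>2)) *
      ((euler 13 * (?e b * ?e (b + 13)) * (?e (13 - b) * ?e (26 - b))) oo ?q)"
    using th_triple_product[of b 13 2, where 'a = bit] assms
      eprod_residue_split_2[of b, where 'a = bit] eprod_residue_split_2[of "13 - b", where 'a = bit]
    by (simp add: euler_def thW_def)
  have ex: "nat ((26 - 2 * int b)\<^sup>2) + nat ((2 * int b)\<^sup>2) = 2 * nat ((13 - 2 * int b)\<^sup>2) + 338"
  proof -
    have "(26 - 2 * int b)\<^sup>2 + (2 * int b)\<^sup>2 = 2 * (13 - 2 * int b)\<^sup>2 + 338" by algebra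
    then have "int (nat ((26 - 2 * int b)\<^sup>2) + nat ((2 * int b)\<^sup>2)) = int (2 * nat ((13 - 2 * int b)\<^sup>2) + 338)"
      by simp
    then show ?thesis by (simp only: of_nat_eq_iff)
  qed
  have X: "(fps_X ^ nat ((26 - 2 * int b)\<^sup>2) * fps_X ^ nat ((2 * int b)\<^sup>2) :: bit fps) =
      fps_X ^ (2 * nat ((13 - 2 * int b)\<^sup>2)) * fps_X ^ 338"
    unfolding power_add[symmetric] using ex by simp
  have key: "x1 * (e * e * u1 * u4) * (x2 * (e * e * u2 * u3)) = y * (e * (u1 * u2) * (u3 * u4)) * (z * e ^ 3)"
    if "x1 * x2 = y * z" for x1 x2 y z e u1 u2 u3 u4 :: "bit fps"
  proof -
    have "x1 * (e * e * u1 * u4) * (x2 * (e * e * u2 * u3)) = (x1 * x2) * (e * (u1 * u2) * (u3 * u4)) * e ^ 3"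
      by (simp only: power3_eq_cube mult_ac)
    then show ?thesis unfolding that by (simp only: mult_ac)
  qed
  show ?thesis
    unfolding t1 t2 t3 thH_def euler_26_bit power2_eq_square[of "euler 13"] mult by (rule key[OF X])
qed

lemma W_double:
  assumes "a \<in> {1, 2, 3, 5}"
  shows "thH * thW (2 * a) = (thW a)\<^sup>2 * thP a"
  using assms th_26_pair[of 2] th_26_pair[of 4] th_26_pair[of 6] th_26_pair[of 10]
    th_26_even[of 1] th_26_even[of 2] th_26_even[of 3] th_26_even[of 5]
  by (auto simp: thP_def mult.commute)

text \<open>Bisection leads to level 52 at 2(2a + 13) and at 4a. Rescaling by 2 and by 4 makes these
  a fourth and an eighth power under Frobenius.\<close>

lemma P_double: "thP (2 * a) = thP a ^ 4 + thW a ^ 8"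
proof -
  have pw2: "(th c M r :: bit fps)\<^sup>2 = th (2 * c) M r" for c M r
    using th_power_char[OF bit_frobenius, of c M r] .
  have p4: "f ^ 4 = (f\<^sup>2)\<^sup>2" and p8: "f ^ 8 = ((f\<^sup>2)\<^sup>2)\<^sup>2" for f :: "bit fps"
    by (simp_all flip: power_mult)
  have "thP (2 * a) = th 1 52 (4 * a + 26) + th 1 52 (4 * a)"
    using th_bisect_char_2[of 1 13 "4 * a + 13", where 'a = bit] by (simp add: thP_def add.commute)
  also have "th 1 52 (4 * a + 26) = thP a ^ 4"
    unfolding p4 thP_def pw2 using th_rescale[of 2 1 26 "2 * a + 13", where 'a = bit] by simp
  also have "th 1 52 (4 * a) = thW a ^ 8"
    unfolding p8 thW_def pw2 using th_rescale[of 4 1 13 a, where 'a = bit] by simp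
  finally show ?thesis .
qed

text \<open>Eliminates the 2-torsion translates pa, pb. Since squaring is additive, h^2 s is the
  product of the squares of pa wb^2 + pb wa^2 and of pa pb + wa^2 wb^2; the duplication formulas
  express pa pb through u v.\<close>

lemma doubling_char_2:
  fixes pa pb wa wb u v h s :: "'a::idom"
  assumes two: "(2 :: 'a) = 0"
    and s: "s = (pa ^ 4 + wa ^ 8) * v\<^sup>2 + (pb ^ 4 + wb ^ 8) * u\<^sup>2"
    and u: "h * u = wa\<^sup>2 * pa" and v: "h * v = wb\<^sup>2 * pb"
  shows "(wa * wb) ^ 4 * (h\<^sup>2 * s) = (pa * wb\<^sup>2 + pb * wa\<^sup>2)\<^sup>2 * (u * v * h\<^sup>2 + (wa * wb) ^ 4)\<^sup>2"
proof -
  have sq: "(f + g)\<^sup>2 = f\<^sup>2 + g\<^sup>2" for f g :: 'a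
    by (rule eq_if_multiple_of_char[OF two, of _ _ "f * g"]) algebra
  have "h\<^sup>2 * s = (pa ^ 4 + wa ^ 8) * (h * v)\<^sup>2 + (pb ^ 4 + wb ^ 8) * (h * u)\<^sup>2"
    unfolding s by algebra
  also have "\<dots> = (pa * wb\<^sup>2 + pb * wa\<^sup>2)\<^sup>2 * (pa * pb + wa\<^sup>2 * wb\<^sup>2)\<^sup>2"
    unfolding u v sq by algebra
  finally have "(wa * wb) ^ 4 * (h\<^sup>2 * s) =
      (pa * wb\<^sup>2 + pb * wa\<^sup>2)\<^sup>2 * ((wa\<^sup>2 * pa) * (wb\<^sup>2 * pb) + (wa * wb) ^ 4)\<^sup>2"
    by algebra
  also have "(wa\<^sup>2 * pa) * (wb\<^sup>2 * pb) = u * v * h\<^sup>2"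
    unfolding u[symmetric] v[symmetric] by algebra
  finally show ?thesis .
qed

theorem modular_equation_mod_2:
  "(euler 1 * euler 13 :: bit fps) =
    ((euler 1)\<^sup>2 + fps_X * (euler 13)\<^sup>2) ^ 3 *
    (euler 1 ^ 4 + fps_X * (euler 1)\<^sup>2 * (euler 13)\<^sup>2 + fps_X\<^sup>2 * euler 13 ^ 4)\<^sup>2"
proof -
  define V1 V2 V4 E where "V1 = thW 1 * thW 5" and "V2 = thW 2 * thW 3" and "V4 = thW 4 * thW 6" and "E = thH\<^sup>2"
  have v: "thW 10 = thW 3" "thW 8 = thW 5" "thW (- 1) = thW 1" "thW (- 2) = thW 2" "thW (- 4) = thW 4"
    using th_13_values[of 2, where 'a = bit] by (simp_all add: thW_def uminus_bit_fps)
  have P10: "thP 10 = thP 3"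
    using th_add_period[of 1 26 7, where 'a = bit] th_reflect[of 1 26 7, where 'a = bit]
    by (simp add: thP_def uminus_bit_fps)
  have nz: "thW 1 \<noteq> 0" "thW 2 \<noteq> 0" "thW 3 \<noteq> 0" "thW 4 \<noteq> 0" "thW 5 \<noteq> 0" "thW 6 \<noteq> 0"
    using th_13_nonzero[of 1 2, where 'a = bit] th_13_nonzero[of 2 2, where 'a = bit]
      th_13_nonzero[of 3 2, where 'a = bit] th_13_nonzero[of 4 2, where 'a = bit]
      th_13_nonzero[of 5 2, where 'a = bit] th_13_nonzero[of 6 2, where 'a = bit]
    by (auto simp: thW_def)
  have rv: "V1 * V2 + V1 * V4 = V2 * V4"
    using th_13_relations(1)[of 2, where 'a = bit] by (simp add: V1_def V2_def V4_def thW_def mult_ac)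
  \<comment> \<open>Sum and difference of the indices of one pair give, up to sign, another pair:
    {2,3} leads to {1,5}, {1,5} to {4,6}, and {4,6} to {2,3}.\<close>
  have "V1 = thP 2 * (thW 3)\<^sup>2 + thP 3 * (thW 2)\<^sup>2" "V4 = thP 1 * (thW 5)\<^sup>2 + thP 5 * (thW 1)\<^sup>2"
    "V2 = thP 4 * (thW 6)\<^sup>2 + thP 6 * (thW 4)\<^sup>2"
    using W_P_addition[of 2 3] W_P_addition[of 1 5] W_P_addition[of 4 6]
    by (simp_all add: v V1_def V2_def V4_def mult.commute)
  note add = this
  have dbl: "thP 2 = thP 1 ^ 4 + thW 1 ^ 8" "thP 3 = thP 5 ^ 4 + thW 5 ^ 8" "thP 4 = thP 2 ^ 4 + thW 2 ^ 8" "thP 6 = thP 3 ^ 4 + thW 3 ^ 8"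
    using P_double[of 1] P_double[of 5] P_double[of 2] P_double[of 3] by (simp_all add: P10)
  have wd: "thH * thW 2 = (thW 1)\<^sup>2 * thP 1" "thH * thW 3 = (thW 5)\<^sup>2 * thP 5" "thH * thW 4 = (thW 2)\<^sup>2 * thP 2" "thH * thW 6 = (thW 3)\<^sup>2 * thP 3"
    using W_double[of 1] W_double[of 5] W_double[of 2] W_double[of 3] by (simp_all add: v)
  have "V1 = (thP 1 ^ 4 + thW 1 ^ 8) * (thW 3)\<^sup>2 + (thP 5 ^ 4 + thW 5 ^ 8) * (thW 2)\<^sup>2"
    using add(1) unfolding dbl(1,2) .
  from doubling_char_2[OF two_fps this wd(1,2)]
  have e1: "V1 ^ 5 * E = V4\<^sup>2 * (V2 * E + V1 ^ 4)\<^sup>2"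
    unfolding E_def add(2)[symmetric] V1_def[symmetric] V2_def[symmetric] by algebra
  have "V2 = (thP 2 ^ 4 + thW 2 ^ 8) * (thW 6)\<^sup>2 + (thP 3 ^ 4 + thW 3 ^ 8) * (thW 4)\<^sup>2"
    using add(3) unfolding dbl(3,4) .
  from doubling_char_2[OF two_fps this wd(3,4)]
  have e2: "V2 ^ 5 * E = V1\<^sup>2 * (V4 * E + V2 ^ 4)\<^sup>2"
    unfolding E_def add(1)[symmetric] V2_def[symmetric] V4_def[symmetric] by algebra

  let ?q = "fps_X ^ 208 :: bit fps"
  define z where "z = (fps_X ^ 52 :: bit fps)"
  let ?a = "jac 1 * jac 5 :: bit fps" and ?b = "jac 2 * jac 3 :: bit fps"
  have mult: "(f * g) oo ?q = (f oo ?q) * (g oo ?q)" for f g by (simp add: fps_compose_mult_distrib)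
  have pow: "(f ^ n) oo ?q = (f oo ?q) ^ n" for f n by (induction n) (simp_all add: mult)
  have X: "fps_X oo ?q = z ^ 4" by (simp add: z_def flip: power_mult)
  have V1: "V1 = z ^ 5 * (?a oo ?q)"
    using th_13_eq_jac[of 1 2, where 'a = bit] th_13_eq_jac[of 5 2, where 'a = bit]
    by (simp add: V1_def thW_def z_def mult mult_ac flip: power_mult power_add)
  have V2: "V2 = z ^ 5 * (?b oo ?q)"
    using th_13_eq_jac[of 2 2, where 'a = bit] th_13_eq_jac[of 3 2, where 'a = bit]
    by (simp add: V2_def thW_def z_def mult mult_ac flip: power_mult power_add)
  \<comment> \<open>Three terms with the same lowest power of X and leading coefficient 1; in
    characteristic 2 their sum still has leading coefficient 1.\<close>
  have ne: "V2 ^ 3 + V1\<^sup>2 * V2 + V1 ^ 3 \<noteq> 0"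
  proof -
    define u where "u = ?b ^ 3 + ?a\<^sup>2 * ?b + ?a ^ 3 oo ?q"
    have "V2 ^ 3 + V1\<^sup>2 * V2 + V1 ^ 3 = fps_X ^ 780 * u"
    proof -
      have "V2 ^ 3 + V1\<^sup>2 * V2 + V1 ^ 3 = z ^ 15 * u"
        unfolding V1 V2 u_def fps_compose_add_distrib mult pow by algebra
      then show ?thesis by (simp add: z_def flip: power_mult)
    qed
    moreover have "u $ 0 = 1" unfolding u_def by (simp add: fps_nth_power_0)
    ultimately show ?thesis using fps_X_power_mult_unit_nonzero[of u] by simp
  qed
  have "fps_to_fls V1 \<noteq> 0" "fps_to_fls V2 \<noteq> 0" "fps_to_fls V4 \<noteq> 0"
    using nz by (simp_all add: V1_def V2_def V4_def)
  note main = modular_equation_char_2[OF two_fls this, of "fps_to_fls E",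
      folded fps_to_fls_power fls_times_fps_to_fls fps_to_fls_plus, unfolded fps_to_fls_eq_iff fps_to_fls_eq_0_iff,
      OF rv e1 e2 ne]
  have PP: "V1 * V2 * V4 = z ^ 11 * ((euler 1 oo ?q) * (euler 13 oo ?q) ^ 5)"
    using th_product[of 2, where 'a = bit]
    by (simp add: V1_def V2_def V4_def thW_def z_def mult pow flip: power_mult)
  have EE: "E = z ^ 13 * (euler 13 oo ?q) ^ 6"
    by (simp add: E_def thH_def z_def power_mult_distrib flip: power_mult)
  let ?R = "((euler 1)\<^sup>2 + fps_X * (euler 13)\<^sup>2) ^ 3 *
      (euler 1 ^ 4 + fps_X * (euler 1)\<^sup>2 * (euler 13)\<^sup>2 + fps_X\<^sup>2 * euler 13 ^ 4)\<^sup>2 :: bit fps"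
  have "z ^ 154 * (euler 13 oo ?q) ^ 70 * ((euler 1 * euler 13) oo ?q) = z ^ 154 * (euler 13 oo ?q) ^ 70 * (?R oo ?q)"
    using main unfolding PP EE mult pow fps_compose_add_distrib X by algebra
  moreover have "z ^ 154 * (euler 13 oo ?q) ^ 70 \<noteq> 0"
    unfolding z_def power_mult[symmetric] by (rule fps_X_power_mult_unit_nonzero) (simp add: fps_nth_power_0)
  ultimately have "(euler 1 * euler 13) oo ?q = ?R oo ?q"
    using cancel_left by blast
  then show ?thesis by (rule fps_compose_X_power_inject[rotated]) simp
qed

section \<open>Partition generating functions\<close>

definition partitions_into :: "nat set \<Rightarrow> nat \<Rightarrow> nat multiset set" where
  "partitions_into S n = {M. set_mset M \<subseteq> S \<and> sum_mset M = n}"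

definition gf :: "nat set \<Rightarrow> 'a::comm_ring_1 fps" where
  "gf S = Abs_fps (\<lambda>n. of_nat (card (partitions_into S n)))"

lemma member_le_sum_mset: "x \<in># M \<Longrightarrow> x \<le> sum_mset (M :: nat multiset)"
  by (metis le_add1 mset_add sum_mset.add_mset)

lemma finite_partitions_into:
  assumes "0 \<notin> S"
  shows "finite (partitions_into S n)"
proof (rule finite_subset)
  show "finite (mset ` {xs. set xs \<subseteq> {..n} \<and> length xs \<le> n})"
    by (intro finite_imageI finite_lists_length_le) simp
  show "partitions_into S n \<subseteq> mset ` {xs. set xs \<subseteq> {..n} \<and> length xs \<le> n}"
  proof
    fix M assume "M \<in> partitions_into S n"
    then have M: "set_mset M \<subseteq> S" "sum_mset M = n" by (auto simp: partitions_into_def)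
    obtain xs where xs: "M = mset xs" by (metis ex_mset)
    have "size M \<le> sum_mset M" using M(1)
    proof (induction M)
      case (add x M)
      then show ?case using assms by (cases x) auto
    qed simp
    moreover have "set_mset M \<subseteq> {..n}" using member_le_sum_mset M(2) by auto
    ultimately have "set xs \<subseteq> {..n}" "length xs \<le> n" using xs M(2) by auto
    then show "M \<in> mset ` {xs. set xs \<subseteq> {..n} \<and> length xs \<le> n}" using xs by auto
  qed
qed

lemma partitions_into_insert:
  assumes "s \<notin> S" "s > 0"
  shows "partitions_into (insert s S) n =
    partitions_into S n \<union> (if s \<le> n then add_mset s ` partitions_into (insert s S) (n - s) else {})"
proof (intro equalityI subsetI)
  fix M assume M: "M \<in> partitions_into (insert s S) n"
  show "M \<in> partitions_into S n \<union> (if s \<le> n then add_mset s ` partitions_into (insert s S) (n - s) else {})"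
  proof (cases "s \<in># M")
    case True
    then obtain N where N: "M = add_mset s N" by (metis mset_add)
    then show ?thesis using M by (auto simp: partitions_into_def)
  next
    case False
    then show ?thesis using M by (auto simp: partitions_into_def)
  qed
qed (auto simp: partitions_into_def split: if_splits)

text \<open>A partition with parts in the larger set avoids s or loses one copy of s.\<close>

lemma gf_insert:
  assumes "s \<notin> S" "s > 0" "0 \<notin> S"
  shows "(gf (insert s S) :: 'a::comm_ring_1 fps) * (1 - fps_X ^ s) = gf S"
proof (rule fps_ext)
  fix n
  let ?c = "\<lambda>S n. card (partitions_into S n)"
  have fin: "finite (partitions_into (insert s S) m)" "finite (partitions_into S m)" for m
    by (rule finite_partitions_into, use assms in simp)+
  have "?c (insert s S) n = ?c S n + (if s \<le> n then ?c (insert s S) (n - s) else 0)"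
  proof (cases "s \<le> n")
    case True
    have "?c (insert s S) n = card (partitions_into S n \<union> add_mset s ` partitions_into (insert s S) (n - s))"
      using partitions_into_insert[OF assms(1,2), of n] True by simp
    also have "\<dots> = ?c S n + card (add_mset s ` partitions_into (insert s S) (n - s))"
    proof (rule card_Un_disjoint)
      show "partitions_into S n \<inter> add_mset s ` partitions_into (insert s S) (n - s) = {}"
      proof (rule ccontr)
        assume "\<not> ?thesis"
        then obtain M where M: "M \<in> partitions_into S n" "M \<in> add_mset s ` partitions_into (insert s S) (n - s)"
          by blast
        from M(2) have "s \<in># M" by (elim imageE) simp
        moreover have "set_mset M \<subseteq> S" using M(1) unfolding partitions_into_def by simp
        ultimately show False using assms(1) by blast
      qed
    qed (intro fin finite_imageI)+
    also have "card (add_mset s ` partitions_into (insert s S) (n - s)) = ?c (insert s S) (n - s)"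
      by (rule card_image) (auto simp: inj_on_def)
    finally show ?thesis using True by simp
  next
    case False
    then show ?thesis using partitions_into_insert[OF assms(1,2), of n] by simp
  qed
  then show "(gf (insert s S) * (1 - fps_X ^ s)) $ n = (gf S :: 'a fps) $ n"
    by (simp add: gf_def right_diff_distrib fps_X_power_mult_right_nth not_less)
qed

lemma gf_finite:
  assumes "finite S" "0 \<notin> S"
  shows "(gf S :: 'a::comm_ring_1 fps) * (\<Prod>k\<in>S. 1 - fps_X ^ k) = 1"
  using assms
proof (induction S rule: finite_induct)
  case empty
  have "partitions_into {} n = (if n = 0 then {{#}} else {})" for n
    by (auto simp: partitions_into_def)
  then show ?case by (auto simp: gf_def fps_eq_iff)
next
  case (insert s S)
  then have "(gf (insert s S) :: 'a fps) * (1 - fps_X ^ s) = gf S" by (intro gf_insert) auto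
  moreover have "(gf S :: 'a fps) * (\<Prod>k\<in>S. 1 - fps_X ^ k) = 1" using insert by simp
  ultimately show ?case using insert by (simp flip: mult.assoc)
qed

theorem gf_mult_eprod:
  assumes "0 \<notin> S"
  shows "(gf S :: 'a::comm_ring_1 fps) * eprod S = 1"
proof (rule fps_eqI_X_power_dvd)
  fix N
  let ?T = "S \<inter> {1..N}"
  have "partitions_into S n = partitions_into ?T n" if "n < N" for n
  proof (intro equalityI subsetI)
    fix M assume M: "M \<in> partitions_into S n"
    have "x \<in> ?T" if "x \<in># M" for x
      using that M \<open>n < N\<close> member_le_sum_mset[OF that] assms
      by (cases x) (auto simp: partitions_into_def)
    then show "M \<in> partitions_into ?T n" using M by (auto simp: partitions_into_def)
  qed (auto simp: partitions_into_def)
  then have "fps_X ^ N dvd (gf S - gf ?T :: 'a fps)"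
    by (simp add: fps_X_power_dvd_iff gf_def)
  from dvd_diff_mult[OF this eprod_trunc[of N S]]
  show "fps_X ^ N dvd (gf S * eprod S - 1 :: 'a fps)"
    using gf_finite[of ?T, where 'a = 'a] assms by simp
qed

definition regular_gf :: "'a::comm_ring_1 fps" where
  "regular_gf = Abs_fps (\<lambda>n. of_nat (b 13 n))"

lemma euler_1_mult_regular_gf: "(euler 1 :: 'a::comm_ring_1 fps) * regular_gf = euler 13"
proof -
  let ?S = "{n :: nat. \<not> 13 dvd n}"
  have "b 13 n = card (partitions_into ?S n)" for n
    unfolding b_def partitions_into_def
    by (rule arg_cong[of _ _ card]) (auto intro: gr0I)
  then have gf: "regular_gf = (gf ?S :: 'a fps)" by (simp add: regular_gf_def gf_def)
  have "{n. n > 0 \<and> 1 dvd n} = {n. n > 0 \<and> 13 dvd n} \<union> ?S" by (auto intro: gr0I)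
  then have "(euler 1 :: 'a fps) = euler 13 * eprod ?S"
    unfolding euler_def by (simp only:) (subst eprod_Un_disjoint, force, rule refl)
  then have "(euler 1 :: 'a fps) * regular_gf = euler 13 * (gf ?S * eprod ?S)"
    unfolding gf by (simp only: mult_ac)
  then show ?thesis using gf_mult_eprod[of ?S, where 'a = 'a] by simp
qed

section \<open>Congruences modulo 3\<close>

lemma cube_nth:
  "((f :: f3 fps) ^ 3) $ n = (if 3 dvd n then f $ (n div 3) else 0)"
  unfolding fps_power_char[OF f3_frobenius, of f] by (simp add: fps_compose_X_power_nth)

lemma trisection_nth:
  fixes f g h :: "f3 fps"
  defines "r \<equiv> f ^ 3 + fps_X * g ^ 3 + fps_X\<^sup>2 * h ^ 3"
  shows "r $ (3 * n) = f $ n" "r $ (3 * n + 1) = g $ n" "r $ (3 * n + 2) = h $ n"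
proof -
  have r: "r $ m = (f ^ 3) $ m + (if m = 0 then 0 else (g ^ 3) $ (m - 1)) + (if m < 2 then 0 else (h ^ 3) $ (m - 2))" for m
    by (simp add: r_def fps_X_power_mult_nth)
  have nd: "\<not> 3 dvd 3 * n + 1" "\<not> 3 dvd 3 * n + 2" "\<not> 3 dvd Suc (3 * n)"
    "n > 0 \<Longrightarrow> \<not> 3 dvd 3 * n - 1" "n > 0 \<Longrightarrow> \<not> 3 dvd 3 * n - 2" "n > 0 \<Longrightarrow> \<not> 3 dvd 3 * n - Suc 0"
    by presburger+
  show "r $ (3 * n) = f $ n"
    unfolding r cube_nth using nd by (cases "n = 0") simp_all
  show "r $ (3 * n + 1) = g $ n"
    unfolding r cube_nth using nd by (cases "n = 0") simp_all
  show "r $ (3 * n + 2) = h $ n"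
    unfolding r cube_nth using nd by simp
qed

lemma trisection_exists:
  fixes f :: "f3 fps"
  shows "f = (Abs_fps (\<lambda>n. f $ (3 * n))) ^ 3 + fps_X * (Abs_fps (\<lambda>n. f $ (3 * n + 1))) ^ 3 +
    fps_X\<^sup>2 * (Abs_fps (\<lambda>n. f $ (3 * n + 2))) ^ 3" (is "_ = ?r")
proof (rule fps_ext)
  fix n :: nat
  have "n = 3 * (n div 3) \<or> n = 3 * (n div 3) + 1 \<or> n = 3 * (n div 3) + 2" by presburger
  then obtain k where "n = 3 * k \<or> n = 3 * k + 1 \<or> n = 3 * k + 2" by blast
  then show "f $ n = ?r $ n"
    by (elim disjE) (simp_all only: trisection_nth fps_nth_Abs_fps)
qed

lemma b_13_mod_3:
  "3 dvd b 13 (9 * n + 7)"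
  "3 dvd b 13 (3 * n + 1) \<Longrightarrow> 3 dvd b 13 (9 * n + 4)"
proof -
  define F :: "f3 fps" where "F = regular_gf"
  have b: "F $ m = 0 \<longleftrightarrow> 3 dvd b 13 m" for m
    unfolding F_def regular_gf_def fps_nth_Abs_fps of_nat_eq_0_iff_char_dvd f3_CHAR ..
  obtain Y :: "f3 fps" where Y: "euler 1 ^ 2 + fps_X * euler 13 ^ 2 = euler 1 * euler 13 * Y ^ 3"
    by (rule modular_equation_mod_3)
  have F: "euler 13 = euler 1 * F"
    using euler_1_mult_regular_gf[where 'a = f3] by (simp add: F_def)
  have "(euler 1)\<^sup>2 * (1 + fps_X * F\<^sup>2) = (euler 1)\<^sup>2 * (F * Y ^ 3)"
    using Y unfolding F by algebra
  then have FY: "1 + fps_X * F\<^sup>2 = F * Y ^ 3"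
    by (rule cancel_left[rotated]) simp
  define V where "V = Abs_fps (\<lambda>n. F $ (3 * n + 1))"
  obtain f0 f2 where Fsplit: "F = f0 ^ 3 + fps_X * V ^ 3 + fps_X\<^sup>2 * f2 ^ 3"
    using trisection_exists[of F] unfolding V_def by blast
  have cube: "(f + g) ^ 3 = f ^ 3 + g ^ 3" "(f - g) ^ 3 = f ^ 3 - g ^ 3" for f g :: "f3 fps"
    by (rule eq_if_multiple_of_char[OF three_fps, of _ _ "f * g * (f + g)"], algebra)
      (rule eq_if_multiple_of_char[OF three_fps, of _ _ "- (f * g * (f - g))"], algebra)
  \<comment> \<open>Rewriting F Y^6 by \<open>FY\<close> twice leaves F only as a cube on the right.
    Multiplying further by Y^12 + q Y^6 + q^2 makes the left factor a cube too, and the trisection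
    can be read off.\<close>
  have "F * (Y ^ 6 - fps_X) = Y ^ 3 + fps_X\<^sup>2 * F ^ 3"
    using FY by algebra
  then have "F * (Y ^ 6 - fps_X) ^ 3 =
      (Y ^ 5 + fps_X * (F * Y\<^sup>2)) ^ 3 + fps_X * (Y ^ 3 + fps_X * F) ^ 3 + fps_X\<^sup>2 * (Y + F * Y ^ 4) ^ 3"
    unfolding cube by algebra
  moreover have "F * (Y ^ 6 - fps_X) ^ 3 =
      (f0 * (Y ^ 6 - fps_X)) ^ 3 + fps_X * (V * (Y ^ 6 - fps_X)) ^ 3 + fps_X\<^sup>2 * (f2 * (Y ^ 6 - fps_X)) ^ 3"
    by (subst Fsplit) algebra
  ultimately have V1: "V * (Y ^ 6 - fps_X) = Y ^ 3 + fps_X * F"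
    using trisection_nth(2) by (metis fps_ext)
  \<comment> \<open>u is a square root of (Y^6 - q) F^2: modulo 3, the discriminant (1 + qF^2)^2 -
    4qF^2 of the quadratic for F is a perfect square.\<close>
  define u where "u = 1 - fps_X * F\<^sup>2"
  have u: "u \<noteq> 0"
  proof -
    have "u $ 0 = 1" by (simp add: u_def)
    then show ?thesis by auto
  qed
  have u2: "(Y ^ 6 - fps_X) * F\<^sup>2 = u\<^sup>2"
  proof -
    have "(Y ^ 6 - fps_X) * F\<^sup>2 = (1 + fps_X * F\<^sup>2)\<^sup>2 - fps_X * F\<^sup>2" unfolding FY by algebra
    also have "\<dots> = u\<^sup>2"
      unfolding u_def by (rule eq_if_multiple_of_char[OF three_fps, of _ _ "fps_X * F\<^sup>2"]) algebra
    finally show ?thesis .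
  qed
  have "(Y ^ 3 + fps_X * F) * F = (1 + fps_X * F\<^sup>2) + fps_X * F\<^sup>2" unfolding FY by algebra
  also have "\<dots> = u"
    unfolding u_def by (rule eq_if_multiple_of_char[OF three_fps, of _ _ "fps_X * F\<^sup>2"]) algebra
  finally have YF: "(Y ^ 3 + fps_X * F) * F = u" .
  have "u * (V * u) = V * ((Y ^ 6 - fps_X) * F\<^sup>2)" unfolding u2 by algebra
  also have "\<dots> = (V * (Y ^ 6 - fps_X)) * F * F" by algebra
  finally have "u * (V * u) = u * F" unfolding V1 YF .
  then have Vu: "V * u = F" by (rule cancel_left[OF u])
  have "F\<^sup>2 * (V\<^sup>2 * (Y ^ 6 - fps_X)) = (V * u)\<^sup>2" using u2 by algebra
  then have h: "F\<^sup>2 * (V\<^sup>2 * (Y ^ 6 - fps_X)) = F\<^sup>2 * 1" unfolding Vu by simp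
  have "F \<noteq> 0" using F by (metis euler_nonzero mult_zero_right)
  then have "V\<^sup>2 * (Y ^ 6 - fps_X) = 1"
    by (intro cancel_left[OF _ h]) simp
  \<comment> \<open>In the trisection of V the class 2 modulo 3 is empty and the class 1 is -V;
    since 3(3n+2)+1 = 9n+7 and 3(3n+1)+1 = 9n+4, these are the two congruences.\<close>
  then have "V = V * (V\<^sup>2 * (Y ^ 6 - fps_X))" by simp
  also have "\<dots> = (V * Y\<^sup>2) ^ 3 + fps_X * (- V) ^ 3" by algebra
  finally have "V = (V * Y\<^sup>2) ^ 3 + fps_X * (- V) ^ 3 + fps_X\<^sup>2 * 0 ^ 3" by simp
  then have "V $ (3 * n + 1) = (- V) $ n" "V $ (3 * n + 2) = 0 $ n"
    using trisection_nth(2,3) by metis+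
  then have "F $ (9 * n + 4) = - F $ (3 * n + 1)" "F $ (9 * n + 7) = 0"
    unfolding V_def by (simp_all add: algebra_simps)
  then show "3 dvd b 13 (9 * n + 7)" "3 dvd b 13 (3 * n + 1) \<Longrightarrow> 3 dvd b 13 (9 * n + 4)"
    unfolding b[symmetric] by simp_all
qed

text \<open>Passing from 3i + 1 to 9i + 4 multiplies 2m + 1 by 3, and m = 9t + 7 means 2m + 1 = 3(6t
  + 5).\<close>

lemma b_13_mod_3_progression:
  assumes "2 * m + 1 = 3 ^ Suc j * (6 * t + 5)"
  shows "3 dvd b 13 m"
  using assms
proof (induction j arbitrary: m)
  case 0
  then have "m = 9 * t + 7" by simp
  then show ?case using b_13_mod_3(1) by simp
next
  case (Suc j)
  define k where "k = 3 ^ j * (6 * t + 5)"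
  have "odd k" by (simp add: k_def)
  then obtain i where i: "k = 2 * i + 1" by (elim oddE)
  have m: "2 * m + 1 = 9 * k" using Suc.prems by (simp add: k_def)
  then have "m = 9 * i + 4" using i by simp
  moreover have "2 * (3 * i + 1) + 1 = 3 ^ Suc j * (6 * t + 5)" using i by (simp add: k_def)
  ultimately show ?case using b_13_mod_3(2) Suc.IH by blast
qed

section \<open>Congruences modulo 2\<close>

lemma square_nth:
  "((f :: bit fps)\<^sup>2) $ n = (if even n then f $ (n div 2) else 0)"
  unfolding fps_power_char[OF bit_frobenius, of f] by (simp add: fps_compose_X_power_nth)

text \<open>Modulo 2, the cube of f_1 is f_1 f_2. As f_1 is f_2 times the products over the classes
  1 and 3 modulo 4, and f_2^2 = f_4, this is the triple product with M = 4 and a = 1.\<close>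

lemma euler_cubed_bit: "(euler 1 :: bit fps) ^ 3 = msum UNIV alt (jexp 4 1)"
proof -
  let ?r = "\<lambda>a. eprod {n. n mod 4 = a} :: bit fps"
  have "n > 0 \<longleftrightarrow> (n > 0 \<and> 2 dvd n \<or> n mod 4 = 1) \<or> n mod 4 = 3" for n :: nat by presburger
  then have "{n :: nat. n > 0 \<and> 1 dvd n} = ({n. n > 0 \<and> 2 dvd n} \<union> {n. n mod 4 = 1}) \<union> {n. n mod 4 = 3}" by auto
  moreover have "{n :: nat. n > 0 \<and> 2 dvd n} \<inter> {n. n mod 4 = 1} = {}"
    "({n :: nat. n > 0 \<and> 2 dvd n} \<union> {n. n mod 4 = 1}) \<inter> {n. n mod 4 = 3} = {}"
    by (auto, presburger+)
  ultimately have e1: "(euler 1 :: bit fps) = euler 2 * ?r 1 * ?r 3"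
    unfolding euler_def by (simp only: eprod_Un_disjoint)
  have e2: "euler 2 = (euler 1 :: bit fps)\<^sup>2" and e4: "euler 4 = (euler 2 :: bit fps)\<^sup>2"
    using euler_power_char[OF bit_frobenius, of 1] euler_power_char[OF bit_frobenius, of 2] by simp_all
  have "euler 1 * (euler 1 ^ 3) = euler 1 * (euler 1 * (euler 1)\<^sup>2 :: bit fps)" by algebra
  also have "\<dots> = euler 1 * (euler 2 * ?r 1 * ?r 3 * (euler 1)\<^sup>2)" using e1 by simp
  also have "\<dots> = euler 1 * (euler 4 * ?r 1 * ?r 3)" unfolding e4 e2 by algebra
  finally have "euler 1 ^ 3 = euler 4 * ?r 1 * ?r 3" by (rule cancel_left[rotated]) simp
  then show ?thesis
    using jacobi_triple_product[of 1 4, where 'a = bit] by (simp add: euler_def)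
qed

lemma euler_cubed_bit_nonzero:
  assumes "((euler 1 :: bit fps) ^ 3) $ n \<noteq> 0"
  obtains k where "8 * int n + 1 = (4 * k - 1)\<^sup>2"
proof -
  obtain k where k: "jexp 4 1 k = n"
  proof -
    have "{i :: int. i \<in> UNIV \<and> jexp 4 1 i = n} \<noteq> {}"
      using assms unfolding euler_cubed_bit msum_nth by (metis sum.empty)
    then show ?thesis using that by blast
  qed
  have "8 * int n + 1 = (4 * k - 1)\<^sup>2"
    using jexp_double[of 1 4 k] unfolding k by (simp add: power2_eq_square algebra_simps)
  then show ?thesis by (rule that)
qed

lemma b_13_mod_2:
  assumes "odd (b 13 (2 * m))"
  obtains y c :: int where "4 * int m + 1 = c * y\<^sup>2" "c = 1 \<or> c = 13"
proof -
  define F :: "bit fps" where "F = regular_gf"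
  define Z :: "bit fps" where "Z = (euler 1 ^ 3)\<^sup>2 + fps_X ^ 3 * (euler 13 ^ 3)\<^sup>2"
  have F: "euler 13 = euler 1 * F"
    using euler_1_mult_regular_gf[where 'a = bit] by (simp add: F_def)
  have "(euler 1)\<^sup>2 * F = (euler 1)\<^sup>2 * (Z\<^sup>2 + fps_X * (F * Z)\<^sup>2)"
  proof -
    \<comment> \<open>Z is x^3 + y^3 for x = f_1^2 and y = q f_13^2; modulo 2 it factors as (x +
      y)(x^2 + xy + y^2).\<close>
    have Zf: "((euler 1)\<^sup>2 + fps_X * (euler 13)\<^sup>2) *
        (euler 1 ^ 4 + fps_X * (euler 1)\<^sup>2 * (euler 13)\<^sup>2 + fps_X\<^sup>2 * euler 13 ^ 4) = Z"
      unfolding Z_def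
      by (rule eq_if_multiple_of_char[OF two_fps, of _ _
            "(euler 1)\<^sup>2 * (fps_X * (euler 13)\<^sup>2) * ((euler 1)\<^sup>2 + fps_X * (euler 13)\<^sup>2)"]) algebra
    have "(euler 1)\<^sup>2 * F = euler 1 * euler 13" unfolding F by algebra
    also have "\<dots> = ((euler 1)\<^sup>2 + fps_X * (euler 13)\<^sup>2) * Z\<^sup>2"
      unfolding modular_equation_mod_2 Zf[symmetric] by algebra
    finally show ?thesis unfolding F by algebra
  qed
  then have "F = Z\<^sup>2 + fps_X * (F * Z)\<^sup>2"
    by (rule cancel_left[rotated]) simp
  then have "F $ (2 * m) = (Z\<^sup>2 + fps_X * (F * Z)\<^sup>2) $ (2 * m)" by simp
  also have "\<dots> = Z $ m" by (cases m) (auto simp: square_nth)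
  finally have "F $ (2 * m) = Z $ m" .
  moreover have "F $ (2 * m) \<noteq> 0"
    unfolding F_def regular_gf_def fps_nth_Abs_fps of_nat_eq_0_iff_char_dvd bit_CHAR using assms .
  ultimately have "Z $ m \<noteq> 0" by simp
  then have "((euler 1 ^ 3)\<^sup>2) $ m \<noteq> (0 :: bit) \<or> m \<ge> 3 \<and> ((euler 13 ^ 3)\<^sup>2) $ (m - 3) \<noteq> (0 :: bit)"
    unfolding Z_def fps_add_nth fps_X_power_mult_nth by (metis add_0_right linorder_not_le)
  then show ?thesis
  proof
    assume "((euler 1 ^ 3)\<^sup>2) $ m \<noteq> (0 :: bit)"
    then have "even m" "(euler 1 ^ 3) $ (m div 2) \<noteq> (0 :: bit)"
      unfolding square_nth by metis+
    then obtain k where "8 * int (m div 2) + 1 = (4 * k - 1)\<^sup>2"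
      using euler_cubed_bit_nonzero by blast
    moreover have "4 * int m + 1 = 8 * int (m div 2) + 1" using \<open>even m\<close> by (elim evenE) simp
    ultimately show ?thesis using that[of 1 "4 * k - 1"] by simp
  next
    assume m: "m \<ge> 3 \<and> ((euler 13 ^ 3)\<^sup>2) $ (m - 3) \<noteq> (0 :: bit)"
    then have ev: "even (m - 3)" and "(euler 13 ^ 3) $ ((m - 3) div 2) \<noteq> (0 :: bit)"
      unfolding square_nth by metis+
    moreover have "(euler 13 :: bit fps) ^ 3 = euler 1 ^ 3 oo fps_X ^ 13"
      using euler_times[of 13 1, where 'a = bit] by (simp add: power3_eq_cube fps_compose_mult_distrib)
    ultimately have d: "13 dvd (m - 3) div 2" and "(euler 1 ^ 3) $ ((m - 3) div 2 div 13) \<noteq> (0 :: bit)"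
      by (simp_all add: fps_compose_X_power_nth split: if_splits)
    then obtain k where k: "8 * int ((m - 3) div 2 div 13) + 1 = (4 * k - 1)\<^sup>2"
      using euler_cubed_bit_nonzero by blast
    \<comment> \<open>With m = 26r + 3, the number 4m + 1 is 13(8r + 1), the source of the factor
      13.\<close>
    obtain i where i: "m - 3 = 2 * i" using ev by (elim evenE)
    obtain r where "i = 13 * r" using d unfolding i by (auto elim!: dvdE)
    then have r: "m - 3 = 26 * r" using i by simp
    from m have "m \<ge> 3" by simp
    then have "m = 26 * r + 3" using r by linarith
    moreover have "8 * int r + 1 = (4 * k - 1)\<^sup>2" using k r by simp
    ultimately have "4 * int m + 1 = 13 * (4 * k - 1)\<^sup>2" by simp
    then show ?thesis using that by blast
  qed
qed

lemma descent_9: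
  fixes c y r :: int
  assumes "\<not> 3 dvd c" "9 ^ a * r = c * y\<^sup>2"
  obtains z where "r = c * z\<^sup>2"
  using assms(2)
proof (induction a arbitrary: y thesis)
  case 0
  show ?case by (rule 0(1)[of y]) (use 0(2) in simp)
next
  case (Suc a)
  have "3 dvd c * y\<^sup>2" unfolding Suc.prems(2)[symmetric] by (simp add: power_Suc mult.assoc)
  moreover have "prime (3 :: int)" by (simp add: prime_int_numeral_eq)
  ultimately have "3 dvd y" using assms(1) by (metis prime_dvd_mult_iff prime_dvd_power)
  then obtain y' where "y = 3 * y'" by (elim dvdE)
  then have "9 ^ a * r = c * y'\<^sup>2" using Suc.prems(2) by (simp add: power_mult_distrib)
  then show ?case using Suc.IH Suc.prems(1) by blast
qed

text \<open>Squares modulo 9 lie in {0, 1, 4, 7}, and multiplication by 13 = 4 preserves this set;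
  the conditions on r avoid it. \<open>descent_9\<close> first strips the power of 9.\<close>

lemma even_b_13:
  assumes "2 * m + 1 = 9 ^ a * r" "r mod 4 = 1" "r mod 9 = 3 \<or> r mod 9 = 6 \<or> r mod 3 = 2"
  shows "even (b 13 m)"
proof (rule ccontr)
  assume odd: "odd (b 13 m)"
  have "9 ^ a mod 4 = (1 :: nat)" by (induction a) (auto simp: mod_mult_eq[of 9, symmetric] mod_Suc)
  then have "(2 * m + 1) mod 4 = 1" unfolding assms(1) using assms(2) by (metis mod_mult_eq mult_1 mod_mod_trivial)
  then have "even m" by presburger
  then obtain i where i: "m = 2 * i" by (elim evenE)
  obtain y c :: int where c: "4 * int i + 1 = c * y\<^sup>2" "c = 1 \<or> c = 13"
    using b_13_mod_2 odd unfolding i by blast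
  have "9 ^ a * int r = int (9 ^ a * r)" by simp
  also have "\<dots> = 4 * int i + 1" unfolding assms(1)[symmetric] i by simp
  finally have "9 ^ a * int r = c * y\<^sup>2" using c(1) by simp
  moreover have "\<not> 3 dvd c" using c(2) by auto
  ultimately obtain z where z: "int r = c * z\<^sup>2" using descent_9 by blast
  have "z\<^sup>2 mod 9 \<in> {0, 1, 4, 7}"
  proof -
    have "z mod 9 = 0 \<or> z mod 9 = 1 \<or> z mod 9 = 2 \<or> z mod 9 = 3 \<or> z mod 9 = 4 \<or> z mod 9 = 5 \<or>
        z mod 9 = 6 \<or> z mod 9 = 7 \<or> z mod 9 = 8" by presburger
    then show ?thesis unfolding power_mod[of z 9 2, symmetric] by (elim disjE) simp_all
  qed
  then have "int r mod 9 \<in> {0, 1, 4, 7}"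
    using c(2) unfolding z by (auto simp: mod_mult_eq[of 13, symmetric] mod_mult_right_eq[of 13, symmetric])
  then have "r mod 9 = 0 \<or> r mod 9 = 1 \<or> r mod 9 = 4 \<or> r mod 9 = 7"
    by (auto simp: zmod_int[of r 9, simplified, symmetric])
  then show False using assms(3) mod_mod_cancel[of 3 9 r] by (elim disjE) simp_all
qed

theorem theorem3p15:
  fixes \<alpha> n :: nat
  assumes "\<alpha> \<ge> 1"
  shows "b 13 (4 * 3 ^ (2 * \<alpha> + 1) * n + (17 * 3 ^ (2 * \<alpha>) - 1) div 2) mod 6 = 0 \<and>
         b 13 (4 * 3 ^ (2 * \<alpha>) * n + (11 * 3 ^ (2 * \<alpha> - 1) - 1) div 2) mod 6 = 0"
proof -
  obtain j where j: "\<alpha> = Suc j" using assms by (cases \<alpha>) auto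
  have six: "k mod 6 = 0" if "even k" "3 dvd k" for k :: nat using that by presburger
  have nine: "3 ^ (2 * i) = (9 :: nat) ^ i" for i by (simp add: power_mult)
  let ?m1 = "4 * 3 ^ (2 * \<alpha> + 1) * n + (17 * 3 ^ (2 * \<alpha>) - 1) div 2"
  let ?m2 = "4 * 3 ^ (2 * \<alpha>) * n + (11 * 3 ^ (2 * \<alpha> - 1) - 1) div 2"
  have half: "2 * ((k - 1) div 2) + 1 = k" if "odd k" for k :: nat using that by (elim oddE) simp
  have "2 * ?m1 + 1 = 8 * 3 ^ (2 * \<alpha> + 1) * n + 17 * 3 ^ (2 * \<alpha>)"
    using half[of "17 * 3 ^ (2 * \<alpha>)"] by simp
  then have m1: "2 * ?m1 + 1 = 3 ^ (2 * \<alpha>) * (24 * n + 17)" by (simp add: algebra_simps)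
  have "2 * ?m2 + 1 = 8 * 3 ^ (2 * \<alpha>) * n + 11 * 3 ^ (2 * \<alpha> - 1)"
    using half[of "11 * 3 ^ (2 * \<alpha> - 1)"] by simp
  then have m2: "2 * ?m2 + 1 = 3 ^ Suc (2 * j) * (24 * n + 11)" by (simp add: j algebra_simps)
  have "3 dvd b 13 ?m1"
    by (rule b_13_mod_3_progression[of _ "Suc (2 * j)" "4 * n + 2"]) (use m1 j in simp)
  moreover have r1: "(24 * n + 17) mod 4 = 1" "(24 * n + 17) mod 3 = 2" by presburger+
  have "even (b 13 ?m1)"
    by (rule even_b_13[of _ \<alpha> "24 * n + 17"]) (use m1 nine r1 in simp_all)
  moreover have "3 dvd b 13 ?m2"
    by (rule b_13_mod_3_progression[of _ "2 * j" "4 * n + 1"]) (use m2 in simp)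
  \<comment> \<open>The exponent of 3 is odd here, so one factor 3 stays with 24n + 11 and the
    residue 6 modulo 9 excludes squares.\<close>
  moreover have r2: "(72 * n + 33) mod 4 = 1" "(72 * n + 33) mod 9 = 6" by presburger+
  have "even (b 13 ?m2)"
    by (rule even_b_13[of _ j "3 * (24 * n + 11)"]) (use m2 nine r2 in \<open>simp_all add: algebra_simps\<close>)
  ultimately show ?thesis using six by blast
qed

end
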